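(* Let $M$ be a Riemannian manifold of dimension $n\geqslant 3$ with a Newtonian dynamical system with force field $\mathbf F$ on it. The system satisfies the additional normality condition if and only if, at all points $q=(p,\mathbf v)$ of the tangent bundle $TM$ with $\mathbf v\ne0$, the force field satisfies for all $\varepsilon,\sigma=1,\ldots,n$ the equations $$\sum^n_{i=1}\sum^n_{j=1}P^i_\varepsilon P^j_\sigma\Bigl(\sum^n_{m=1}N^m\frac{F_i\,\tilde\nabla_mF_j}{v}-\nabla_iF_j\Bigr)=\sum^n_{i=1}\sum^n_{j=1}P^i_\varepsilon P^j_\sigma\Bigl(\sum^n_{m=1}N^m\frac{F_j\,\tilde\nabla_mF_i}{v}-\nabla_jF_i\Bigr),$$ $$\sum^n_{i=1}\sum^n_{j=1}P^j_\sigma\,\tilde\nabla_jF^i\,P^\varepsilon_i=\sum^n_{i=1}\sum^n_{j=1}\sum^n_{m=1}\frac{P^j_m\,\tilde\nabla_jF^i\,P^m_i}{n-1}\,P^\varepsilon_\sigma .$$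
   Context: $M$ is a smooth Riemannian manifold with metric $\mathbf g$, scalar product $(\cdot\,|\,\cdot)$ and Levi-Civita connection with components $\Gamma^k_{ij}$. Indices are raised and lowered with $g$. In a local chart $x^1,\ldots,x^n$ of $M$ the tangent bundle $TM$ has coordinates $(x^1,\ldots,x^n,v^1,\ldots,v^n)$. Newtonian dynamical system. A force field is a smooth extended vector field $\mathbf F$: to each $q=(p,\mathbf v)\in TM$ it assigns $\mathbf F(p,\mathbf v)\in T_pM$. The Newtonian dynamical system with force field $\mathbf F$ is $\dot x^k=v^k$, $\nabla_tv^k=F^k(x,v)$, where $\nabla_tv^k=\dot v^k+\sum_{i,j}\Gamma^k_{ij}v^iv^j$. Its trajectories are the curves $p(t)$ in $M$ with velocity $\mathbf v(t)=\dot p(t)$ solving these equations. Gradients of extended fields. Spatial gradient $\nabla_iF^k=\frac{\partial F^k}{\partial x^i}-\sum_{a,b}v^a\Gamma^b_{ia}\frac{\partial F^k}{\partial v^b}+\sum_a\Gamma^k_{ia}F^a$, $\nabla_iF_k=\frac{\partial F_k}{\partial x^i}-\sum_{a,b}v^a\Gamma^b_{ia}\frac{\partial F_k}{\partial v^b}-\sum_a\Gamma^a_{ik}F_a$; velocity gradient $\tilde\nabla_iF^k=\frac{\partial F^k}{\partial v^i}$, $\tilde\nabla_iF_k=\frac{\partial F_k}{\partial v^i}$. At points with $\mathbf v\ne0$: $v=|\mathbf v|$, $N^i=v^i/v$, $N_i=\sum_jg_{ij}N^j$, $P^i_j=\delta^i_j-N^iN_j$. Transformation class. A hypersurface $S\subset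 M$ belongs to transformation class if it is a connected, simply connected, open hypersurface with compact closure and $S\Subset S'$ (the closure of $S$ is compact and contained in $S'$) for some other open hypersurface $S'$. A smooth function $\nu$ on such $S$ belongs to transformation class on $S$ if it extends smoothly to some bigger open hypersurface $S'$ with $S\Subset S'$ and is nonzero everywhere on the closure $\overline S$. Shift. Let $S$ be a hypersurface of transformation class with a fixed smooth field of unit normals $\mathbf n(p)$, and $\nu$ a function of transformation class on $S$. For each $p\in S$ take the trajectory with initial data $x^k(0)=x^k(p)$, $v^k(0)=\nu(p)\,n^k(p)$; let $f_t$ map $p$ to the point of this trajectory at time $t$ and let $S_t=f_t(S)$ (for small $|t|$). If $u^1,\ldots,u^{n-1}$ are local coordinates on $S$ and $x^k(u^1,\ldots,u^{n-1},t)$ describe the shift, the vectors of variation $\boldsymbol\tau_k$ have components $\partial x^j/\partial u^k$, and the functions of deviation are $\varphi_k=(\boldsymbol\tau_k\,|\,\mathbf v)$, $k=1,\ldots,n-1$. Additional normality condition: for any hypersurface $S$ in $M$, any point $p_0\in S$ and any real $\nu_0\neq0$ there exist a smaller piece $S'$ of $S$ belonging to transformation class and containing $p_0$, and a function $\nu(p)$ of transformation class on $S'$ with $\nu(p_0)=\nu_0$, such that for the shift $f_t:S'\to S'_t$ it defines one has $\dot\varphi_k(t)|_{t=0}=0$ for $k=1,\ldots,n-1$ (this does not depend on the choice of local coordinates on $S$). *)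

theory Defs
  imports "HOL-Analysis.Analysis"
begin

primrec Ck_on ::
  "nat \<Rightarrow> 'a::euclidean_space set \<Rightarrow> ('a \<Rightarrow> 'b::real_normed_vector) \<Rightarrow> bool" where
  "Ck_on 0 U f \<longleftrightarrow> continuous_on U f"
| "Ck_on (Suc k) U f \<longleftrightarrow>
     (\<forall>x\<in>U. f differentiable (at x)) \<and>
     (\<forall>b\<in>Basis. Ck_on k U (\<lambda>x. frechet_derivative f (at x) b))"

text \<open>Only meaningful for open sets; all the domains used below are open.\<close>

definition smooth_on :: "'a::euclidean_space set \<Rightarrow> ('a \<Rightarrow> 'b::real_normed_vector) \<Rightarrow> bool" where
  "smooth_on U f \<longleftrightarrow> (\<forall>k. Ck_on k U f)"

definition partial :: "'n \<Rightarrow> (real^'n \<Rightarrow> real) \<Rightarrow> real^'n \<Rightarrow> real" where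
  "partial i f x = frechet_derivative f (at x) (axis i 1)"

text \<open>A manifold is a whole Hausdorff, second countable type \<open>'m\<close> together with a maximal smooth
  atlas; its dimension is \<open>CARD('n)\<close>.\<close>

record ('m, 'n) chart =
  cdom :: "'m set"
  cmap :: "'m \<Rightarrow> real^'n"

definition cinv :: "('m, 'n::finite) chart \<Rightarrow> real^'n \<Rightarrow> 'm" where
  "cinv c = inv_into (cdom c) (cmap c)"

definition is_chart :: "('m::topological_space, 'n::finite) chart \<Rightarrow> bool" where
  "is_chart c \<longleftrightarrow> open (cdom c) \<and> open (cmap c ` cdom c) \<and>
     homeomorphism (cdom c) (cmap c ` cdom c) (cmap c) (cinv c)"

definition compatible :: "('m::topological_space, 'n::finite) chart \<Rightarrow> ('m, 'n) chart \<Rightarrow> bool" where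
  "compatible c d \<longleftrightarrow>
     smooth_on (cmap c ` (cdom c \<inter> cdom d)) (cmap d \<circ> cinv c) \<and>
     smooth_on (cmap d ` (cdom c \<inter> cdom d)) (cmap c \<circ> cinv d)"

definition smooth_manifold ::
  "('m::{t2_space,second_countable_topology}, 'n::finite) chart set \<Rightarrow> bool" where
  "smooth_manifold A \<longleftrightarrow>
     (\<forall>c\<in>A. is_chart c) \<and>
     (\<Union>c\<in>A. cdom c) = UNIV \<and>
     (\<forall>c\<in>A. \<forall>d\<in>A. compatible c d) \<and>
     (\<forall>c. is_chart c \<longrightarrow> (\<forall>d\<in>A. compatible c d) \<longrightarrow> c \<in> A)"

text \<open>A tangent vector at \<open>p\<close> is the family of its components in all the charts around \<open>p\<close>, related
  by the Jacobians of the transition maps. It is set to 0 on the other charts, so that equality of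
  tangent vectors is equality of functions.\<close>

type_synonym ('m, 'n) tvec = "('m, 'n) chart \<Rightarrow> real^'n"

definition tangent_space ::
  "('m::topological_space, 'n::finite) chart set \<Rightarrow> 'm \<Rightarrow> ('m, 'n) tvec set" where
  "tangent_space A p = {w.
     (\<forall>c\<in>A. \<forall>d\<in>A. p \<in> cdom c \<inter> cdom d \<longrightarrow>
        w d = frechet_derivative (cmap d \<circ> cinv c) (at (cmap c p)) (w c)) \<and>
     (\<forall>c. \<not> (c \<in> A \<and> p \<in> cdom c) \<longrightarrow> w c = 0)}"

text \<open>The tangent vector at \<open>p\<close> with components \<open>a\<close> in the chart \<open>c\<close>.\<close>

definition tvec_of ::
  "('m::topological_space, 'n::finite) chart set \<Rightarrow> ('m, 'n) chart \<Rightarrow> 'm \<Rightarrow> real^'n \<Rightarrow> ('m, 'n) tvec" where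
  "tvec_of A c p a = (\<lambda>d. if d \<in> A \<and> p \<in> cdom d
     then frechet_derivative (cmap d \<circ> cinv c) (at (cmap c p)) a else 0)"

definition velocity ::
  "('m::topological_space, 'n::finite) chart set \<Rightarrow> (real \<Rightarrow> 'm) \<Rightarrow> real \<Rightarrow> ('m, 'n) tvec" where
  "velocity A \<gamma> t = (\<lambda>c. if c \<in> A \<and> \<gamma> t \<in> cdom c
     then vector_derivative (cmap c \<circ> \<gamma>) (at t) else 0)"

type_synonym ('m, 'n) metric = "'m \<Rightarrow> ('m, 'n) tvec \<Rightarrow> ('m, 'n) tvec \<Rightarrow> real"
type_synonym ('m, 'n) force = "'m \<Rightarrow> ('m, 'n) tvec \<Rightarrow> ('m, 'n) tvec"

definition metric_matrix ::
  "('m::topological_space, 'n::finite) chart set \<Rightarrow> ('m, 'n) metric \<Rightarrow> ('m, 'n) chart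
    \<Rightarrow> real^'n \<Rightarrow> real^'n^'n" where
  "metric_matrix A g c x = (\<chi> i j.
     g (cinv c x) (tvec_of A c (cinv c x) (axis i 1)) (tvec_of A c (cinv c x) (axis j 1)))"

definition riemannian_metric ::
  "('m::topological_space, 'n::finite) chart set \<Rightarrow> ('m, 'n) metric \<Rightarrow> bool" where
  "riemannian_metric A g \<longleftrightarrow>
     (\<forall>p. \<forall>u\<in>tangent_space A p. \<forall>v\<in>tangent_space A p. \<forall>w\<in>tangent_space A p.
        g p u v = g p v u \<and>
        (\<forall>a b. g p (\<lambda>c. a *\<^sub>R u c + b *\<^sub>R v c) w = a * g p u w + b * g p v w)) \<and>
     (\<forall>p. \<forall>u\<in>tangent_space A p. u \<noteq> (\<lambda>_. 0) \<longrightarrow> g p u u > 0) \<and>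
     (\<forall>c\<in>A. smooth_on (cmap c ` cdom c) (metric_matrix A g c))"

text \<open>\<open>christoffel A g c k i j x\<close> is $\Gamma^k_{ij}$ at the point with coordinates \<open>x\<close> in \<open>c\<close>.\<close>

definition christoffel ::
  "('m::topological_space, 'n::finite) chart set \<Rightarrow> ('m, 'n) metric \<Rightarrow> ('m, 'n) chart
    \<Rightarrow> 'n \<Rightarrow> 'n \<Rightarrow> 'n \<Rightarrow> real^'n \<Rightarrow> real" where
  "christoffel A g c k i j x =
     (\<Sum>l\<in>UNIV. matrix_inv (metric_matrix A g c x) $ k $ l *
        (partial i (\<lambda>y. metric_matrix A g c y $ l $ j) x
         + partial j (\<lambda>y. metric_matrix A g c y $ i $ l) x
         - partial l (\<lambda>y. metric_matrix A g c y $ i $ j) x)) / 2"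

definition force_up ::
  "('m::topological_space, 'n::finite) chart set \<Rightarrow> ('m, 'n) force \<Rightarrow> ('m, 'n) chart
    \<Rightarrow> real^'n \<Rightarrow> real^'n \<Rightarrow> real^'n" where
  "force_up A F c x v = F (cinv c x) (tvec_of A c (cinv c x) v) c"

definition force_down ::
  "('m::topological_space, 'n::finite) chart set \<Rightarrow> ('m, 'n) metric \<Rightarrow> ('m, 'n) force
    \<Rightarrow> ('m, 'n) chart \<Rightarrow> real^'n \<Rightarrow> real^'n \<Rightarrow> real^'n" where
  "force_down A g F c x v = metric_matrix A g c x *v force_up A F c x v"

definition force_field ::
  "('m::topological_space, 'n::finite) chart set \<Rightarrow> ('m, 'n) force \<Rightarrow> bool" where
  "force_field A F \<longleftrightarrow>
     (\<forall>p. \<forall>v\<in>tangent_space A p. F p v \<in> tangent_space A p) \<and>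
     (\<forall>c\<in>A. smooth_on ((cmap c ` cdom c) \<times> UNIV) (\<lambda>(x, v). force_up A F c x v))"

text \<open>\<open>vgrad_up A F c i k\<close> is $\tilde\nabla_i F^k$, \<open>vgrad_down A g F c i k\<close> is $\tilde\nabla_i F_k$ and
  \<open>sgrad_down A g F c i k\<close> is $\nabla_i F_k$.\<close>

definition vgrad_up ::
  "('m::topological_space, 'n::finite) chart set \<Rightarrow> ('m, 'n) force \<Rightarrow> ('m, 'n) chart
    \<Rightarrow> 'n \<Rightarrow> 'n \<Rightarrow> real^'n \<Rightarrow> real^'n \<Rightarrow> real" where
  "vgrad_up A F c i k x v = partial i (\<lambda>w. force_up A F c x w $ k) v"

definition vgrad_down ::
  "('m::topological_space, 'n::finite) chart set \<Rightarrow> ('m, 'n) metric \<Rightarrow> ('m, 'n) force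
    \<Rightarrow> ('m, 'n) chart \<Rightarrow> 'n \<Rightarrow> 'n \<Rightarrow> real^'n \<Rightarrow> real^'n \<Rightarrow> real" where
  "vgrad_down A g F c i k x v = partial i (\<lambda>w. force_down A g F c x w $ k) v"

definition sgrad_down ::
  "('m::topological_space, 'n::finite) chart set \<Rightarrow> ('m, 'n) metric \<Rightarrow> ('m, 'n) force
    \<Rightarrow> ('m, 'n) chart \<Rightarrow> 'n \<Rightarrow> 'n \<Rightarrow> real^'n \<Rightarrow> real^'n \<Rightarrow> real" where
  "sgrad_down A g F c i k x v =
     partial i (\<lambda>y. force_down A g F c y v $ k) x
     - (\<Sum>a\<in>UNIV. \<Sum>b\<in>UNIV. v $ a * christoffel A g c b i a x * vgrad_down A g F c b k x v)
     - (\<Sum>a\<in>UNIV. christoffel A g c a i k x * force_down A g F c x v $ a)"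

definition unit_up ::
  "('m, 'n::finite) metric \<Rightarrow> ('m, 'n) chart \<Rightarrow> 'm \<Rightarrow> ('m, 'n) tvec \<Rightarrow> 'n \<Rightarrow> real" where
  "unit_up g c p v i = v c $ i / sqrt (g p v v)"

definition unit_down ::
  "('m::topological_space, 'n::finite) chart set \<Rightarrow> ('m, 'n) metric \<Rightarrow> ('m, 'n) chart
    \<Rightarrow> 'm \<Rightarrow> ('m, 'n) tvec \<Rightarrow> 'n \<Rightarrow> real" where
  "unit_down A g c p v i =
     (\<Sum>j\<in>UNIV. metric_matrix A g c (cmap c p) $ i $ j * unit_up g c p v j)"

text \<open>\<open>projector A g c p v i j\<close> is $P^i_j = \delta^i_j - N^i N_j$ (upper index first).\<close>

definition projector ::
  "('m::topological_space, 'n::finite) chart set \<Rightarrow> ('m, 'n) metric \<Rightarrow> ('m, 'n) chart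
    \<Rightarrow> 'm \<Rightarrow> ('m, 'n) tvec \<Rightarrow> 'n \<Rightarrow> 'n \<Rightarrow> real" where
  "projector A g c p v i j =
     (if i = j then 1 else 0) - unit_up g c p v i * unit_down A g c p v j"

definition trajectory ::
  "('m::topological_space, 'n::finite) chart set \<Rightarrow> ('m, 'n) metric \<Rightarrow> ('m, 'n) force
    \<Rightarrow> real set \<Rightarrow> (real \<Rightarrow> 'm) \<Rightarrow> bool" where
  "trajectory A g F I \<gamma> \<longleftrightarrow> continuous_on I \<gamma> \<and>
     (\<forall>t\<in>I. \<forall>c\<in>A. \<gamma> t \<in> cdom c \<longrightarrow>
        (cmap c \<circ> \<gamma>) differentiable (at t) \<and>
        (\<exists>a. ((\<lambda>s. velocity A \<gamma> s c) has_vector_derivative a) (at t) \<and>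
           (\<forall>k. a $ k + (\<Sum>i\<in>UNIV. \<Sum>j\<in>UNIV. christoffel A g c k i j (cmap c (\<gamma> t))
                             * velocity A \<gamma> t c $ i * velocity A \<gamma> t c $ j)
                = F (\<gamma> t) (velocity A \<gamma> t) c $ k)))"

text \<open>Hypersurfaces are embedded submanifolds of codimension one without boundary, described by slice
  charts, i.e. charts of the manifold in which \<open>S\<close> is the set \<open>x $ i = 0\<close>. The remaining coordinates
  \<open>x $ k\<close>, \<open>k \<noteq> i\<close>, are local coordinates on \<open>S\<close>; as the atlas is maximal, every system of local
  coordinates on \<open>S\<close> arises in this way near each point.\<close>

definition slice_chart ::
  "('m::topological_space, 'n::finite) chart set \<Rightarrow> 'm set \<Rightarrow> ('m, 'n) chart \<Rightarrow> 'n \<Rightarrow> bool" where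
  "slice_chart A S c i \<longleftrightarrow> c \<in> A \<and>
     cmap c ` (cdom c \<inter> S) = cmap c ` cdom c \<inter> {x. x $ i = 0}"

definition hypersurface ::
  "('m::topological_space, 'n::finite) chart set \<Rightarrow> 'm set \<Rightarrow> bool" where
  "hypersurface A S \<longleftrightarrow> (\<forall>p\<in>S. \<exists>c i. slice_chart A S c i \<and> p \<in> cdom c)"

definition zero_coord :: "'n \<Rightarrow> real^'n \<Rightarrow> real^'n" where
  "zero_coord i x = (\<chi> j. if j = i then 0 else x $ j)"

text \<open>Smoothness in the local coordinates \<open>x $ k\<close>, \<open>k \<noteq> i\<close>, of \<open>S\<close>. The function of these \<open>n - 1\<close>
  variables is read as a function on an open subset of \<open>real^'n\<close> not depending on \<open>x $ i\<close>.\<close>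

definition smooth_in_slice ::
  "('m::topological_space, 'n::finite) chart \<Rightarrow> 'n \<Rightarrow> ('m \<Rightarrow> 'b::real_normed_vector) \<Rightarrow> bool" where
  "smooth_in_slice c i h \<longleftrightarrow>
     smooth_on {x. zero_coord i x \<in> cmap c ` cdom c} (\<lambda>x. h (cinv c (zero_coord i x)))"

definition smooth_function_on ::
  "('m::topological_space, 'n::finite) chart set \<Rightarrow> 'm set \<Rightarrow> ('m \<Rightarrow> real) \<Rightarrow> bool" where
  "smooth_function_on A S h \<longleftrightarrow> (\<forall>c i. slice_chart A S c i \<longrightarrow> smooth_in_slice c i h)"

definition tangent_to ::
  "('m::topological_space, 'n::finite) chart set \<Rightarrow> 'm set \<Rightarrow> 'm \<Rightarrow> ('m, 'n) tvec set" where
  "tangent_to A S p = {w \<in> tangent_space A p.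
     \<forall>c i. slice_chart A S c i \<and> p \<in> cdom c \<longrightarrow> w c $ i = 0}"

definition unit_normal_field ::
  "('m::topological_space, 'n::finite) chart set \<Rightarrow> ('m, 'n) metric \<Rightarrow> 'm set
    \<Rightarrow> ('m \<Rightarrow> ('m, 'n) tvec) \<Rightarrow> bool" where
  "unit_normal_field A g S n \<longleftrightarrow>
     (\<forall>p\<in>S. n p \<in> tangent_space A p \<and> g p (n p) (n p) = 1 \<and>
        (\<forall>w\<in>tangent_to A S p. g p (n p) w = 0)) \<and>
     (\<forall>c i. slice_chart A S c i \<longrightarrow> smooth_in_slice c i (\<lambda>p. n p c))"

definition relatively_compact_in ::
  "('m::topological_space, 'n::finite) chart set \<Rightarrow> 'm set \<Rightarrow> 'm set \<Rightarrow> bool" where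
  "relatively_compact_in A S S' \<longleftrightarrow>
     hypersurface A S' \<and> S' \<noteq> S \<and> compact (closure S) \<and> closure S \<subseteq> S'"

definition transformation_class ::
  "('m::topological_space, 'n::finite) chart set \<Rightarrow> 'm set \<Rightarrow> bool" where
  "transformation_class A S \<longleftrightarrow>
     hypersurface A S \<and> connected S \<and> simply_connected S \<and> compact (closure S) \<and>
     (\<exists>S'. relatively_compact_in A S S')"

definition transformation_function ::
  "('m::topological_space, 'n::finite) chart set \<Rightarrow> 'm set \<Rightarrow> ('m \<Rightarrow> real) \<Rightarrow> bool" where
  "transformation_function A S \<nu> \<longleftrightarrow>
     (\<exists>S' \<nu>'. relatively_compact_in A S S' \<and> smooth_function_on A S' \<nu>' \<and>
        (\<forall>p\<in>S. \<nu>' p = \<nu> p) \<and> (\<forall>p\<in>closure S. \<nu>' p \<noteq> 0))"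

definition is_shift ::
  "('m::topological_space, 'n::finite) chart set \<Rightarrow> ('m, 'n) metric \<Rightarrow> ('m, 'n) force
    \<Rightarrow> 'm set \<Rightarrow> ('m \<Rightarrow> ('m, 'n) tvec) \<Rightarrow> ('m \<Rightarrow> real) \<Rightarrow> real \<Rightarrow> (real \<Rightarrow> 'm \<Rightarrow> 'm) \<Rightarrow> bool" where
  "is_shift A g F S n \<nu> \<delta> f \<longleftrightarrow> \<delta> > 0 \<and>
     (\<forall>p\<in>S. trajectory A g F {-\<delta><..<\<delta>} (\<lambda>t. f t p) \<and>
        f 0 p = p \<and> velocity A (\<lambda>t. f t p) 0 = (\<lambda>c. \<nu> p *\<^sub>R n p c))"

text \<open>The vector of variation at \<open>f t p\<close> belonging to the local coordinate \<open>x $ k\<close> of a slice chart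
  \<open>c\<close>, \<open>k \<noteq> i\<close>. For \<open>p\<close> on \<open>S\<close> and small \<open>s\<close> the point with coordinates
  \<open>cmap c p + s *\<^sub>R axis k 1\<close> lies on \<open>S\<close>, so its image under \<open>f t\<close> is determined.\<close>

definition variation ::
  "('m::topological_space, 'n::finite) chart set \<Rightarrow> (real \<Rightarrow> 'm \<Rightarrow> 'm) \<Rightarrow> ('m, 'n) chart
    \<Rightarrow> 'n \<Rightarrow> 'm \<Rightarrow> real \<Rightarrow> ('m, 'n) tvec" where
  "variation A f c k p t = velocity A (\<lambda>s. f t (cinv c (cmap c p + s *\<^sub>R axis k 1))) 0"

definition deviation ::
  "('m::topological_space, 'n::finite) chart set \<Rightarrow> ('m, 'n) metric \<Rightarrow> (real \<Rightarrow> 'm \<Rightarrow> 'm)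
    \<Rightarrow> ('m, 'n) chart \<Rightarrow> 'n \<Rightarrow> 'm \<Rightarrow> real \<Rightarrow> real" where
  "deviation A g f c k p t =
     g (f t p) (variation A f c k p t) (velocity A (\<lambda>s. f s p) t)"

text \<open>The condition is required for each of the two smooth unit normal fields on \<open>S'\<close>. These exist
  because \<open>S'\<close> is simply connected; their existence is nevertheless stated, which makes it evident
  that the condition is not vacuous.\<close>

definition additional_normality ::
  "('m::topological_space, 'n::finite) chart set \<Rightarrow> ('m, 'n) metric \<Rightarrow> ('m, 'n) force \<Rightarrow> bool" where
  "additional_normality A g F \<longleftrightarrow>
     (\<forall>S p\<^sub>0 \<nu>\<^sub>0. hypersurface A S \<and> p\<^sub>0 \<in> S \<and> \<nu>\<^sub>0 \<noteq> 0 \<longrightarrow>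
       (\<exists>S'. S' \<subseteq> S \<and> p\<^sub>0 \<in> S' \<and> transformation_class A S' \<and>
         (\<exists>n. unit_normal_field A g S' n) \<and>
         (\<forall>n. unit_normal_field A g S' n \<longrightarrow>
           (\<exists>\<nu>. transformation_function A S' \<nu> \<and> \<nu> p\<^sub>0 = \<nu>\<^sub>0 \<and>
             (\<exists>\<delta> f. is_shift A g F S' n \<nu> \<delta> f \<and>
               (\<forall>c i k p. slice_chart A S' c i \<and> k \<noteq> i \<and> p \<in> S' \<inter> cdom c \<longrightarrow>
                 (deviation A g f c k p has_real_derivative 0) (at 0)))))))"

end

theory Submission
  imports Defs
begin

text \<open>
  At time 0 the derivative of the deviation functions is $\nu\,\partial_k\nu + (\mathbf F\,|\,\tau_k)$,
  because $\nabla_t\tau_k = \nabla_{u^k}\mathbf v$ and $\mathbf v = \nu\mathbf n$. Hence additional normality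
  says that on every hypersurface the Pfaff system $\partial_k\nu = -F_k(x, \nu n)/\nu$ has solutions with
  arbitrary nonzero initial value. The cross derivatives of this system agree at a point iff
  $-\alpha_{lk} + \nu \sum_{j,m} \tilde\nabla_m F_j\,(\nabla_l n)^m \tau_k^j$ is symmetric in $l$ and $k$, where
  $\alpha$ is the bracket of the first family of equations. The derivative of the normal is an
  arbitrary symmetric operator, as hypersurfaces through a point can have any second fundamental
  form. If it vanishes, the first family results; rank one operators then force the projection of
  $\tilde\nabla F$ to have every vector as an eigenvector, hence to be scalar, which is the second
  family. Conversely, the two families make the system integrable.
\<close>

section \<open>Smooth functions\<close>

text \<open>The geometry is done in components of one chart: the connection enters as the bilinear
  map \<open>Gam\<close>, known through the Koszul formula. In the derivative of the deviation the
  term nu d_k nu is half the derivative of |v|^2 = nu^2 along the hypersurface; hence the derivative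
  of the normal drops out at first order and returns only in the cross derivatives, where
  hypersurfaces of prescribed curvature probe it. Three obstacles shape the rest. A shift is a
  family of trajectories with no regularity in the initial point assumed, so differentiability in
  that point, near time 0, is derived from estimates for the differential equation. The piece S'
  supplied by the condition is just some hypersurface inside S; invariance of domain makes it open
  in S, so that both have the same curvature at the point. In the converse direction S' must be
  fixed before the unit normal is given, so the Pfaff system is solved for both signs of the initial
  value and a common radius is taken.\<close>

lemma frechet_derivative_cong_open:
  assumes "open U" "x \<in> U" "\<And>y. y \<in> U \<Longrightarrow> f y = g y"
  shows "frechet_derivative f (at x) = frechet_derivative g (at x)"
    and "f differentiable (at x) \<longleftrightarrow> g differentiable (at x)"
proof -
  have "(f has_derivative D) (at x) \<longleftrightarrow> (g has_derivative D) (at x)" for D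
    using assms by (metis has_derivative_transform_within_open)
  then show "frechet_derivative f (at x) = frechet_derivative g (at x)"
    "f differentiable (at x) \<longleftrightarrow> g differentiable (at x)"
    unfolding frechet_derivative_def differentiable_def by auto
qed

lemma Ck_on_cong:
  assumes "open U" "\<And>y. y \<in> U \<Longrightarrow> f y = g y"
  shows "Ck_on k U f \<longleftrightarrow> Ck_on k U g"
  using assms(2)
proof (induction k arbitrary: f g)
  case 0
  then show ?case by (auto intro: continuous_on_cong)
next
  case (Suc k)
  note c = frechet_derivative_cong_open[OF assms(1) _ Suc.prems]
  have "Ck_on k U (\<lambda>x. frechet_derivative f (at x) b) \<longleftrightarrow> Ck_on k U (\<lambda>x. frechet_derivative g (at x) b)" for b
    by (rule Suc.IH) (simp add: c(1))
  then show ?case using c(2) by auto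
qed

text \<open>The engine of the closure properties below: once the derivative is written by a formula,
  an induction on k has to treat that formula only at basis vectors.\<close>

lemma Ck_on_SucI:
  assumes "open U" "\<And>x. x \<in> U \<Longrightarrow> (f has_derivative f' x) (at x)"
    and "\<And>b. b \<in> Basis \<Longrightarrow> Ck_on k U (\<lambda>x. f' x b)"
  shows "Ck_on (Suc k) U f"
proof -
  have "frechet_derivative f (at x) = f' x" if "x \<in> U" for x
    using assms(2)[OF that] frechet_derivative_at by fastforce
  then have "Ck_on k U (\<lambda>x. frechet_derivative f (at x) b) \<longleftrightarrow> Ck_on k U (\<lambda>x. f' x b)" for b
    by (intro Ck_on_cong assms(1)) auto
  then show ?thesis using assms(2,3) by (auto simp: differentiable_def)
qed

lemma Ck_on_Suc_has_derivative:
  "Ck_on (Suc k) U f \<Longrightarrow> x \<in> U \<Longrightarrow> (f has_derivative frechet_derivative f (at x)) (at x)"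
  using frechet_derivative_works by fastforce

lemma Ck_on_SucD: "Ck_on (Suc k) U f \<Longrightarrow> Ck_on k U f"
proof (induction k arbitrary: f)
  case 0
  then show ?case
    by (auto simp: continuous_on_eq_continuous_within differentiable_imp_continuous_within
        intro: continuous_at_imp_continuous_at_within)
next
  case (Suc k)
  then show ?case by (metis Ck_on.simps(2))
qed

lemma Ck_on_le: "Ck_on k U f \<Longrightarrow> j \<le> k \<Longrightarrow> Ck_on j U f"
  by (induction k) (auto simp: le_Suc_eq dest: Ck_on_SucD simp del: Ck_on.simps)

lemma Ck_on_subset: "Ck_on k U f \<Longrightarrow> V \<subseteq> U \<Longrightarrow> Ck_on k V f"
  by (induction k arbitrary: f) (auto intro: continuous_on_subset)

lemma Ck_on_imp_continuous_on: "Ck_on k U f \<Longrightarrow> continuous_on U f"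
  using Ck_on_le[of k U f 0] by simp

section \<open>Closure of \<open>Ck_on\<close> under algebraic operations and composition\<close>

lemma Ck_on_const: "open U \<Longrightarrow> Ck_on k U (\<lambda>_. c)"
proof (induction k arbitrary: c)
  case (Suc k)
  show ?case by (rule Ck_on_SucI[where f' = "\<lambda>_ _. 0"]) (use Suc in auto)
qed auto

lemma Ck_on_bounded_linear:
  assumes "bounded_linear L" "open U" "Ck_on k U f"
  shows "Ck_on k U (\<lambda>x. L (f x))"
  using assms(3)
proof (induction k arbitrary: f)
  case 0
  then show ?case using assms(1) by (auto intro: bounded_linear.continuous_on)
next
  case (Suc k)
  show ?case
  proof (rule Ck_on_SucI[OF assms(2), where f' = "\<lambda>x h. L (frechet_derivative f (at x) h)"])
    show "((\<lambda>x. L (f x)) has_derivative (\<lambda>h. L (frechet_derivative f (at x) h))) (at x)" if "x \<in> U" for x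
      by (intro bounded_linear.has_derivative[OF assms(1)] Ck_on_Suc_has_derivative[OF Suc.prems that])
    show "Ck_on k U (\<lambda>x. L (frechet_derivative f (at x) b))" if "b \<in> Basis" for b
      using Suc.prems that by (intro Suc.IH) auto
  qed
qed

lemma Ck_on_id: "open U \<Longrightarrow> Ck_on k U (\<lambda>x. x)"
proof (cases k)
  case (Suc j)
  assume U: "open U"
  show ?thesis unfolding Suc
    by (rule Ck_on_SucI[OF U, where f' = "\<lambda>_ h. h"]) (use U Ck_on_const in auto)
qed auto

lemma Ck_on_linear: "bounded_linear L \<Longrightarrow> open U \<Longrightarrow> Ck_on k U L"
  using Ck_on_bounded_linear[OF _ _ Ck_on_id] by blast

lemma Ck_on_add:
  assumes "open U" "Ck_on k U f" "Ck_on k U g"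
  shows "Ck_on k U (\<lambda>x. f x + g x)"
  using assms(2,3)
proof (induction k arbitrary: f g)
  case 0
  then show ?case by (auto intro: continuous_on_add)
next
  case (Suc k)
  show ?case
  proof (rule Ck_on_SucI[OF assms(1), where f' = "\<lambda>x h. frechet_derivative f (at x) h + frechet_derivative g (at x) h"])
    show "((\<lambda>x. f x + g x) has_derivative (\<lambda>h. frechet_derivative f (at x) h + frechet_derivative g (at x) h)) (at x)"
      if "x \<in> U" for x
      by (intro has_derivative_add Ck_on_Suc_has_derivative[OF Suc.prems(1) that] Ck_on_Suc_has_derivative[OF Suc.prems(2) that])
    show "Ck_on k U (\<lambda>x. frechet_derivative f (at x) b + frechet_derivative g (at x) b)" if "b \<in> Basis" for b
      using Suc.prems that by (intro Suc.IH) auto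
  qed
qed

text \<open>By the product rule the derivative is a sum of two values of B with one argument
  differentiated, so the induction hypothesis applies to each summand. Scalar multiples, products
  and inner products are instances.\<close>

lemma Ck_on_bilinear:
  assumes B: "bounded_bilinear B" and U: "open U" and "Ck_on k U f" "Ck_on k U g"
  shows "Ck_on k U (\<lambda>x. B (f x) (g x))"
  using assms(3,4)
proof (induction k arbitrary: f g)
  case 0
  then show ?case using B by (auto intro: bounded_bilinear.continuous_on)
next
  case (Suc k)
  let ?f = "\<lambda>x. frechet_derivative f (at x)" and ?g = "\<lambda>x. frechet_derivative g (at x)"
  show ?case
  proof (rule Ck_on_SucI[OF U, where f' = "\<lambda>x h. B (f x) (?g x h) + B (?f x h) (g x)"])
    show "((\<lambda>x. B (f x) (g x)) has_derivative (\<lambda>h. B (f x) (?g x h) + B (?f x h) (g x))) (at x)"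
      if "x \<in> U" for x
      by (rule bounded_bilinear.FDERIV[OF B])
        (use Suc.prems that Ck_on_Suc_has_derivative in blast)+
    show "Ck_on k U (\<lambda>x. B (f x) (?g x b) + B (?f x b) (g x))" if "b \<in> Basis" for b
      using Suc.prems that Ck_on_SucD[OF Suc.prems(1)] Ck_on_SucD[OF Suc.prems(2)]
      by (intro Ck_on_add U Suc.IH) auto
  qed
qed

lemmas Ck_on_scaleR = Ck_on_bilinear[OF bounded_bilinear_scaleR]
lemmas Ck_on_mult = Ck_on_bilinear[OF bounded_bilinear_mult]
lemmas Ck_on_inner = Ck_on_bilinear[OF bounded_bilinear_inner]
lemmas Ck_on_minus = Ck_on_bounded_linear[OF bounded_linear_minus[OF bounded_linear_ident]]

lemma Ck_on_diff: "open U \<Longrightarrow> Ck_on k U f \<Longrightarrow> Ck_on k U g \<Longrightarrow> Ck_on k U (\<lambda>x. f x - g x)"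
  using Ck_on_add[OF _ _ Ck_on_minus, of U k f g] by simp

lemma Ck_on_sum:
  assumes "open U" "\<And>i. i \<in> I \<Longrightarrow> Ck_on k U (f i)"
  shows "Ck_on k U (\<lambda>x. \<Sum>i\<in>I. f i x)"
  using assms(2) by (induction I rule: infinite_finite_induct)
    (auto intro: Ck_on_const Ck_on_add assms(1))

lemma Ck_on_prod:
  fixes f :: "'i \<Rightarrow> 'a::euclidean_space \<Rightarrow> real"
  assumes "open U" "\<And>i. i \<in> I \<Longrightarrow> Ck_on k U (f i)"
  shows "Ck_on k U (\<lambda>x. \<Prod>i\<in>I. f i x)"
  using assms(2) by (induction I rule: infinite_finite_induct)
    (auto intro: Ck_on_const Ck_on_mult assms(1))

text \<open>\<open>Ck_on\<close> speaks of derivatives at basis vectors only, whereas the chain rule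
  applies the derivative of g to a vector that varies with x. Expanding this vector in the basis
  leaves sums of products of functions covered by the induction hypothesis.\<close>

lemma Ck_on_compose:
  fixes f :: "'a::euclidean_space \<Rightarrow> 'b::euclidean_space"
  assumes U: "open U" and V: "open V"
    and "Ck_on k U f" "Ck_on k V g" "\<And>x. x \<in> U \<Longrightarrow> f x \<in> V"
  shows "Ck_on k U (\<lambda>x. g (f x))"
  using assms(3-)
proof (induction k arbitrary: g)
  case 0
  then show ?case by (auto intro!: continuous_on_compose2[of V g U f])
next
  case (Suc k)
  let ?f = "\<lambda>x. frechet_derivative f (at x)" and ?g = "\<lambda>x. frechet_derivative g (at x)"
  have gexp: "?g (f x) h = (\<Sum>b\<in>Basis. (h \<bullet> b) *\<^sub>R ?g (f x) b)" if "x \<in> U" for x h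
  proof -
    have "linear (?g (f x))"
      using Ck_on_Suc_has_derivative[OF Suc.prems(2) Suc.prems(3)[OF that]] has_derivative_linear by blast
    then show ?thesis
      by (subst euclidean_representation[of h, symmetric]) (simp add: linear_sum linear_scale)
  qed
  show ?case
  proof (rule Ck_on_SucI[OF U, where f' = "\<lambda>x h. \<Sum>b\<in>Basis. (?f x h \<bullet> b) *\<^sub>R ?g (f x) b"])
    show "((\<lambda>x. g (f x)) has_derivative (\<lambda>h. \<Sum>b\<in>Basis. (?f x h \<bullet> b) *\<^sub>R ?g (f x) b)) (at x)" if "x \<in> U" for x
      unfolding gexp[OF that, symmetric]
      using has_derivative_compose[OF Ck_on_Suc_has_derivative[OF Suc.prems(1) that]
          Ck_on_Suc_has_derivative[OF Suc.prems(2) Suc.prems(3)[OF that]]] .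
    show "Ck_on k U (\<lambda>x. \<Sum>b\<in>Basis. (?f x h \<bullet> b) *\<^sub>R ?g (f x) b)" if "h \<in> Basis" for h
      using Suc.prems that Ck_on_SucD[OF Suc.prems(1)]
      by (intro Ck_on_sum Ck_on_scaleR Ck_on_inner U Ck_on_const Suc.IH) auto
  qed
qed

lemma Ck_on_derivative:
  assumes U: "open U" and f: "Ck_on (Suc k) U f" and w: "Ck_on k U w"
  shows "Ck_on k U (\<lambda>x. frechet_derivative f (at x) (w x))"
proof -
  have "frechet_derivative f (at x) (w x) = (\<Sum>b\<in>Basis. (w x \<bullet> b) *\<^sub>R frechet_derivative f (at x) b)" if "x \<in> U" for x
  proof -
    have "linear (frechet_derivative f (at x))"
      using Ck_on_Suc_has_derivative[OF f that] has_derivative_linear by blast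
    then show ?thesis
      by (subst euclidean_representation[of "w x", symmetric]) (simp add: linear_sum linear_scale)
  qed
  then show ?thesis
    using f w by (subst Ck_on_cong[OF U])
      (auto intro!: Ck_on_sum Ck_on_scaleR Ck_on_inner U Ck_on_const)
qed

lemma Ck_on_Pair:
  assumes "open U" "Ck_on k U f" "Ck_on k U g"
  shows "Ck_on k U (\<lambda>x. (f x, g x))"
proof -
  have "bounded_linear (\<lambda>a. (a, 0))" "bounded_linear (\<lambda>b. (0, b))"
    by (auto intro!: bounded_linear_Pair bounded_linear_ident bounded_linear_zero)
  from Ck_on_add[OF assms(1) Ck_on_bounded_linear[OF this(1) assms(1,2)]
      Ck_on_bounded_linear[OF this(2) assms(1,3)]]
  show ?thesis by simp
qed

lemmas Ck_on_nth = Ck_on_bounded_linear[OF bounded_linear_vec_nth]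
lemmas Ck_on_fst = Ck_on_bounded_linear[OF bounded_linear_fst]
lemmas Ck_on_snd = Ck_on_bounded_linear[OF bounded_linear_snd]

lemma bounded_linear_axis: "bounded_linear (axis i :: 'a::real_normed_vector \<Rightarrow> 'a ^ 'n::finite)"
proof -
  have "linear (axis i :: 'a \<Rightarrow> 'a ^ 'n)"
    by (rule linearI) (auto simp: vec_eq_iff axis_def)
  moreover have "norm (axis i x :: 'a ^ 'n) \<le> norm x * 1" for x :: 'a
    by (simp add: norm_vec_def L2_set_def axis_def if_distrib[of norm] if_distrib[of "\<lambda>x. x ^ 2"] cong: if_cong)
  ultimately show ?thesis
    unfolding bounded_linear_def bounded_linear_axioms_def by blast
qed

lemma Ck_on_vec:
  fixes f :: "'a::euclidean_space \<Rightarrow> 'b::real_normed_vector ^ 'n::finite"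
  assumes U: "open U" and "\<And>i. Ck_on k U (\<lambda>x. f x $ i)"
  shows "Ck_on k U f"
proof -
  have "f = (\<lambda>x. \<Sum>i\<in>UNIV. axis i (f x $ i))"
    by (auto simp: vec_eq_iff fun_eq_iff axis_def if_distrib cong: if_cong)
  moreover have "Ck_on k U (\<lambda>x. \<Sum>i\<in>UNIV. axis i (f x $ i))"
    by (intro Ck_on_sum U Ck_on_bounded_linear[OF bounded_linear_axis] assms)
  ultimately show ?thesis by simp
qed

text \<open>The derivative is a polynomial in the reciprocal itself, so the induction hypothesis
  already covers it.\<close>

lemma Ck_on_real_inverse: "Ck_on k (- {0}) (inverse :: real \<Rightarrow> real)"
proof (induction k)
  case 0
  then show ?case by (auto intro: continuous_on_inverse continuous_on_id)
next
  case (Suc k)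
  have U: "open (- {0::real})" by auto
  show ?case
    by (rule Ck_on_SucI[OF U, where f' = "\<lambda>x h. - (inverse x * h * inverse x)"])
      (auto intro!: has_derivative_inverse' Ck_on_minus Ck_on_mult Suc Ck_on_const)
qed

lemma Ck_on_real_sqrt: "Ck_on k {0<..} sqrt"
proof (induction k)
  case 0
  then show ?case by (auto intro: continuous_on_real_sqrt continuous_on_id)
next
  case (Suc k)
  have U: "open {0::real<..}" by auto
  show ?case
  proof (rule Ck_on_SucI[OF U, where f' = "\<lambda>x h. inverse (sqrt x) / 2 * h"])
    show "(sqrt has_derivative (\<lambda>h. inverse (sqrt x) / 2 * h)) (at x)" if "x \<in> {0<..}" for x
    proof -
      have "(\<lambda>h. inverse (sqrt x) / 2 * h) = (*) (inverse (sqrt x) / 2)" by auto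
      then show ?thesis using DERIV_real_sqrt[of x] that by (simp only: has_field_derivative_def greaterThan_iff)
    qed
    show "Ck_on k {0<..} (\<lambda>x. inverse (sqrt x) / 2 * b)" for b
      unfolding divide_inverse by (intro Ck_on_mult Ck_on_compose[OF U _ _ Ck_on_real_inverse] U Ck_on_const Suc) auto
  qed
qed

lemma Ck_on_inverse:
  fixes f :: "'a::euclidean_space \<Rightarrow> real"
  shows "open U \<Longrightarrow> Ck_on k U f \<Longrightarrow> (\<And>x. x \<in> U \<Longrightarrow> f x \<noteq> 0) \<Longrightarrow> Ck_on k U (\<lambda>x. inverse (f x))"
  by (rule Ck_on_compose[OF _ _ _ Ck_on_real_inverse]) auto

lemma Ck_on_divide:
  fixes f :: "'a::euclidean_space \<Rightarrow> real"
  shows "open U \<Longrightarrow> Ck_on k U f \<Longrightarrow> Ck_on k U g \<Longrightarrow> (\<And>x. x \<in> U \<Longrightarrow> g x \<noteq> 0) \<Longrightarrow> Ck_on k U (\<lambda>x. f x / g x)"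
  unfolding divide_inverse by (intro Ck_on_mult Ck_on_inverse)

lemma Ck_on_sqrt:
  fixes f :: "'a::euclidean_space \<Rightarrow> real"
  shows "open U \<Longrightarrow> Ck_on k U f \<Longrightarrow> (\<And>x. x \<in> U \<Longrightarrow> f x > 0) \<Longrightarrow> Ck_on k U (\<lambda>x. sqrt (f x))"
  by (rule Ck_on_compose[OF _ _ _ Ck_on_real_sqrt]) auto

lemma Ck_on_det:
  fixes M :: "'a::euclidean_space \<Rightarrow> real ^ 'n::finite ^ 'n"
  assumes "open U" "\<And>i j. Ck_on k U (\<lambda>x. M x $ i $ j)"
  shows "Ck_on k U (\<lambda>x. det (M x))"
  unfolding det_def by (intro Ck_on_sum Ck_on_mult Ck_on_prod Ck_on_const assms)

text \<open>Column b of the inverse solves a linear system with a basis vector on the right.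
  Cramer's rule thus makes the entries quotients of polynomials in the entries of M, which gives
  smoothness of the inverse metric.\<close>

lemma matrix_inv_cramer:
  fixes M :: "real ^ 'n::finite ^ 'n"
  assumes "det M \<noteq> 0"
  shows "matrix_inv M $ a $ b = det (\<chi> i j. if j = a then axis b 1 $ i else M $ i $ j) / det M"
proof -
  have "M ** matrix_inv M = mat 1"
    using assms unfolding invertible_det_nz[symmetric] invertible_def matrix_inv_def
    by (rule someI2_ex) blast
  then have "M *v (matrix_inv M *v axis b 1) = axis b 1"
    by (simp add: matrix_vector_mul_assoc)
  then have "matrix_inv M *v axis b 1 = (\<chi> a. det (\<chi> i j. if j = a then axis b 1 $ i else M $ i $ j) / det M)"
    using cramer[OF assms] by blast
  then have "(matrix_inv M *v axis b 1) $ a = det (\<chi> i j. if j = a then axis b 1 $ i else M $ i $ j) / det M"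
    by simp
  then show ?thesis
    by (simp add: matrix_vector_mul_component inner_axis)
qed

lemma Ck_on_matrix_inv:
  fixes M :: "'a::euclidean_space \<Rightarrow> real ^ 'n::finite ^ 'n"
  assumes U: "open U" and M: "Ck_on k U M" and d: "\<And>x. x \<in> U \<Longrightarrow> det (M x) \<noteq> 0"
  shows "Ck_on k U (\<lambda>x. matrix_inv (M x))"
proof (intro Ck_on_vec U)
  fix a b
  have e: "Ck_on k U (\<lambda>x. M x $ i $ j)" for i j by (intro Ck_on_nth U M)
  have "Ck_on k U (\<lambda>x. det (\<chi> i j. if j = a then axis b 1 $ i else M x $ i $ j) / det (M x))"
  proof (intro Ck_on_divide Ck_on_det U d)
    fix i j show "Ck_on k U (\<lambda>x. (\<chi> i j. if j = a then axis b 1 $ i else M x $ i $ j) $ i $ j)"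
      by (cases "j = a") (auto intro: e Ck_on_const U)
  qed (auto intro: e)
  then show "Ck_on k U (\<lambda>x. matrix_inv (M x) $ a $ b)"
    by (subst Ck_on_cong[OF U]) (auto simp: matrix_inv_cramer d)
qed

lemma Ck_on_matrix_vector:
  fixes M :: "'a::euclidean_space \<Rightarrow> real ^ 'n::finite ^ 'm::finite"
  assumes U: "open U" and M: "Ck_on k U M" "Ck_on k U f"
  shows "Ck_on k U (\<lambda>x. M x *v f x)"
  unfolding matrix_vector_mult_def
  by (intro Ck_on_vec U, simp, intro Ck_on_sum Ck_on_mult Ck_on_nth U M)

lemma smooth_onI: "(\<And>k. Ck_on k U f) \<Longrightarrow> smooth_on U f"
  by (simp add: smooth_on_def)

lemma smooth_onD: "smooth_on U f \<Longrightarrow> Ck_on k U f"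
  by (simp add: smooth_on_def)

lemma smooth_on_cong: "open U \<Longrightarrow> (\<And>y. y \<in> U \<Longrightarrow> f y = g y) \<Longrightarrow> smooth_on U f \<longleftrightarrow> smooth_on U g"
  using Ck_on_cong unfolding smooth_on_def by blast

lemma smooth_on_subset: "smooth_on U f \<Longrightarrow> V \<subseteq> U \<Longrightarrow> smooth_on V f"
  using Ck_on_subset unfolding smooth_on_def by blast

lemma smooth_on_compose:
  fixes f :: "'a::euclidean_space \<Rightarrow> 'b::euclidean_space"
  shows "open U \<Longrightarrow> open V \<Longrightarrow> smooth_on U f \<Longrightarrow> smooth_on V g \<Longrightarrow> (\<And>x. x \<in> U \<Longrightarrow> f x \<in> V)
    \<Longrightarrow> smooth_on U (\<lambda>x. g (f x))"
  using Ck_on_compose unfolding smooth_on_def by metis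

lemma smooth_on_has_derivative:
  "smooth_on U f \<Longrightarrow> x \<in> U \<Longrightarrow> (f has_derivative frechet_derivative f (at x)) (at x)"
  using Ck_on_Suc_has_derivative smooth_onD by blast

lemma Ck_on_local:
  assumes "\<And>x. x \<in> U \<Longrightarrow> \<exists>V. x \<in> V \<and> open V \<and> Ck_on k V f"
  shows "Ck_on k U f"
  using assms
proof (induction k arbitrary: f)
  case 0
  have "isCont f x" if "x \<in> U" for x
    using 0[OF that] by (auto simp: continuous_on_eq_continuous_at)
  then show ?case by (simp add: continuous_at_imp_continuous_on)
next
  case (Suc k)
  show ?case
  proof (simp, intro conjI ballI)
    show "f differentiable (at x)" if "x \<in> U" for x
      using Suc.prems[OF that] by auto
    show "Ck_on k U (\<lambda>x. frechet_derivative f (at x) b)" if "b \<in> Basis" for b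
      by (rule Suc.IH) (use Suc.prems that in fastforce)
  qed
qed

lemma smooth_on_local:
  assumes "\<And>x. x \<in> U \<Longrightarrow> \<exists>V. x \<in> V \<and> open V \<and> smooth_on V f"
  shows "smooth_on U f"
  unfolding smooth_on_def using assms Ck_on_local smooth_onD by metis

text \<open>Schwarz's theorem: the second difference of f over a small parallelogram at x equals m^2
  times either mixed derivative at some point of the parallelogram, and continuity brings both
  points to x.\<close>

lemma second_derivative_symmetric:
  fixes f :: "'a::euclidean_space \<Rightarrow> real"
  assumes U: "open U" and f: "Ck_on 2 U f" and x: "x \<in> U"
  shows "frechet_derivative (\<lambda>y. frechet_derivative f (at y) a) (at x) b
       = frechet_derivative (\<lambda>y. frechet_derivative f (at y) b) (at x) a"
proof -
  let ?d = "\<lambda>a y. frechet_derivative f (at y) a"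
  let ?dd = "\<lambda>a b y. frechet_derivative (?d a) (at y) b"
  have f1: "Ck_on (Suc 1) U f" using f by (simp add: numeral_2_eq_2)
  have d1: "Ck_on (Suc 0) U (?d a)" for a using Ck_on_derivative[OF U f1 Ck_on_const[OF U]] by simp
  have d2: "continuous_on U (?dd a b)" for a b
    using Ck_on_derivative[OF U d1 Ck_on_const[OF U]] by simp
  obtain r where r: "r > 0" "ball x r \<subseteq> U" using U x open_contains_ball by blast
  have main: "\<exists>p. dist p x < e \<and> p \<in> U \<and> (\<exists>q. dist q x < e \<and> q \<in> U \<and> ?dd a b p = ?dd b a q)" if "e > 0" for e
  proof -
    \<comment> \<open>The scale m makes the parallelogram spanned by m a and m b fit into the ball
      of radius \<open>min r e\<close> about x; the summand 1 avoids division by zero.\<close>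
    define m where "m = min r e / (2 * (norm a + norm b + 1))"
    have m: "m > 0" using r that by (simp add: m_def add_nonneg_pos)
    have mb: "m * (norm a + norm b) < min r e"
    proof -
      have "m * (norm a + norm b) \<le> m * (norm a + norm b + 1)" using m by simp
      also have "\<dots> = min r e / 2" unfolding m_def by (simp add: field_simps add_nonneg_pos add_nonneg_eq_0_iff)
      also have "\<dots> < min r e" using r that by linarith
      finally show ?thesis .
    qed
    have pt: "dist (x + s *\<^sub>R a + t *\<^sub>R b) x < min r e" if "0 \<le> s" "s \<le> m" "0 \<le> t" "t \<le> m" for s t
    proof -
      have "dist (x + s *\<^sub>R a + t *\<^sub>R b) x \<le> s * norm a + t * norm b"
        using that norm_triangle_ineq[of "s *\<^sub>R a" "t *\<^sub>R b"] by (simp add: dist_norm add.assoc)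
      also have "\<dots> \<le> m * norm a + m * norm b" using that by (intro add_mono mult_right_mono) auto
      finally show ?thesis using mb by (simp add: algebra_simps)
    qed
    have pU: "x + s *\<^sub>R a + t *\<^sub>R b \<in> U" if "0 \<le> s" "s \<le> m" "0 \<le> t" "t \<le> m" for s t
      using pt[OF that] r by (auto simp: dist_commute)
    have der: "((\<lambda>t. h (c + t *\<^sub>R v)) has_real_derivative frechet_derivative h (at (c + t *\<^sub>R v)) v) (at t)"
      if h: "Ck_on (Suc k) U h" "c + t *\<^sub>R v \<in> U" for k h c t v
    proof -
      have D: "(h has_derivative frechet_derivative h (at (c + t *\<^sub>R v))) (at (c + t *\<^sub>R v))"
        using Ck_on_Suc_has_derivative[OF h] .
      have "((\<lambda>t. h (c + t *\<^sub>R v)) has_derivative (\<lambda>s. frechet_derivative h (at (c + t *\<^sub>R v)) (s *\<^sub>R v))) (at t)"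
        by (rule has_derivative_compose[where f = "\<lambda>t. c + t *\<^sub>R v" and g = h, OF _ D])
          (auto intro!: derivative_eq_intros)
      moreover have "(\<lambda>s. frechet_derivative h (at (c + t *\<^sub>R v)) (s *\<^sub>R v)) = (*) (frechet_derivative h (at (c + t *\<^sub>R v)) v)"
        using has_derivative_linear[OF D] by (auto simp: linear_scale fun_eq_iff)
      ultimately show ?thesis by (simp add: has_field_derivative_def)
    qed
    \<comment> \<open>The mean value theorem is used twice: in direction u for the difference of f
      along two parallel edges, then in direction v for the derivative obtained.\<close>
    have half: "\<exists>s t. 0 \<le> s \<and> s \<le> m \<and> 0 \<le> t \<and> t \<le> m \<and>
       (f (x + m *\<^sub>R u + m *\<^sub>R v) - f (x + m *\<^sub>R u)) - (f (x + m *\<^sub>R v) - f x) = m * (m * ?dd u v (x + s *\<^sub>R u + t *\<^sub>R v))"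
      if uv: "\<And>s t. 0 \<le> s \<Longrightarrow> s \<le> m \<Longrightarrow> 0 \<le> t \<Longrightarrow> t \<le> m \<Longrightarrow> x + s *\<^sub>R u + t *\<^sub>R v \<in> U" for u v
    proof -
      let ?\<phi> = "\<lambda>s. f ((x + m *\<^sub>R v) + s *\<^sub>R u) - f (x + s *\<^sub>R u)"
      have "\<exists>z. 0 < z \<and> z < m \<and> ?\<phi> m - ?\<phi> 0 = (m - 0) * (?d u ((x + m *\<^sub>R v) + z *\<^sub>R u) - ?d u (x + z *\<^sub>R u))"
      proof (rule MVT2[OF m])
        fix s assume s: "0 \<le> s" "s \<le> m"
        show "(?\<phi> has_real_derivative ?d u ((x + m *\<^sub>R v) + s *\<^sub>R u) - ?d u (x + s *\<^sub>R u)) (at s)"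
          using uv[OF s, of m] uv[OF s, of 0] m
          by (intro DERIV_diff der[OF f1]) (auto simp: algebra_simps)
      qed
      then obtain s where s: "0 < s" "s < m"
        "?\<phi> m - ?\<phi> 0 = m * (?d u ((x + m *\<^sub>R v) + s *\<^sub>R u) - ?d u (x + s *\<^sub>R u))" by auto
      have "\<exists>z. 0 < z \<and> z < m \<and> ?d u ((x + s *\<^sub>R u) + m *\<^sub>R v) - ?d u ((x + s *\<^sub>R u) + 0 *\<^sub>R v)
          = (m - 0) * ?dd u v ((x + s *\<^sub>R u) + z *\<^sub>R v)"
      proof (rule MVT2[OF m])
        fix t assume t: "0 \<le> t" "t \<le> m"
        show "((\<lambda>t. ?d u ((x + s *\<^sub>R u) + t *\<^sub>R v)) has_real_derivative ?dd u v ((x + s *\<^sub>R u) + t *\<^sub>R v)) (at t)"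
          using uv[of s t] s t by (intro der[OF d1]) auto
      qed
      then obtain t where "0 < t" "t < m" "?d u ((x + s *\<^sub>R u) + m *\<^sub>R v) - ?d u (x + s *\<^sub>R u) = m * ?dd u v ((x + s *\<^sub>R u) + t *\<^sub>R v)"
        by auto
      with s show ?thesis
        by (intro exI[of _ s] exI[of _ t]) (auto simp: algebra_simps)
    qed
    obtain s t where 1: "0 \<le> s" "s \<le> m" "0 \<le> t" "t \<le> m"
      "(f (x + m *\<^sub>R a + m *\<^sub>R b) - f (x + m *\<^sub>R a)) - (f (x + m *\<^sub>R b) - f x) = m * (m * ?dd a b (x + s *\<^sub>R a + t *\<^sub>R b))"
      using half[of a b] pU by blast
    have swap: "x + s *\<^sub>R b + t *\<^sub>R a = x + t *\<^sub>R a + s *\<^sub>R b" for s t by simp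
    have "x + s *\<^sub>R b + t *\<^sub>R a \<in> U" if "0 \<le> s" "s \<le> m" "0 \<le> t" "t \<le> m" for s t
      unfolding swap using pU that by blast
    from half[OF this] obtain s' t' where 2: "0 \<le> s'" "s' \<le> m" "0 \<le> t'" "t' \<le> m"
      "(f (x + m *\<^sub>R b + m *\<^sub>R a) - f (x + m *\<^sub>R b)) - (f (x + m *\<^sub>R a) - f x) = m * (m * ?dd b a (x + s' *\<^sub>R b + t' *\<^sub>R a))"
      by blast
    have "m * (m * ?dd a b (x + s *\<^sub>R a + t *\<^sub>R b)) = m * (m * ?dd b a (x + s' *\<^sub>R b + t' *\<^sub>R a))"
      using 1(5) 2(5) unfolding swap[of m m] by linarith
    then have "?dd a b (x + s *\<^sub>R a + t *\<^sub>R b) = ?dd b a (x + t' *\<^sub>R a + s' *\<^sub>R b)"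
      using m unfolding swap[of s' t'] by simp
    then show ?thesis
      using pt[OF 1(1-4)] pt[OF 2(3,4,1,2)] pU[OF 1(1-4)] pU[OF 2(3,4,1,2)] by auto
  qed
  show ?thesis
  proof (rule ccontr)
    let ?e = "\<bar>?dd a b x - ?dd b a x\<bar> / 2"
    assume "\<not> ?thesis"
    then have e: "?e > 0" by simp
    obtain d1 where D1: "d1 > 0" "\<And>p. p \<in> U \<Longrightarrow> dist p x < d1 \<Longrightarrow> dist (?dd a b p) (?dd a b x) < ?e"
      using d2[of a b] x e unfolding continuous_on_iff by meson
    obtain d2 where D2: "d2 > 0" "\<And>p. p \<in> U \<Longrightarrow> dist p x < d2 \<Longrightarrow> dist (?dd b a p) (?dd b a x) < ?e"
      using d2[of b a] x e unfolding continuous_on_iff by meson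
    have "min d1 d2 > 0" using D1 D2 by simp
    from main[OF this] obtain p q where pq: "dist p x < min d1 d2" "p \<in> U" "dist q x < min d1 d2" "q \<in> U"
      and e: "?dd a b p = ?dd b a q" by blast
    have "dist (?dd a b p) (?dd a b x) < ?e" using D1(2) pq by simp
    moreover have "dist (?dd a b p) (?dd b a x) < ?e" unfolding e using D2(2) pq by simp
    ultimately have "dist (?dd a b x) (?dd b a x) < \<bar>?dd a b x - ?dd b a x\<bar>"
      by (rule dist_triangle_half_r)
    then show False by (simp add: dist_real_def)
  qed
qed

section \<open>Ordinary differential equations and Pfaff systems\<close>

text \<open>For short intervals the mean value inequality replaces Gronwall's lemma.\<close>

lemma short_time_bound:
  fixes z :: "real \<Rightarrow> 'a::real_normed_vector"
  assumes I: "t0 \<in> {a..b}" and t: "t \<in> {a..b}"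
    and D: "\<And>t. t \<in> {a..b} \<Longrightarrow> (z has_vector_derivative z' t) (at t within {a..b})"
    and B: "\<And>t. t \<in> {a..b} \<Longrightarrow> norm (z' t) \<le> L * norm (z t) + e"
    and L: "0 \<le> L" "L * (b - a) \<le> 1 / 2" and e: "0 \<le> e"
  shows "norm (z t) \<le> 2 * (norm (z t0) + (b - a) * e)"
proof -
  have "continuous_on {a..b} z"
    using D has_vector_derivative_continuous by (fastforce simp: continuous_on_eq_continuous_within)
  then have "continuous_on {a..b} (\<lambda>t. norm (z t))" by (intro continuous_intros)
  \<comment> \<open>At a maximum m of the norm, |z m| is at most |z t0| + (b - a) (L |z m| + e), and
    L (b - a) at most 1/2 lets the left-hand side absorb the term with |z m|.\<close>
  then obtain m where m: "m \<in> {a..b}" "\<And>t. t \<in> {a..b} \<Longrightarrow> norm (z t) \<le> norm (z m)"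
    using continuous_attains_sup[of "{a..b}" "\<lambda>t. norm (z t)"] I by auto
  have nn: "0 \<le> L * norm (z m) + e" using L e by simp
  have "norm (z m - z t0) \<le> (L * norm (z m) + e) * norm (m - t0)"
  proof (rule differentiable_bound[of "{a..b}" z "\<lambda>t h. h *\<^sub>R z' t"])
    show "(z has_derivative (\<lambda>h. h *\<^sub>R z' s)) (at s within {a..b})" if "s \<in> {a..b}" for s
      using D[OF that] by (simp add: has_vector_derivative_def)
    show "onorm (\<lambda>h. h *\<^sub>R z' s) \<le> L * norm (z m) + e" if s: "s \<in> {a..b}" for s
    proof (rule onorm_bound[OF nn])
      fix h :: real
      have "norm (z' s) \<le> L * norm (z m) + e"
        using B[OF s] mult_left_mono[OF m(2)[OF s] L(1)] by linarith
      then show "norm (h *\<^sub>R z' s) \<le> (L * norm (z m) + e) * norm h"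
        by (simp add: mult.commute mult_left_mono)
    qed
  qed (use I m in auto)
  also have "\<dots> \<le> (L * norm (z m) + e) * (b - a)"
    using I m by (intro mult_left_mono nn) auto
  finally have "norm (z m - z t0) \<le> (L * (b - a)) * norm (z m) + (b - a) * e"
    by (simp add: algebra_simps)
  also have "(L * (b - a)) * norm (z m) \<le> 1 / 2 * norm (z m)"
    by (intro mult_right_mono L) auto
  finally have "norm (z m) \<le> 2 * (norm (z t0) + (b - a) * e)"
    using norm_triangle_sub[of "z m" "z t0"] by simp
  then show ?thesis using m(2)[OF t] by simp
qed

text \<open>Banach's fixed point theorem for the integral equation: the bound on M (b - a) keeps the
  iterates in the ball, and the bound on L (b - a) makes the integral operator a contraction with
  factor 1/2 in the supremum norm.\<close>

lemma picard:
  fixes f :: "real \<Rightarrow> 'a::banach \<Rightarrow> 'a"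
  assumes I: "t0 \<in> {a..b}" and r: "0 \<le> r"
    and cont: "continuous_on ({a..b} \<times> cball x0 r) (\<lambda>(t, x). f t x)"
    and lip: "\<And>t x y. t \<in> {a..b} \<Longrightarrow> x \<in> cball x0 r \<Longrightarrow> y \<in> cball x0 r \<Longrightarrow> norm (f t x - f t y) \<le> L * norm (x - y)"
    and bd: "\<And>t x. t \<in> {a..b} \<Longrightarrow> x \<in> cball x0 r \<Longrightarrow> norm (f t x) \<le> M"
    and M: "M * (b - a) \<le> r" and L: "0 \<le> L" "L * (b - a) \<le> 1 / 2"
  obtains x where "x t0 = x0"
    "\<And>t. t \<in> {a..b} \<Longrightarrow> x t \<in> cball x0 r \<and> (x has_vector_derivative f t (x t)) (at t within {a..b})"
proof -
  have M0: "0 \<le> M" using order_trans[OF norm_ge_zero bd[OF I, of x0]] r by simp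
  define S where "S = PiC UNIV (\<lambda>_::real. cball x0 r)"
  \<comment> \<open>This is the oriented integral from t0 to t; both integrals start at a because t
    may lie to the left of t0.\<close>
  define J where "J \<phi> t = integral {a..t} (\<lambda>s. f s (\<phi> s)) - integral {a..t0} (\<lambda>s. f s (\<phi> s))" for \<phi> t
  \<comment> \<open>Clamping the time to the interval extends functions on it to bounded continuous
    functions on the whole line, the complete space in which the fixed point is found.\<close>
  define c where "c t = max a (min b t)" for t
  have c: "c t \<in> {a..b}" "t \<in> {a..b} \<Longrightarrow> c t = t" for t using I by (auto simp: c_def)
  have fc: "continuous_on {a..b} (\<lambda>s. f s (\<phi> s))" if "continuous_on {a..b} \<phi>" "\<And>t. \<phi> t \<in> cball x0 r" for \<phi>
  proof -
    have "(\<lambda>s. (s, \<phi> s)) ` {a..b} \<subseteq> {a..b} \<times> cball x0 r" using that(2) by blast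
    then show ?thesis
      using continuous_on_compose2[OF cont continuous_on_Pair[OF continuous_on_id that(1)]] by simp
  qed
  have Jd: "(J \<phi> has_vector_derivative f t (\<phi> t)) (at t within {a..b})"
    if "continuous_on {a..b} \<phi>" "\<And>t. \<phi> t \<in> cball x0 r" "t \<in> {a..b}" for \<phi> t
    unfolding J_def using integral_has_vector_derivative[OF fc[OF that(1,2)] that(3)]
    by (auto intro!: derivative_eq_intros)
  have Jc: "continuous_on {a..b} (J \<phi>)" if "continuous_on {a..b} \<phi>" "\<And>t. \<phi> t \<in> cball x0 r" for \<phi>
    using Jd[OF that] has_vector_derivative_continuous by (fastforce simp: continuous_on_eq_continuous_within)
  have J0: "J \<phi> t0 = 0" for \<phi> by (simp add: J_def)
  have Jb: "norm (J \<phi> t) \<le> r" if "continuous_on {a..b} \<phi>" "\<And>t. \<phi> t \<in> cball x0 r" "t \<in> {a..b}" for \<phi> t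
  proof -
    have "norm (J \<phi> t - J \<phi> t0) \<le> M * norm (t - t0)"
    proof (rule differentiable_bound[of "{a..b}" "J \<phi>" "\<lambda>s h. h *\<^sub>R f s (\<phi> s)"])
      show "onorm (\<lambda>h. h *\<^sub>R f s (\<phi> s)) \<le> M" if "s \<in> {a..b}" for s
      proof (rule onorm_bound[OF M0])
        show "norm (h *\<^sub>R f s (\<phi> s)) \<le> M * norm h" for h
          using mult_left_mono[OF bd[OF that \<open>\<phi> s \<in> cball x0 r\<close>], of "\<bar>h\<bar>"] by (simp add: mult.commute)
      qed
    qed (use I that Jd[OF that(1,2)] in \<open>auto simp: has_vector_derivative_def\<close>)
    also have "\<dots> \<le> M * (b - a)" using I that by (intro mult_left_mono M0) auto
    finally show ?thesis using M J0 by simp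
  qed
  have cc: "continuous_on UNIV c" unfolding c_def by (intro continuous_intros)
  define P where "P \<phi> = Bcontfun (\<lambda>t. x0 + J (apply_bcontfun \<phi>) (c t))" for \<phi>
  have SD: "apply_bcontfun \<phi> t \<in> cball x0 r" if "\<phi> \<in> S" for \<phi> t
    using that by (auto simp: S_def mem_PiC_iff)
  have P: "apply_bcontfun (P \<phi>) = (\<lambda>t. x0 + J (apply_bcontfun \<phi>) (c t))" if "\<phi> \<in> S" for \<phi>
    unfolding P_def
  proof (rule Bcontfun_inverse, rule bcontfun_normI)
    show "continuous_on UNIV (\<lambda>t. x0 + J (apply_bcontfun \<phi>) (c t))"
      by (intro continuous_intros continuous_on_compose2[OF Jc cc]) (use SD[OF that] c in auto)
    show "norm (x0 + J (apply_bcontfun \<phi>) (c t)) \<le> norm x0 + r" for t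
      using Jb[of "apply_bcontfun \<phi>" "c t"] SD[OF that] c norm_triangle_ineq[of x0 "J (apply_bcontfun \<phi>) (c t)"]
      by fastforce
  qed
  have "\<exists>!\<phi>\<in>S. P \<phi> = \<phi>"
  proof (rule Banach_fix[of S "1/2"])
    have "closed S" unfolding S_def by (rule closed_PiC) auto
    then show "complete S" by (simp add: complete_eq_closed)
    have "const_bcontfun x0 \<in> S" using r by (auto simp: S_def mem_PiC_iff)
    then show "S \<noteq> {}" by blast
    show "P ` S \<subseteq> S"
    proof
      fix \<psi> assume "\<psi> \<in> P ` S"
      then obtain \<phi> where \<phi>: "\<phi> \<in> S" "\<psi> = P \<phi>" by blast
      have "norm (J (apply_bcontfun \<phi>) (c t)) \<le> r" for t
        by (rule Jb) (use SD[OF \<phi>(1)] c in auto)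
      then show "\<psi> \<in> S" unfolding \<phi>(2) S_def mem_PiC_iff P[OF \<phi>(1)] by (auto simp: dist_norm)
    qed
    show "dist (P \<phi>) (P \<psi>) \<le> 1/2 * dist \<phi> \<psi>" if "\<phi> \<in> S" "\<psi> \<in> S" for \<phi> \<psi>
    proof (rule dist_bound)
      fix t
      let ?D = "\<lambda>t. J (apply_bcontfun \<phi>) t - J (apply_bcontfun \<psi>) t"
      have "norm (?D (c t) - ?D t0) \<le> (L * dist \<phi> \<psi>) * norm (c t - t0)"
      proof (rule differentiable_bound[of "{a..b}" ?D "\<lambda>s h. h *\<^sub>R (f s (apply_bcontfun \<phi> s) - f s (apply_bcontfun \<psi> s))"])
        fix s assume s: "s \<in> {a..b}"
        show "(?D has_derivative (\<lambda>h. h *\<^sub>R (f s (apply_bcontfun \<phi> s) - f s (apply_bcontfun \<psi> s)))) (at s within {a..b})"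
          using has_vector_derivative_diff[OF Jd[of "apply_bcontfun \<phi>" s] Jd[of "apply_bcontfun \<psi>" s]] that SD s
          by (auto simp: has_vector_derivative_def)
        show "onorm (\<lambda>h. h *\<^sub>R (f s (apply_bcontfun \<phi> s) - f s (apply_bcontfun \<psi> s))) \<le> L * dist \<phi> \<psi>"
        proof (rule onorm_bound)
          fix h :: real
          have "norm (f s (apply_bcontfun \<phi> s) - f s (apply_bcontfun \<psi> s)) \<le> L * norm (apply_bcontfun \<phi> s - apply_bcontfun \<psi> s)"
            by (rule lip[OF s]) (use SD that in auto)
          also have "\<dots> \<le> L * dist \<phi> \<psi>"
            using dist_bounded[of \<phi> s \<psi>] L(1) by (intro mult_left_mono) (auto simp: dist_norm)
          finally show "norm (h *\<^sub>R (f s (apply_bcontfun \<phi> s) - f s (apply_bcontfun \<psi> s))) \<le> L * dist \<phi> \<psi> * norm h"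
            by (simp add: mult.commute mult_left_mono)
        qed (use L in auto)
      qed (use I c in auto)
      also have "\<dots> \<le> (L * dist \<phi> \<psi>) * (b - a)"
        using I c[of t] L by (intro mult_left_mono) auto
      also have "\<dots> = (L * (b - a)) * dist \<phi> \<psi>" by simp
      also have "\<dots> \<le> 1/2 * dist \<phi> \<psi>" by (intro mult_right_mono L) auto
      finally show "dist (apply_bcontfun (P \<phi>) t) (apply_bcontfun (P \<psi>) t) \<le> 1/2 * dist \<phi> \<psi>"
        using that by (simp add: P dist_norm J0)
    qed
  qed auto
  then obtain \<phi> where \<phi>: "\<phi> \<in> S" "P \<phi> = \<phi>" by blast
  let ?x = "apply_bcontfun \<phi>"
  have x: "?x t = x0 + J ?x (c t)" for t using P[OF \<phi>(1)] \<phi>(2) by metis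
  show ?thesis
  proof (rule that)
    show "?x t0 = x0" using x[of t0] I c J0 by simp
    show "?x t \<in> cball x0 r \<and> (?x has_vector_derivative f t (?x t)) (at t within {a..b})" if t: "t \<in> {a..b}" for t
    proof (intro conjI SD[OF \<phi>(1)])
      have "((\<lambda>t. x0 + J ?x t) has_vector_derivative f t (?x t)) (at t within {a..b})"
        using Jd[of ?x t] SD[OF \<phi>(1)] t by (auto intro!: derivative_eq_intros)
      then show "(?x has_vector_derivative f t (?x t)) (at t within {a..b})"
        by (rule has_vector_derivative_transform[OF t, rotated]) (use x c in auto)
    qed
  qed
qed

text \<open>The solution of the Pfaff system is shown to be differentiable through a remainder
  estimate of this form.\<close>

lemma has_derivative_quadratic:
  fixes f :: "'a::real_normed_vector \<Rightarrow> 'b::real_normed_vector"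
  assumes D: "bounded_linear D" and e: "0 < e"
    and B: "\<And>h. norm h < e \<Longrightarrow> norm (f (x + h) - f x - D h) \<le> C * norm h ^ 2"
  shows "(f has_derivative D) (at x)"
  unfolding has_derivative_at
proof (intro conjI D)
  have lim: "((\<lambda>h::'a. C * norm h) \<longlongrightarrow> 0) (at 0)"
    by (intro tendsto_mult_right_zero tendsto_norm_zero tendsto_ident_at)
  show "(\<lambda>h. norm (f (x + h) - f x - D h) / norm h) \<midarrow>0\<rightarrow> 0"
  proof (rule Lim_null_comparison[OF _ lim])
    have "norm (norm (f (x + h) - f x - D h) / norm h) \<le> C * norm h" if "h \<noteq> 0" "norm h < e" for h
      using B[OF that(2)] that(1) by (simp add: divide_le_eq power2_eq_square)
    then show "\<forall>\<^sub>F h in at 0. norm (norm (f (x + h) - f x - D h) / norm h) \<le> C * norm h"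
      using e unfolding eventually_at by (auto simp: dist_norm)
  qed
qed

text \<open>Compactness bounds the derivative at basis vectors, and convexity turns this into a
  Lipschitz bound. A single L serves for the derivative and for the increments, so that both can
  enter the same short time estimate.\<close>

lemma Ck_on_lipschitz:
  fixes f :: "'a::euclidean_space \<Rightarrow> 'b::real_normed_vector"
  assumes f: "Ck_on 1 U f" and K: "compact K" "convex K" "K \<subseteq> U"
  obtains L where "0 \<le> L" "\<And>x h. x \<in> K \<Longrightarrow> norm (frechet_derivative f (at x) h) \<le> L * norm h"
    "\<And>x y. x \<in> K \<Longrightarrow> y \<in> K \<Longrightarrow> norm (f x - f y) \<le> L * norm (x - y)"
proof -
  let ?f = "\<lambda>x. frechet_derivative f (at x)"
  have f1: "Ck_on (Suc 0) U f" using f by simp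
  have d: "(f has_derivative ?f x) (at x)" if "x \<in> K" for x
    using Ck_on_Suc_has_derivative[OF f1] that K by blast
  have "\<exists>M. \<forall>x\<in>K. norm (?f x b) \<le> M" if "b \<in> Basis" for b
  proof -
    have "continuous_on K (\<lambda>x. ?f x b)" using f1 that by (auto intro: continuous_on_subset[OF _ K(3)])
    then have "compact ((\<lambda>x. ?f x b) ` K)" using K(1) compact_continuous_image by blast
    then show ?thesis using compact_imp_bounded by (fastforce simp: bounded_iff)
  qed
  then obtain M where M: "\<And>x b. b \<in> Basis \<Longrightarrow> x \<in> K \<Longrightarrow> norm (?f x b) \<le> M b" by metis
  define L where "L = (\<Sum>b\<in>(Basis::'a set). \<bar>M b\<bar>)"
  have L: "norm (?f x h) \<le> L * norm h" if x: "x \<in> K" for x h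
  proof -
    have l: "linear (?f x)" using d[OF x] has_derivative_linear by blast
    have "?f x h = (\<Sum>b\<in>Basis. (h \<bullet> b) *\<^sub>R ?f x b)"
      by (subst euclidean_representation[of h, symmetric]) (simp add: linear_sum[OF l] linear_scale[OF l])
    also have "norm \<dots> \<le> (\<Sum>b\<in>Basis. norm ((h \<bullet> b) *\<^sub>R ?f x b))" by (rule norm_sum)
    also have "\<dots> \<le> (\<Sum>b\<in>Basis. norm h * \<bar>M b\<bar>)"
    proof (rule sum_mono)
      fix b :: 'a assume b: "b \<in> Basis"
      have "norm (?f x b) \<le> \<bar>M b\<bar>" using M[OF b x] by simp
      then show "norm ((h \<bullet> b) *\<^sub>R ?f x b) \<le> norm h * \<bar>M b\<bar>"
        using Basis_le_norm[OF b, of h] by (auto intro!: mult_mono)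
    qed
    finally show ?thesis by (simp add: L_def sum_distrib_left[symmetric] mult.commute)
  qed
  have L0: "0 \<le> L" unfolding L_def by (intro sum_nonneg) auto
  show ?thesis
  proof (rule that[OF L0 L])
    show "norm (f x - f y) \<le> L * norm (x - y)" if "x \<in> K" "y \<in> K" for x y
      by (rule differentiable_bound[OF K(2), of f ?f])
        (use that L L0 in \<open>auto intro!: onorm_bound intro: has_derivative_at_withinI[OF d]\<close>)
  qed
qed

text \<open>The mean value inequality is applied on the segment to f minus its linear part at x. The
  derivative of this difference is at most C |y - x| there, since first derivatives are Lipschitz on
  K.\<close>

lemma Ck_on_taylor:
  fixes f :: "'a::euclidean_space \<Rightarrow> 'b::real_normed_vector"
  assumes U: "open U" and f: "Ck_on 2 U f" and K: "compact K" "convex K" "K \<subseteq> U"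
  obtains C where "0 \<le> C"
    "\<And>x y. x \<in> K \<Longrightarrow> y \<in> K \<Longrightarrow> norm (f y - f x - frechet_derivative f (at x) (y - x)) \<le> C * norm (y - x) ^ 2"
proof -
  let ?f = "\<lambda>x. frechet_derivative f (at x)"
  have f2: "Ck_on (Suc 1) U f" using f by (simp add: numeral_2_eq_2)
  have d: "(f has_derivative ?f x) (at x)" if "x \<in> K" for x
    using Ck_on_Suc_has_derivative[OF f2] that K by blast
  have "\<exists>M\<ge>0. \<forall>x\<in>K. \<forall>y\<in>K. norm (?f x b - ?f y b) \<le> M * norm (x - y)" for b
    using Ck_on_lipschitz[OF Ck_on_derivative[OF U f2 Ck_on_const[OF U]] K] by metis
  then obtain M where M: "\<And>b. M b \<ge> 0" "\<And>x y b. x \<in> K \<Longrightarrow> y \<in> K \<Longrightarrow> norm (?f x b - ?f y b) \<le> M b * norm (x - y)"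
    by metis
  define C where "C = (\<Sum>b\<in>(Basis::'a set). M b)"
  have C0: "0 \<le> C" unfolding C_def by (intro sum_nonneg M)
  have C: "norm (?f x h - ?f y h) \<le> C * norm (x - y) * norm h" if x: "x \<in> K" "y \<in> K" for x y h
  proof -
    have l: "linear (\<lambda>h. ?f x h - ?f y h)"
      using d[OF x(1)] d[OF x(2)] has_derivative_linear by (intro linear_compose_sub) auto
    have "?f x h - ?f y h = (\<Sum>b\<in>Basis. (h \<bullet> b) *\<^sub>R (?f x b - ?f y b))"
      using linear_sum[OF l, of "\<lambda>b. (h \<bullet> b) *\<^sub>R b" Basis] linear_scale[OF l]
      by (simp add: euclidean_representation)
    also have "norm \<dots> \<le> (\<Sum>b\<in>Basis. norm ((h \<bullet> b) *\<^sub>R (?f x b - ?f y b)))" by (rule norm_sum)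
    also have "\<dots> \<le> (\<Sum>b\<in>Basis. norm h * (M b * norm (x - y)))"
    proof (rule sum_mono)
      fix b :: 'a assume b: "b \<in> Basis"
      show "norm ((h \<bullet> b) *\<^sub>R (?f x b - ?f y b)) \<le> norm h * (M b * norm (x - y))"
        using Basis_le_norm[OF b, of h] M(2)[OF x, of b] by (auto intro!: mult_mono)
    qed
    finally show ?thesis by (simp add: C_def sum_distrib_left[symmetric] sum_distrib_right[symmetric] mult_ac)
  qed
  show ?thesis
  proof (rule that[OF C0])
    fix x y assume x: "x \<in> K" "y \<in> K"
    let ?S = "closed_segment x y"
    have S: "?S \<subseteq> K" using x K(2) closed_segment_subset by blast
    have bl: "bounded_linear (?f x)" using d[OF x(1)] has_derivative_bounded_linear by blast
    have "norm ((f y - ?f x y) - (f x - ?f x x)) \<le> (C * norm (y - x)) * norm (y - x)"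
    proof (rule differentiable_bound[of ?S "\<lambda>z. f z - ?f x z" "\<lambda>z h. ?f z h - ?f x h"])
      fix z assume z: "z \<in> ?S"
      then have zK: "z \<in> K" using S by blast
      show "((\<lambda>z. f z - ?f x z) has_derivative (\<lambda>h. ?f z h - ?f x h)) (at z within ?S)"
        by (intro has_derivative_diff has_derivative_at_withinI[OF d[OF zK]] bounded_linear.has_derivative[OF bl] has_derivative_ident)
      have "norm (z - x) \<le> norm (y - x)"
        using segment_bound(1)[OF z] by simp
      then have "C * norm (z - x) * norm h \<le> C * norm (y - x) * norm h" for h :: 'a
        by (intro mult_right_mono mult_left_mono C0) auto
      then show "onorm (\<lambda>h. ?f z h - ?f x h) \<le> C * norm (y - x)"
        using C[OF zK x(1)] C0 by (intro onorm_bound) (auto intro: order_trans)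
    qed auto
    then show "norm (f y - f x - ?f x (y - x)) \<le> C * norm (y - x) ^ 2"
      using bounded_linear.linear[OF bl] by (simp add: linear_diff power2_eq_square algebra_simps)
  qed
qed

text \<open>The solutions are given, and dependence on s is assumed differentiable at time 0 only.
  The candidate Y solves the linearized equation along the solution for s = 0, and its own
  derivative at 0 is the mixed derivative that the deviation functions call for.\<close>

lemma ode_dependence:
  fixes G :: "'a::euclidean_space \<Rightarrow> 'a" and z :: "real \<Rightarrow> real \<Rightarrow> 'a"
  assumes U: "open U" and G: "Ck_on 2 U G" and K: "cball z0 R \<subseteq> U" and T: "0 < T" and s0: "0 < s0"
    and zK: "\<And>t s. \<bar>t\<bar> < T \<Longrightarrow> \<bar>s\<bar> < s0 \<Longrightarrow> z t s \<in> cball z0 R"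
    and zD: "\<And>t s. \<bar>t\<bar> < T \<Longrightarrow> \<bar>s\<bar> < s0 \<Longrightarrow> ((\<lambda>t. z t s) has_vector_derivative G (z t s)) (at t)"
    and init: "((\<lambda>s. z 0 s) has_vector_derivative y0) (at 0)"
  obtains T' Y where "0 < T'" "Y 0 = y0"
    "(Y has_vector_derivative frechet_derivative G (at (z 0 0)) y0) (at 0)"
    "\<And>t. \<bar>t\<bar> < T' \<Longrightarrow> ((\<lambda>s. z t s) has_vector_derivative Y t) (at 0)"
proof -
  let ?D = "\<lambda>x. frechet_derivative G (at x)"
  have G2: "Ck_on (Suc 1) U G" and G1: "Ck_on 1 U G"
    using G Ck_on_le[OF G, of 1] by (simp_all add: numeral_2_eq_2)
  have Kc: "compact (cball z0 R)" "convex (cball z0 R)" by auto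
  obtain L where L: "0 \<le> L" "\<And>x h. x \<in> cball z0 R \<Longrightarrow> norm (?D x h) \<le> L * norm h"
    "\<And>x y. x \<in> cball z0 R \<Longrightarrow> y \<in> cball z0 R \<Longrightarrow> norm (G x - G y) \<le> L * norm (x - y)"
    using Ck_on_lipschitz[OF G1 Kc K] by blast
  obtain C where C: "0 \<le> C" "\<And>x y. x \<in> cball z0 R \<Longrightarrow> y \<in> cball z0 R \<Longrightarrow>
      norm (G y - G x - ?D x (y - x)) \<le> C * norm (y - x) ^ 2"
    using Ck_on_taylor[OF U G Kc K] by blast
  have lin: "linear (?D x)" if "x \<in> cball z0 R" for x
    using Ck_on_Suc_has_derivative[OF G2] K that has_derivative_linear by blast
  \<comment> \<open>On the interval from -S to S the product of L and the length is at most 1/2, as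
    \<open>picard\<close> and \<open>short_time_bound\<close> require.\<close>
  define S where "S = min (T / 2) (1 / (4 * (L + 1)))"
  have S: "0 < S" "S < T" "S \<le> T / 2" using T L by (auto simp: S_def)
  have LS: "L * (S - (- S)) \<le> 1 / 2"
  proof -
    have "L * (2 * S) \<le> L * (2 * (1 / (4 * (L + 1))))" using L by (intro mult_left_mono) (auto simp: S_def)
    also have "\<dots> \<le> 1 / 2" using L by (simp add: field_simps)
    finally show ?thesis by simp
  qed
  define I where "I = {- S..S}"
  have IT: "\<bar>t\<bar> < T" if "t \<in> I" for t using that S by (auto simp: I_def)
  have I0: "0 \<in> {-S..S}" using S by auto
  have z0K: "z t 0 \<in> cball z0 R" if "t \<in> I" for t using zK IT[OF that] s0 by simp
  have zc: "continuous_on I (\<lambda>t. z t 0)"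
    using zD[of _ 0] IT s0 has_vector_derivative_continuous
    by (fastforce intro!: continuous_at_imp_continuous_on)
  \<comment> \<open>The linearized field is bounded by L (|y0| + r) on the ball of radius r about
    y0. Times the interval length this is at most (2 r - 1) / 2, so \<open>picard\<close> never
    leaves the ball.\<close>
  define r where "r = norm y0 + 1"
  have "\<exists>Y. Y 0 = y0 \<and> (\<forall>t\<in>{-S..S}. Y t \<in> cball y0 r \<and> (Y has_vector_derivative ?D (z t 0) (Y t)) (at t within {-S..S}))"
  proof (rule picard[OF I0, of r y0 "\<lambda>t. ?D (z t 0)" L "L * (norm y0 + r)"])
    show "0 \<le> r" by (simp add: r_def)
    show "L * (S - - S) \<le> 1 / 2" "0 \<le> L" using LS L by auto
    show "L * (norm y0 + r) * (S - - S) \<le> r"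
      using mult_right_mono[OF LS, of "norm y0 + r"] by (simp add: r_def algebra_simps)
    fix t assume t: "t \<in> {-S..S}"
    then have tK: "z t 0 \<in> cball z0 R" using z0K by (simp add: I_def)
    show "norm (?D (z t 0) x - ?D (z t 0) y) \<le> L * norm (x - y)" for x y
      using L(2)[OF tK, of "x - y"] by (simp add: linear_diff[OF lin[OF tK]])
    show "norm (?D (z t 0) x) \<le> L * (norm y0 + r)" if "x \<in> cball y0 r" for x
    proof -
      have "norm x \<le> norm y0 + r" using that norm_triangle_sub[of x y0] by (simp add: dist_norm norm_minus_commute)
      then show ?thesis using L(2)[OF tK, of x] mult_left_mono[OF _ L(1)] order_trans by blast
    qed
  next
    have "?D (z t 0) x = (\<Sum>b\<in>Basis. (x \<bullet> b) *\<^sub>R ?D (z t 0) b)" if "t \<in> {-S..S}" for t x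
    proof -
      have l: "linear (?D (z t 0))" using lin z0K that by (simp add: I_def)
      show ?thesis by (subst euclidean_representation[of x, symmetric]) (simp add: linear_sum[OF l] linear_scale[OF l])
    qed
    then have eq: "(case p of (t, x) \<Rightarrow> ?D (z t 0) x) = (\<Sum>b\<in>Basis. (snd p \<bullet> b) *\<^sub>R ?D (z (fst p) 0) b)"
      if "p \<in> {-S..S} \<times> cball y0 r" for p
      using that by auto
    have "continuous_on {-S..S} (\<lambda>t. ?D (z t 0) b)" if "b \<in> Basis" for b
    proof (rule continuous_on_compose2[where f = "\<lambda>t. z t 0" and t = U and g = "\<lambda>x. ?D x b"])
      show "continuous_on U (\<lambda>x. ?D x b)" using G1 that by simp
    qed (use zc z0K K in \<open>auto simp: I_def\<close>)
    then have "continuous_on ({-S..S} \<times> cball y0 r) (\<lambda>p. ?D (z (fst p) 0) b)" if "b \<in> Basis" for b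
      using that by (intro continuous_on_compose2[where f = fst and t = "{-S..S}" and g = "\<lambda>t. ?D (z t 0) b"]) (auto intro: continuous_intros)
    then have "continuous_on ({-S..S} \<times> cball y0 r) (\<lambda>p. \<Sum>b\<in>Basis. (snd p \<bullet> b) *\<^sub>R ?D (z (fst p) 0) b)"
      by (intro continuous_intros) auto
    then show "continuous_on ({-S..S} \<times> cball y0 r) (\<lambda>(t, x). ?D (z t 0) x)"
      by (subst continuous_on_cong[OF refl eq]) auto
  qed blast
  then obtain Y where Y: "Y 0 = y0" "\<And>t. t \<in> I \<Longrightarrow> (Y has_vector_derivative ?D (z t 0) (Y t)) (at t within I)"
    by (auto simp: I_def)
  define \<Delta> where "\<Delta> s t = z t s - z t 0" for s t
  have \<Delta>D: "(\<Delta> s has_vector_derivative (G (z t s) - G (z t 0))) (at t within {-S..S})" if "t \<in> {-S..S}" "\<bar>s\<bar> < s0" for s t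
  proof -
    have "\<bar>t\<bar> < T" using IT that(1) by (simp add: I_def)
    then have "((\<lambda>t. z t s - z t 0) has_vector_derivative (G (z t s) - G (z t 0))) (at t)"
      by (intro has_vector_derivative_diff zD) (use that(2) s0 in auto)
    then show ?thesis unfolding \<Delta>_def by (rule has_vector_derivative_at_within)
  qed
  have \<Delta>: "norm (\<Delta> s t) \<le> 2 * norm (\<Delta> s 0)" if "t \<in> I" "\<bar>s\<bar> < s0" for s t
  proof -
    have "norm (\<Delta> s t) \<le> 2 * (norm (\<Delta> s 0) + (S - (-S)) * 0)"
    proof (rule short_time_bound[OF I0 _ \<Delta>D _ L(1) LS])
      fix t assume t: "t \<in> {-S..S}"
      then have "\<bar>t\<bar> < T" using IT by (simp add: I_def)
      then have "norm (G (z t s) - G (z t 0)) \<le> L * norm (z t s - z t 0)"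
        by (intro L(3) zK) (use that(2) s0 in auto)
      then show "norm (G (z t s) - G (z t 0)) \<le> L * norm (\<Delta> s t) + 0" by (simp add: \<Delta>_def)
    qed (use that in \<open>auto simp: I_def\<close>)
    then show ?thesis by simp
  qed
  \<comment> \<open>The error \<open>E\<close> satisfies the linearized equation up to a Taylor
    remainder quadratic in \<Delta>. As \<Delta> is controlled by its value at time 0, the error
    stays of order o(s) if it is so at time 0.\<close>
  define E where "E s t = \<Delta> s t - s *\<^sub>R Y t" for s t
  have E: "norm (E s t) \<le> 2 * (norm (E s 0) + (S - (-S)) * (C * (2 * norm (\<Delta> s 0)) ^ 2))" if t: "t \<in> I" and s: "\<bar>s\<bar> < s0" for s t
  proof (rule short_time_bound[OF I0 _ _ _ L(1) LS, where z = "E s"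
        and z' = "\<lambda>t. G (z t s) - G (z t 0) - s *\<^sub>R ?D (z t 0) (Y t)"])
    show "t \<in> {-S..S}" using t by (simp add: I_def)
    show "0 \<le> C * (2 * norm (\<Delta> s 0))\<^sup>2" using C by simp
    fix t assume t: "t \<in> {-S..S}"
    then have tI: "t \<in> I" by (simp add: I_def)
    show "(E s has_vector_derivative G (z t s) - G (z t 0) - s *\<^sub>R ?D (z t 0) (Y t)) (at t within {-S..S})"
      unfolding E_def using \<Delta>D[OF t s] Y(2)[OF tI]
      by (intro has_vector_derivative_diff bounded_linear.has_vector_derivative[OF bounded_linear_scaleR_right]) (auto simp: I_def)
    let ?r = "G (z t s) - G (z t 0) - ?D (z t 0) (\<Delta> s t)"
    have "norm ?r \<le> C * norm (\<Delta> s t) ^ 2"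
      unfolding \<Delta>_def by (rule C(2)) (use zK IT[OF tI] s s0 in auto)
    also have "\<dots> \<le> C * (2 * norm (\<Delta> s 0)) ^ 2"
      by (intro mult_left_mono power_mono C \<Delta> tI s) auto
    finally have r: "norm ?r \<le> C * (2 * norm (\<Delta> s 0)) ^ 2" .
    have l: "linear (?D (z t 0))" using lin z0K tI by blast
    have eq: "G (z t s) - G (z t 0) - s *\<^sub>R ?D (z t 0) (Y t) = ?D (z t 0) (E s t) + ?r"
      by (simp add: E_def linear_diff[OF l] linear_scale[OF l])
    show "norm (G (z t s) - G (z t 0) - s *\<^sub>R ?D (z t 0) (Y t)) \<le> L * norm (E s t) + C * (2 * norm (\<Delta> s 0))\<^sup>2"
      unfolding eq using norm_triangle_ineq[of "?D (z t 0) (E s t)" ?r] r L(2)[OF z0K[OF tI], of "E s t"] by linarith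
  qed
  have hd: "((\<lambda>s. z t s) has_vector_derivative Y t) (at 0)" if t: "\<bar>t\<bar> < S" for t
  proof -
    have tI: "t \<in> I" using t by (auto simp: I_def)
    have q0: "((\<lambda>s. norm (E s 0) / norm s) \<longlongrightarrow> 0) (at 0)"
      using init unfolding has_vector_derivative_def has_derivative_at by (simp add: E_def \<Delta>_def Y(1))
    have q1: "((\<lambda>s. z 0 s) \<longlongrightarrow> z 0 0) (at 0)"
      using has_vector_derivative_continuous[OF init] by (simp add: isCont_def)
    then have q2: "((\<lambda>s. norm (\<Delta> s 0)) \<longlongrightarrow> 0) (at 0)"
      unfolding \<Delta>_def by (intro tendsto_norm_zero) (simp add: LIM_zero)
    have q3: "((\<lambda>s. norm (\<Delta> s 0) / norm s) \<longlongrightarrow> norm y0) (at 0)"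
    proof -
      have "((\<lambda>s. inverse s *\<^sub>R (E s 0)) \<longlongrightarrow> 0) (at 0)"
        by (rule tendsto_norm_zero_cancel) (use q0 in \<open>simp add: divide_inverse mult.commute\<close>)
      then have "((\<lambda>s. norm (inverse s *\<^sub>R (E s 0) + y0)) \<longlongrightarrow> norm (0 + y0)) (at 0)"
        by (intro tendsto_intros)
      moreover have "norm (inverse s *\<^sub>R (E s 0) + y0) = norm (\<Delta> s 0) / norm s" if "s \<noteq> 0" for s
      proof -
        have "inverse s *\<^sub>R (E s 0) + y0 = inverse s *\<^sub>R \<Delta> s 0" using that by (simp add: E_def Y(1) algebra_simps)
        then show ?thesis by (simp add: divide_inverse mult.commute)
      qed
      ultimately show ?thesis
        by (auto elim!: Lim_transform_eventually simp: eventually_at intro!: exI[of _ 1])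
    qed
    \<comment> \<open>The first quotient tends to 0 by the differentiability of the initial values;
      in the second term a convergent quotient is multiplied by \<Delta>, which tends to 0.\<close>
    have lim: "((\<lambda>s. 2 * (norm (E s 0) / norm s + (S - (-S)) * (C * 4 * (norm (\<Delta> s 0) * (norm (\<Delta> s 0) / norm s))))) \<longlongrightarrow>
        2 * (0 + (S - (-S)) * (C * 4 * (0 * norm y0)))) (at 0)"
      by (intro tendsto_intros q0 q2 q3)
    show ?thesis
      unfolding has_vector_derivative_def has_derivative_at
    proof (intro conjI bounded_linear_scaleR_left)
      show "(\<lambda>h. norm (z t (0 + h) - z t 0 - h *\<^sub>R Y t) / norm h) \<midarrow>0\<rightarrow> 0"
      proof (rule Lim_null_comparison)
        show "((\<lambda>s. 2 * (norm (E s 0) / norm s + (S - (-S)) * (C * 4 * (norm (\<Delta> s 0) * (norm (\<Delta> s 0) / norm s))))) \<longlongrightarrow> 0) (at 0)"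
          using lim by simp
        have "norm (norm (z t (0 + s) - z t 0 - s *\<^sub>R Y t) / norm s)
          \<le> 2 * (norm (E s 0) / norm s + (S - (-S)) * (C * 4 * (norm (\<Delta> s 0) * (norm (\<Delta> s 0) / norm s))))"
          if s: "s \<noteq> 0" "\<bar>s\<bar> < s0" for s
        proof -
          have "norm (z t (0 + s) - z t 0 - s *\<^sub>R Y t) = norm (E s t)" by (simp add: E_def \<Delta>_def)
          then show ?thesis
            using divide_right_mono[OF E[OF tI s(2)], of "norm s"] by (simp add: power2_eq_square add_divide_distrib algebra_simps)
        qed
        then show "\<forall>\<^sub>F s in at 0. norm (norm (z t (0 + s) - z t 0 - s *\<^sub>R Y t) / norm s)
          \<le> 2 * (norm (E s 0) / norm s + (S - (-S)) * (C * 4 * (norm (\<Delta> s 0) * (norm (\<Delta> s 0) / norm s))))"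
          unfolding eventually_at using s0 by (intro exI[of _ s0]) (auto simp: dist_norm)
      qed
    qed
  qed
  have "(Y has_vector_derivative ?D (z 0 0) y0) (at 0)"
    using Y(2)[of 0] S Y(1) by (simp add: I_def at_within_Icc_at)
  with that[OF S(1) Y(1) _ hd] show ?thesis by blast
qed

text \<open>A solution is built along the rays from \<open>y0\<close>; the compatibility condition makes the error
  \<open>z\<close> of the expected linearization satisfy a linear equation up to quadratic terms.\<close>

lemma pfaff_system:
  fixes H :: "'e::euclidean_space \<times> real \<Rightarrow> 'e"
  assumes U: "open U" and H: "Ck_on 2 U H" and yw0: "(y0, w0) \<in> U"
    and sym: "\<And>p a b. p \<in> U \<Longrightarrow> frechet_derivative H (at p) (a, H p \<bullet> a) \<bullet> b = frechet_derivative H (at p) (b, H p \<bullet> b) \<bullet> a"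
  obtains \<rho> \<nu> where "0 < \<rho>" "\<nu> y0 = w0"
    "\<And>y. y \<in> ball y0 \<rho> \<Longrightarrow> (y, \<nu> y) \<in> U \<and> (\<nu> has_derivative (\<lambda>h. H (y, \<nu> y) \<bullet> h)) (at y)"
proof -
  let ?D = "\<lambda>p. frechet_derivative H (at p)"
  obtain R where R: "0 < R" "cball (y0, w0) R \<subseteq> U" using U yw0 open_contains_cball by blast
  let ?K = "cball (y0, w0) R"
  have H2: "Ck_on (Suc 1) U H" and H1: "Ck_on 1 U H"
    using H Ck_on_le[OF H, of 1] by (simp_all add: numeral_2_eq_2)
  have Kc: "compact ?K" "convex ?K" by auto
  obtain L where L: "0 \<le> L" "\<And>x h. x \<in> ?K \<Longrightarrow> norm (?D x h) \<le> L * norm h"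
    "\<And>x y. x \<in> ?K \<Longrightarrow> y \<in> ?K \<Longrightarrow> norm (H x - H y) \<le> L * norm (x - y)"
    using Ck_on_lipschitz[OF H1 Kc R(2)] by blast
  obtain C where C: "0 \<le> C" "\<And>x y. x \<in> ?K \<Longrightarrow> y \<in> ?K \<Longrightarrow>
      norm (H y - H x - ?D x (y - x)) \<le> C * norm (y - x) ^ 2"
    using Ck_on_taylor[OF U H Kc R(2)] by blast
  have lin: "linear (?D x)" if "x \<in> ?K" for x
    using Ck_on_Suc_has_derivative[OF H2] R that has_derivative_linear by blast
  have cH: "continuous_on ?K H"
    using Ck_on_imp_continuous_on[OF H] R(2) continuous_on_subset by blast
  define M where "M = norm (H (y0, w0)) + L * R"
  have M: "norm (H x) \<le> M" if "x \<in> ?K" for x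
  proof -
    have "norm (H x - H (y0, w0)) \<le> L * norm (x - (y0, w0))" by (rule L(3)[OF that]) (use R in auto)
    also have "\<dots> \<le> L * R" using that by (intro mult_left_mono L) (simp add: dist_norm norm_minus_commute)
    finally show ?thesis using norm_triangle_sub[of "H x" "H (y0, w0)"] by (simp add: M_def)
  qed
  have M0: "0 \<le> M" using L R by (simp add: M_def)
  \<comment> \<open>With these bounds a ray of length at most \<rho>, together with values within
    R/2 of w0, stays in \<open>?K\<close>. On the unit interval the equation along the ray has
    Lipschitz constant \<rho> L at most 1/2 and a right-hand side bounded by \<rho> M, at most
    R/2.\<close>
  define \<rho> where "\<rho> = min (R / 2) (min (R / (2 * (M + 1))) (1 / (2 * (L + 1))))"
  have \<rho>: "0 < \<rho>" "\<rho> \<le> R / 2" using R(1) M0 L(1) unfolding \<rho>_def by (simp, linarith)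
  have \<rho>M: "\<rho> * M \<le> R / 2"
  proof -
    have "\<rho> * M \<le> R / (2 * (M + 1)) * M" using M0 by (intro mult_right_mono) (auto simp: \<rho>_def)
    also have "\<dots> \<le> R / 2" using M0 R by (simp add: field_simps)
    finally show ?thesis .
  qed
  have \<rho>L: "\<rho> * L \<le> 1 / 2"
  proof -
    have "\<rho> * L \<le> 1 / (2 * (L + 1)) * L" using L by (intro mult_right_mono) (auto simp: \<rho>_def)
    also have "\<dots> \<le> 1 / 2" using L by (simp add: field_simps)
    finally show ?thesis .
  qed
  have inK: "(y0 + s *\<^sub>R u, w) \<in> ?K" if "norm u \<le> \<rho>" "s \<in> {0..1}" "w \<in> cball w0 (R / 2)" for s u w
  proof -
    have "norm (s *\<^sub>R u) \<le> R / 2" using that \<rho> mult_mono[of s 1 "norm u" "R / 2"] by auto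
    then have "norm (- (s *\<^sub>R u), w0 - w) \<le> R / 2 + R / 2"
      using that(3) norm_Pair_le[of "- (s *\<^sub>R u)" "w0 - w"] by (simp add: dist_norm)
    then show ?thesis by (simp add: dist_norm)
  qed
  have I0: "(0::real) \<in> {0..1}" by simp
  \<comment> \<open>Restricted to the ray s -> y0 + s u the system is an ordinary differential
    equation on the unit interval; the solution of the system at y0 + u will be its value at s =
    1.\<close>
  have "\<exists>W. W 0 = w0 \<and> (\<forall>s\<in>{0..1}. W s \<in> cball w0 (R / 2) \<and>
      (W has_vector_derivative (H (y0 + s *\<^sub>R u, W s) \<bullet> u)) (at s within {0..1}))" if u: "norm u \<le> \<rho>" for u
  proof (rule picard[OF I0, of "R / 2" w0 "\<lambda>s w. H (y0 + s *\<^sub>R u, w) \<bullet> u" "\<rho> * L" "\<rho> * M"])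
    show "continuous_on ({0..1} \<times> cball w0 (R / 2)) (\<lambda>(s, w). H (y0 + s *\<^sub>R u, w) \<bullet> u)"
      unfolding case_prod_unfold using inK[OF u]
      by (intro continuous_intros continuous_on_compose2[OF cH]) (auto simp del: mem_cball)
    fix s w assume s: "s \<in> {0..1::real}" and w: "w \<in> cball w0 (R / 2)"
    show "norm (H (y0 + s *\<^sub>R u, w) \<bullet> u) \<le> \<rho> * M"
      using Cauchy_Schwarz_ineq2[of "H (y0 + s *\<^sub>R u, w)" u] mult_mono[OF M[OF inK[OF u s w]] u M0] by (simp add: mult.commute)
    fix w' assume w': "w' \<in> cball w0 (R / 2)"
    have "norm (H (y0 + s *\<^sub>R u, w) - H (y0 + s *\<^sub>R u, w')) \<le> L * norm (w - w')"
      using L(3)[OF inK[OF u s w] inK[OF u s w']] by simp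
    then have "norm (H (y0 + s *\<^sub>R u, w) - H (y0 + s *\<^sub>R u, w')) * norm u \<le> (L * norm (w - w')) * \<rho>"
      using u L by (intro mult_mono) auto
    then show "norm (H (y0 + s *\<^sub>R u, w) \<bullet> u - H (y0 + s *\<^sub>R u, w') \<bullet> u) \<le> \<rho> * L * norm (w - w')"
      using Cauchy_Schwarz_ineq2[of "H (y0 + s *\<^sub>R u, w) - H (y0 + s *\<^sub>R u, w')" u] by (simp add: inner_diff_left mult_ac)
  qed (use R L \<rho> \<rho>M \<rho>L in auto)
  then obtain W where W: "\<And>u. norm u \<le> \<rho> \<Longrightarrow> W u 0 = w0"
    "\<And>u s. norm u \<le> \<rho> \<Longrightarrow> s \<in> {0..1} \<Longrightarrow> W u s \<in> cball w0 (R / 2)"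
    "\<And>u s. norm u \<le> \<rho> \<Longrightarrow> s \<in> {0..1} \<Longrightarrow> (W u has_vector_derivative (H (y0 + s *\<^sub>R u, W u s) \<bullet> u)) (at s within {0..1})"
    by metis
  define P where "P u s = (y0 + s *\<^sub>R u, W u s)" for u s
  have PK: "P u s \<in> ?K" if "norm u \<le> \<rho>" "s \<in> {0..1}" for u s
    unfolding P_def using inK[OF that W(2)[OF that]] .
  define \<nu> where "\<nu> y = W (y - y0) 1" for y
  define k where "k = 2 * (M + \<rho> * L)"
  have k0: "0 \<le> k" using M0 \<rho> L by (simp add: k_def)
  define c where "c = \<rho> * C * (1 + k) ^ 2 + L * (1 + k)"
  have c0: "0 \<le> c" using \<rho> C L k0 by (simp add: c_def)
  have main: "norm (W (u + d) 1 - W u 1 - H (P u 1) \<bullet> d) \<le> 2 * c * norm d ^ 2"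
    if u: "norm u \<le> \<rho>" and ud: "norm (u + d) \<le> \<rho>" for u d
  proof -
    let ?\<Delta> = "\<lambda>s. W (u + d) s - W u s"
    let ?e = "\<lambda>s. P (u + d) s - P u s"
    have PD: "norm (?e s) \<le> norm d + norm (?\<Delta> s)" if "s \<in> {0..1}" for s
    proof -
      have "norm (?e s) \<le> norm (s *\<^sub>R d) + norm (?\<Delta> s)"
        using norm_Pair_le[of "s *\<^sub>R d" "?\<Delta> s"] unfolding P_def by (simp add: scaleR_add_right del: norm_scaleR)
      then show ?thesis using that mult_right_mono[of s 1 "norm d"] by auto
    qed
    have HD: "norm (H (P (u + d) s) - H (P u s)) \<le> L * (norm d + norm (?\<Delta> s))" if "s \<in> {0..1}" for s
      using L(3)[OF PK[OF ud that] PK[OF u that]] mult_left_mono[OF PD[OF that] L(1)] by linarith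
    have \<Delta>: "norm (?\<Delta> s) \<le> k * norm d" if s: "s \<in> {0..1}" for s
    proof -
      have "norm (?\<Delta> s) \<le> 2 * (norm (?\<Delta> 0) + (1 - 0) * ((M + \<rho> * L) * norm d))"
      proof (rule short_time_bound[OF I0 s, where L = "\<rho> * L"
            and z' = "\<lambda>s. H (P (u + d) s) \<bullet> (u + d) - H (P u s) \<bullet> u"])
        fix s assume s: "s \<in> {0..1::real}"
        show "(?\<Delta> has_vector_derivative (H (P (u + d) s) \<bullet> (u + d) - H (P u s) \<bullet> u)) (at s within {0..1})"
          unfolding P_def by (intro has_vector_derivative_diff W(3) u ud s)
        have eq: "H (P (u + d) s) \<bullet> (u + d) - H (P u s) \<bullet> u = H (P (u + d) s) \<bullet> d + (H (P (u + d) s) - H (P u s)) \<bullet> u"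
          by (simp add: inner_diff_left inner_add_right)
        have "norm (H (P (u + d) s) \<bullet> d) \<le> M * norm d"
          using Cauchy_Schwarz_ineq2[of "H (P (u + d) s)" d] mult_right_mono[OF M[OF PK[OF ud s]], of "norm d"] by simp
        moreover have "norm ((H (P (u + d) s) - H (P u s)) \<bullet> u) \<le> L * (norm d + norm (?\<Delta> s)) * \<rho>"
          using Cauchy_Schwarz_ineq2[of "H (P (u + d) s) - H (P u s)" u]
            mult_mono[OF HD[OF s] u] L(1) by simp
        ultimately show "norm (H (P (u + d) s) \<bullet> (u + d) - H (P u s) \<bullet> u) \<le> \<rho> * L * norm (?\<Delta> s) + (M + \<rho> * L) * norm d"
          unfolding eq using norm_triangle_ineq[of "H (P (u + d) s) \<bullet> d" "(H (P (u + d) s) - H (P u s)) \<bullet> u"]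
          by (simp add: algebra_simps)
      qed (use \<rho> L M0 \<rho>L in auto)
      then show ?thesis using W(1) u ud by (simp add: k_def algebra_simps)
    qed
    \<comment> \<open>At parameter s the rays of u + d and u are s d apart, so s (H . d) is the
      expected first order change of W.\<close>
    let ?z = "\<lambda>s. ?\<Delta> s - s * (H (P u s) \<bullet> d)"
    have PDer: "(P u has_vector_derivative (u, H (P u s) \<bullet> u)) (at s within {0..1})" if s: "s \<in> {0..1}" for s
      unfolding P_def[abs_def] by (intro has_vector_derivative_Pair W(3)[OF u s]) (auto intro!: derivative_eq_intros)
    have "norm (?z 1) \<le> 2 * (norm (?z 0) + (1 - 0) * (c * norm d ^ 2))"
    proof (rule short_time_bound[OF I0, where L = "\<rho> * L" and z = ?z and t = 1
          and z' = "\<lambda>s. H (P (u + d) s) \<bullet> (u + d) - H (P u s) \<bullet> u - (s * (?D (P u s) (u, H (P u s) \<bullet> u) \<bullet> d) + H (P u s) \<bullet> d)"])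
      fix s assume s: "s \<in> {0..1::real}"
      have HP: "((\<lambda>s. H (P u s)) has_vector_derivative ?D (P u s) (u, H (P u s) \<bullet> u)) (at s within {0..1})"
      proof -
        have "P u s \<in> U" using PK[OF u s] R by blast
        from vector_derivative_diff_chain_within[OF PDer[OF s] has_derivative_at_withinI[OF Ck_on_Suc_has_derivative[OF H2 this]]]
        show ?thesis by (simp add: o_def)
      qed
      have HPd: "((\<lambda>s. H (P u s) \<bullet> d) has_vector_derivative (?D (P u s) (u, H (P u s) \<bullet> u) \<bullet> d)) (at s within {0..1})"
        by (rule bounded_linear.has_vector_derivative[OF bounded_linear_inner_left HP])
      show "(?z has_vector_derivative (H (P (u + d) s) \<bullet> (u + d) - H (P u s) \<bullet> u - (s * (?D (P u s) (u, H (P u s) \<bullet> u) \<bullet> d) + H (P u s) \<bullet> d))) (at s within {0..1})"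
        using W(3)[OF u s, folded P_def] W(3)[OF ud s, folded P_def] HPd
        by (auto intro!: derivative_eq_intros simp: has_real_derivative_iff_has_vector_derivative[symmetric])
      have l: "linear (?D (P u s))" using lin PK[OF u s] by blast
      let ?r = "H (P (u + d) s) - H (P u s) - ?D (P u s) (?e s)"
      have e: "?e s = (s *\<^sub>R d, ?\<Delta> s)" by (simp add: P_def scaleR_add_right)
      have dec: "?D (P u s) (?e s) = s *\<^sub>R ?D (P u s) (d, H (P u s) \<bullet> d) + ?D (P u s) (0, ?z s)"
      proof -
        have "?e s = s *\<^sub>R (d, H (P u s) \<bullet> d) + (0, ?z s)" by (simp add: e)
        then show ?thesis by (simp only: linear_add[OF l] linear_scale[OF l])
      qed
      \<comment> \<open>\<open>sym\<close> exchanges u and d in the derivative of H. The terms with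
        s then cancel, leaving a term linear in \<open>?z\<close>, a Taylor remainder and a product
        of two small increments; the last two are quadratic in d.\<close>
      have eq: "H (P (u + d) s) \<bullet> (u + d) - H (P u s) \<bullet> u - (s * (?D (P u s) (u, H (P u s) \<bullet> u) \<bullet> d) + H (P u s) \<bullet> d)
        = ?D (P u s) (0, ?z s) \<bullet> u + ?r \<bullet> u + (H (P (u + d) s) - H (P u s)) \<bullet> d"
      proof -
        have "s * (?D (P u s) (u, H (P u s) \<bullet> u) \<bullet> d) = s * (?D (P u s) (d, H (P u s) \<bullet> d) \<bullet> u)"
          using sym[of "P u s" u d] PK[OF u s] R by auto
        then show ?thesis unfolding dec by (simp add: inner_add_left inner_diff_left inner_add_right)
      qed
      have en: "norm (?e s) \<le> (1 + k) * norm d" using PD[OF s] \<Delta>[OF s] by (simp add: algebra_simps)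
      have b1: "norm (?D (P u s) (0, ?z s) \<bullet> u) \<le> \<rho> * L * norm (?z s)"
        using Cauchy_Schwarz_ineq2[of "?D (P u s) (0, ?z s)" u] mult_mono[OF L(2)[OF PK[OF u s], of "(0, ?z s)"] u] L(1)
        by (simp add: mult_ac)
      have "norm ?r \<le> C * norm (?e s) ^ 2" by (rule C(2)[OF PK[OF u s] PK[OF ud s]])
      also have "\<dots> \<le> C * ((1 + k) * norm d) ^ 2" by (intro mult_left_mono power_mono en C) auto
      finally have r: "norm ?r \<le> C * ((1 + k) * norm d) ^ 2" .
      have b2: "norm (?r \<bullet> u) \<le> \<rho> * C * (1 + k) ^ 2 * norm d ^ 2"
        using Cauchy_Schwarz_ineq2[of ?r u] mult_mono[OF r u] C(1) by (simp add: power_mult_distrib mult_ac)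
      have "norm (H (P (u + d) s) - H (P u s)) \<le> L * ((1 + k) * norm d)"
        using L(3)[OF PK[OF ud s] PK[OF u s]] mult_left_mono[OF en L(1)] by linarith
      then have b3: "norm ((H (P (u + d) s) - H (P u s)) \<bullet> d) \<le> L * (1 + k) * norm d ^ 2"
        using Cauchy_Schwarz_ineq2[of "H (P (u + d) s) - H (P u s)" d]
          mult_right_mono[of "norm (H (P (u + d) s) - H (P u s))" "L * ((1 + k) * norm d)" "norm d"]
        by (simp add: power2_eq_square mult_ac)
      show "norm (H (P (u + d) s) \<bullet> (u + d) - H (P u s) \<bullet> u - (s * (?D (P u s) (u, H (P u s) \<bullet> u) \<bullet> d) + H (P u s) \<bullet> d))
          \<le> \<rho> * L * norm (?z s) + c * norm d ^ 2"
        unfolding eq c_def using b1 b2 b3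
          norm_triangle_ineq[of "?D (P u s) (0, ?z s) \<bullet> u + ?r \<bullet> u" "(H (P (u + d) s) - H (P u s)) \<bullet> d"]
          norm_triangle_ineq[of "?D (P u s) (0, ?z s) \<bullet> u" "?r \<bullet> u"]
        by (simp only: distrib_right)
    qed (use \<rho> L \<rho>L c0 in auto)
    then show ?thesis using W(1) u ud by simp
  qed
  show ?thesis
  proof (rule that[OF \<rho>(1), of \<nu>])
    \<comment> \<open>For u = 0 the ray does not move and the equation along it is w' = 0.\<close>
    have "norm (W 0 1 - w0) \<le> 2 * (norm (W 0 0 - w0) + (1 - 0) * 0)"
    proof (rule short_time_bound[OF I0, where L = 0 and z' = "\<lambda>_. 0"])
      show "((\<lambda>t. W 0 t - w0) has_vector_derivative 0) (at t within {0..1})" if "t \<in> {0..1}" for t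
        using W(3)[of 0 t] that \<rho> by (auto intro!: derivative_eq_intros)
    qed auto
    then show "\<nu> y0 = w0" using W(1)[of 0] \<rho> by (simp add: \<nu>_def)
    fix y assume y: "y \<in> ball y0 \<rho>"
    then have n: "norm (y - y0) < \<rho>" by (simp add: dist_norm norm_minus_commute)
    have P1: "P (y - y0) 1 = (y, \<nu> y)" by (simp add: P_def \<nu>_def)
    show "(y, \<nu> y) \<in> U \<and> (\<nu> has_derivative (\<lambda>h. H (y, \<nu> y) \<bullet> h)) (at y)"
    proof
      show "(y, \<nu> y) \<in> U" using PK[of "y - y0" 1] n R unfolding P1[symmetric] by auto
      show "(\<nu> has_derivative (\<lambda>h. H (y, \<nu> y) \<bullet> h)) (at y)"
      proof (rule has_derivative_quadratic)
        show "bounded_linear (\<lambda>h. H (y, \<nu> y) \<bullet> h)" by (rule bounded_linear_inner_right)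
        show "0 < \<rho> - norm (y - y0)" using n by simp
        fix h :: 'e assume "norm h < \<rho> - norm (y - y0)"
        then have "norm ((y - y0) + h) \<le> \<rho>" using norm_triangle_ineq[of "y - y0" h] by linarith
        from main[OF _ this] n show "norm (\<nu> (y + h) - \<nu> y - H (y, \<nu> y) \<bullet> h) \<le> 2 * c * norm h ^ 2"
          unfolding P1 by (simp add: \<nu>_def algebra_simps)
      qed
    qed
  qed
qed

section \<open>Charts and tangent vectors\<close>

locale manifold =
  fixes A :: "('m::{t2_space,second_countable_topology}, 'n::finite) chart set"
  assumes smooth_manifold: "smooth_manifold A"
begin

abbreviation cim :: "('m, 'n) chart \<Rightarrow> (real^'n) set" where
  "cim c \<equiv> cmap c ` cdom c"

lemma chartD:
  assumes "c \<in> A"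
  shows "open (cdom c)" "open (cim c)" "homeomorphism (cdom c) (cim c) (cmap c) (cinv c)"
proof -
  have "is_chart c" using assms smooth_manifold unfolding smooth_manifold_def by blast
  then show "open (cdom c)" "open (cim c)" "homeomorphism (cdom c) (cim c) (cmap c) (cinv c)"
    unfolding is_chart_def by blast+
qed

lemma cinv_cmap: "c \<in> A \<Longrightarrow> p \<in> cdom c \<Longrightarrow> cinv c (cmap c p) = p"
  using chartD(3) homeomorphism_apply1 by blast

lemma cmap_cinv: "c \<in> A \<Longrightarrow> x \<in> cim c \<Longrightarrow> cmap c (cinv c x) = x"
  using chartD(3) homeomorphism_apply2 by blast

lemma cinv_in: "c \<in> A \<Longrightarrow> x \<in> cim c \<Longrightarrow> cinv c x \<in> cdom c"
  using cinv_cmap by auto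

lemma continuous_on_cmap: "c \<in> A \<Longrightarrow> continuous_on (cdom c) (cmap c)"
  using chartD(3) homeomorphism_cont1 by blast

lemma continuous_on_cinv: "c \<in> A \<Longrightarrow> continuous_on (cim c) (cinv c)"
  using chartD(3) homeomorphism_cont2 by blast

lemma isCont_cinv: "c \<in> A \<Longrightarrow> x \<in> cim c \<Longrightarrow> isCont (cinv c) x"
  using continuous_on_cinv chartD(2) continuous_on_eq_continuous_at by blast

lemma chart_cover: "\<exists>c\<in>A. p \<in> cdom c"
  using smooth_manifold unfolding smooth_manifold_def by blast

lemma open_chart_preimage: "c \<in> A \<Longrightarrow> open W \<Longrightarrow> open {p \<in> cdom c. cmap c p \<in> W}"
  using continuous_open_preimage[OF continuous_on_cmap chartD(1), of c W]
  by (simp add: vimage_def Int_def)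

lemma image_eq_cinv: "c \<in> A \<Longrightarrow> cmap c ` (cdom c \<inter> X) = {x \<in> cim c. cinv c x \<in> X}"
  using cinv_cmap by (auto simp: image_iff)

lemma open_chart_image: "c \<in> A \<Longrightarrow> open X \<Longrightarrow> open (cmap c ` (cdom c \<inter> X))"
  unfolding image_eq_cinv using continuous_open_preimage[OF continuous_on_cinv chartD(2), of c X]
  by (simp add: vimage_def Int_def)

lemma smooth_transition:
  "c \<in> A \<Longrightarrow> d \<in> A \<Longrightarrow> smooth_on (cmap c ` (cdom c \<inter> cdom d)) (cmap d \<circ> cinv c)"
  using smooth_manifold unfolding smooth_manifold_def compatible_def by blast

definition TD :: "('m, 'n) chart \<Rightarrow> ('m, 'n) chart \<Rightarrow> 'm \<Rightarrow> real^'n \<Rightarrow> real^'n" where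
  "TD c d p = frechet_derivative (cmap d \<circ> cinv c) (at (cmap c p))"

lemma TD_has_derivative:
  "c \<in> A \<Longrightarrow> d \<in> A \<Longrightarrow> p \<in> cdom c \<Longrightarrow> p \<in> cdom d \<Longrightarrow> ((cmap d \<circ> cinv c) has_derivative TD c d p) (at (cmap c p))"
  unfolding TD_def using smooth_on_has_derivative[OF smooth_transition, of c d "cmap c p"] by blast

lemma TD_linear: "c \<in> A \<Longrightarrow> d \<in> A \<Longrightarrow> p \<in> cdom c \<Longrightarrow> p \<in> cdom d \<Longrightarrow> linear (TD c d p)"
  using TD_has_derivative has_derivative_linear by blast

lemma TD_unique:
  "c \<in> A \<Longrightarrow> d \<in> A \<Longrightarrow> p \<in> cdom c \<Longrightarrow> p \<in> cdom d \<Longrightarrow> ((cmap d \<circ> cinv c) has_derivative D) (at (cmap c p)) \<Longrightarrow> TD c d p = D"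
  unfolding TD_def using frechet_derivative_at by metis

lemma TD_chain:
  assumes "c \<in> A" "d \<in> A" "e \<in> A" "p \<in> cdom c" "p \<in> cdom d" "p \<in> cdom e"
  shows "TD d e p (TD c d p a) = TD c e p a"
proof -
  have "((cmap e \<circ> cinv d) \<circ> (cmap d \<circ> cinv c) has_derivative TD d e p \<circ> TD c d p) (at (cmap c p))"
    by (rule diff_chain_at[OF TD_has_derivative])
      (use assms TD_has_derivative cinv_cmap in auto)
  moreover have "open (cmap c ` (cdom c \<inter> cdom d))" using assms open_chart_image chartD by blast
  ultimately have "((cmap e \<circ> cinv c) has_derivative TD d e p \<circ> TD c d p) (at (cmap c p))"
    by (rule has_derivative_transform_within_open) (use assms cinv_cmap in auto)
  then show ?thesis using TD_unique assms by (metis comp_apply)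
qed

lemma TD_refl: "c \<in> A \<Longrightarrow> p \<in> cdom c \<Longrightarrow> TD c c p a = a"
proof -
  assume c: "c \<in> A" "p \<in> cdom c"
  have "((\<lambda>x. x) has_derivative (\<lambda>x. x)) (at (cmap c p))" by (rule has_derivative_ident)
  then have "((cmap c \<circ> cinv c) has_derivative (\<lambda>x. x)) (at (cmap c p))"
    by (rule has_derivative_transform_within_open[OF _ chartD(2)[OF c(1)]]) (use c cmap_cinv in auto)
  then show ?thesis using TD_unique c by metis
qed

lemma tvec_of_eq: "tvec_of A c p a = (\<lambda>d. if d \<in> A \<and> p \<in> cdom d then TD c d p a else 0)"
  unfolding tvec_of_def TD_def by (rule refl)

lemma tvec_of_apply: "d \<in> A \<Longrightarrow> p \<in> cdom d \<Longrightarrow> tvec_of A c p a d = TD c d p a"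
  by (simp add: tvec_of_eq)

lemma tvec_of_self: "c \<in> A \<Longrightarrow> p \<in> cdom c \<Longrightarrow> tvec_of A c p a c = a"
  by (simp add: tvec_of_apply TD_refl)

lemma tvec_of_in: "c \<in> A \<Longrightarrow> p \<in> cdom c \<Longrightarrow> tvec_of A c p a \<in> tangent_space A p"
  unfolding tangent_space_def TD_def[symmetric] by (simp add: tvec_of_eq TD_chain)

lemma tangent_spaceD: "w \<in> tangent_space A p \<Longrightarrow> c \<in> A \<Longrightarrow> p \<in> cdom c \<Longrightarrow> tvec_of A c p (w c) = w"
proof (rule ext)
  fix d assume w: "w \<in> tangent_space A p" and c: "c \<in> A" "p \<in> cdom c"
  have "w d = TD c d p (w c)" if "d \<in> A" "p \<in> cdom d"
    using w c that unfolding tangent_space_def TD_def by blast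
  moreover have "w d = 0" if "\<not> (d \<in> A \<and> p \<in> cdom d)"
    using w that unfolding tangent_space_def by blast
  ultimately show "tvec_of A c p (w c) d = w d" unfolding tvec_of_eq by presburger
qed

lemma tvec_of_change:
  assumes "c \<in> A" "p \<in> cdom c" "d \<in> A" "p \<in> cdom d"
  shows "tvec_of A d p (TD c d p a) = tvec_of A c p a"
  using tangent_spaceD[OF tvec_of_in[OF assms(1,2)] assms(3,4)] by (simp add: tvec_of_apply assms)

lemma tvec_of_comb:
  assumes "c \<in> A" "p \<in> cdom c"
  shows "tvec_of A c p (r *\<^sub>R a + s *\<^sub>R b) = (\<lambda>d. r *\<^sub>R tvec_of A c p a d + s *\<^sub>R tvec_of A c p b d)"
  using TD_linear[OF assms(1) _ assms(2)] by (auto simp: tvec_of_eq linear_add linear_scale)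

lemma tvec_of_scaleR:
  assumes "c \<in> A" "p \<in> cdom c"
  shows "tvec_of A c p (r *\<^sub>R a) = (\<lambda>d. r *\<^sub>R tvec_of A c p a d)"
  using TD_linear[OF assms(1) _ assms(2)] by (auto simp: tvec_of_eq linear_scale)

lemma tvec_of_zero: "c \<in> A \<Longrightarrow> p \<in> cdom c \<Longrightarrow> tvec_of A c p 0 = (\<lambda>_. 0)"
  using tvec_of_scaleR[of c p 0 0] by simp

lemma tangent_space_scaleR: "w \<in> tangent_space A p \<Longrightarrow> (\<lambda>c. r *\<^sub>R w c) \<in> tangent_space A p"
proof -
  assume w: "w \<in> tangent_space A p"
  obtain c where c: "c \<in> A" "p \<in> cdom c" using chart_cover by blast
  show ?thesis
    using tvec_of_in[OF c, of "r *\<^sub>R w c"] unfolding tvec_of_scaleR[OF c] tangent_spaceD[OF w c] .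
qed

text \<open>Continuity of \<gamma> is assumed separately: \<open>cmap c\<close> is arbitrary outside
  its domain, so differentiability of the coordinates alone would not keep the curve inside that
  domain.\<close>

lemma curve_change:
  assumes c: "c \<in> A" "d \<in> A" "\<gamma> t \<in> cdom c" "\<gamma> t \<in> cdom d" and \<gamma>: "isCont \<gamma> t"
    and D: "((cmap c \<circ> \<gamma>) has_vector_derivative a) (at t)"
  shows "((cmap d \<circ> \<gamma>) has_vector_derivative TD c d (\<gamma> t) a) (at t)"
proof -
  have "((cmap d \<circ> cinv c) has_derivative TD c d (\<gamma> t)) (at ((cmap c \<circ> \<gamma>) t))"
    using TD_has_derivative c by simp
  from vector_derivative_diff_chain_within[OF D has_derivative_at_withinI[OF this]]
  have "((\<lambda>s. cmap d (cinv c (cmap c (\<gamma> s)))) has_vector_derivative TD c d (\<gamma> t) a) (at t)"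
    by (simp add: o_def)
  moreover have "\<forall>\<^sub>F s in at t. \<gamma> s \<in> cdom c"
    using \<gamma> c chartD(1) by (auto simp: isCont_def tendsto_def)
  then have "\<forall>\<^sub>F s in at t. cmap d (cinv c (cmap c (\<gamma> s))) = cmap d (\<gamma> s)"
    by eventually_elim (simp add: cinv_cmap c)
  ultimately show ?thesis
    unfolding has_vector_derivative_def o_def
    by (rule has_derivative_transform_eventually) (auto simp: cinv_cmap c)
qed

lemma velocity_eq:
  assumes c: "c \<in> A" "\<gamma> t \<in> cdom c" and \<gamma>: "isCont \<gamma> t"
    and D: "((cmap c \<circ> \<gamma>) has_vector_derivative a) (at t)"
  shows "velocity A \<gamma> t = tvec_of A c (\<gamma> t) a"
  using curve_change[OF c(1) _ c(2) _ \<gamma> D] by (auto simp: velocity_def tvec_of_eq fun_eq_iff vector_derivative_at)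

text \<open>By maximality of the atlas, restricting a chart to an open set and following it by a
  diffeomorphism of the coordinate space gives a chart again. Restricted charts and the sheared
  charts of the test hypersurfaces arise in this way.\<close>

lemma chart_modify:
  assumes c: "c \<in> A" and X: "open X"
    and \<phi>: "smooth_on UNIV \<phi>" and \<psi>: "smooth_on UNIV \<psi>" and inv: "\<And>x. \<psi> (\<phi> x) = x" "\<And>x. \<phi> (\<psi> x) = x"
  defines "c' \<equiv> \<lparr>cdom = cdom c \<inter> X, cmap = \<phi> \<circ> cmap c\<rparr>"
  shows "c' \<in> A" and "\<And>x. x \<in> cim c' \<Longrightarrow> cinv c' x = cinv c (\<psi> x) \<and> \<psi> x \<in> cim c"
proof -
  have inj: "inj_on (cmap c) (cdom c)" using chartD(3)[OF c] homeomorphism_apply1 inj_on_inverseI by metis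
  then have inj': "inj_on (cmap c') (cdom c')"
    unfolding c'_def by (auto simp: inj_on_def) (metis inv(1))
  have ci: "cinv c' x = cinv c (\<psi> x) \<and> \<psi> x \<in> cim c" if x: "x \<in> cim c'" for x
  proof -
    obtain p where p: "p \<in> cdom c'" "x = cmap c' p" using x by blast
    then have "cinv c' x = p" using inj' by (simp add: cinv_def)
    moreover have "\<psi> x = cmap c p" "p \<in> cdom c" using p by (auto simp: c'_def inv)
    ultimately show ?thesis using cinv_cmap[OF c] by simp
  qed
  then show "\<And>x. x \<in> cim c' \<Longrightarrow> cinv c' x = cinv c (\<psi> x) \<and> \<psi> x \<in> cim c" .
  have c\<phi>: "continuous_on UNIV \<phi>" and c\<psi>: "continuous_on UNIV \<psi>"
    using Ck_on_imp_continuous_on smooth_onD \<phi> \<psi> by blast+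
  have im: "cmap c' ` (cdom c' \<inter> Y) = \<psi> -` (cmap c ` (cdom c \<inter> (X \<inter> Y)))" for Y
    by (auto simp: c'_def inv image_iff) (metis inv(2) IntI)
  have imo: "open (cmap c' ` (cdom c' \<inter> Y))" if "open Y" for Y
    unfolding im using open_chart_image[OF c] X that c\<psi> by (intro open_vimage) auto
  have dom: "cdom c' \<subseteq> cdom c" "open (cdom c')" using chartD[OF c] X by (auto simp: c'_def)
  have "is_chart c'"
    unfolding is_chart_def homeomorphism_def
  proof (intro conjI ballI)
    show "open (cdom c')" by (rule dom)
    show "open (cim c')" using imo[of UNIV] by simp
    show i: "cinv c' (cmap c' p) = p" if "p \<in> cdom c'" for p
      using inj' that by (simp add: cinv_def)
    show "cmap c' (cinv c' x) = x" if "x \<in> cim c'" for x using that i by auto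
    show "cinv c' ` cim c' = cdom c'" using i by force
    show "continuous_on (cdom c') (cmap c')"
      using continuous_on_compose2[OF c\<phi> continuous_on_subset[OF continuous_on_cmap[OF c], of "cdom c \<inter> X"]]
      by (simp add: c'_def o_def)
    have "continuous_on (cim c') (\<lambda>x. cinv c (\<psi> x))"
      by (rule continuous_on_compose2[OF continuous_on_cinv[OF c] continuous_on_subset[OF c\<psi>]]) (use ci in auto)
    then show "continuous_on (cim c') (cinv c')" by (subst continuous_on_cong[OF refl]) (use ci in auto)
  qed simp_all
  moreover have "compatible c' d" if d: "d \<in> A" for d
    unfolding compatible_def
  proof
    let ?U = "cmap c' ` (cdom c' \<inter> cdom d)"
    have U: "open ?U" using imo chartD[OF d] by blast
    have "smooth_on ?U (\<lambda>x. (cmap d \<circ> cinv c) (\<psi> x))"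
      by (rule smooth_on_compose[OF U _ smooth_on_subset[OF \<psi>] smooth_transition[OF c d]])
        (use im open_chart_image[OF c] chartD[OF d] in auto)
    moreover have "(cmap d \<circ> cinv c') x = (cmap d \<circ> cinv c) (\<psi> x)" if "x \<in> ?U" for x
    proof -
      have "x \<in> cim c'" using that by blast
      then show ?thesis using ci[of x] by simp
    qed
    ultimately show "smooth_on ?U (cmap d \<circ> cinv c')" using smooth_on_cong[OF U] by metis
    let ?V = "cmap d ` (cdom c' \<inter> cdom d)"
    have V: "open ?V" using open_chart_image[OF d dom(2)] by (simp add: Int_commute)
    have "?V \<subseteq> cmap d ` (cdom d \<inter> cdom c)" using dom by blast
    from smooth_on_subset[OF smooth_transition[OF d c] this]
    have "smooth_on ?V (\<lambda>x. \<phi> ((cmap c \<circ> cinv d) x))"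
      by (rule smooth_on_compose[OF V open_UNIV _ \<phi>]) auto
    then show "smooth_on ?V (cmap c' \<circ> cinv d)" by (simp add: c'_def o_def)
  qed
  ultimately show "c' \<in> A" using smooth_manifold unfolding smooth_manifold_def by blast
qed

end

section \<open>The Levi-Civita connection\<close>

lemma has_vector_derivative_chain:
  assumes "(\<xi> has_vector_derivative a) (at t within S)" "(f has_derivative f') (at (\<xi> t))"
  shows "((\<lambda>t. f (\<xi> t)) has_vector_derivative f' a) (at t within S)"
  using vector_derivative_diff_chain_within[OF assms(1) has_derivative_at_withinI[OF assms(2)]] by (simp add: o_def)

lemma bounded_bilinear_matrix_vector: "bounded_bilinear ((*v) :: real^'n::finite^'m::finite \<Rightarrow> _)"
  unfolding bilinear_conv_bounded_bilinear[symmetric] bilinear_def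
  by (auto intro!: linearI simp: algebra_simps matrix_vector_mult_add_rdistrib scaleR_matrix_vector_assoc)

lemmas has_vector_derivative_mv = bounded_bilinear.has_vector_derivative[OF bounded_bilinear_matrix_vector]
lemmas has_vector_derivative_inner = bounded_bilinear.has_vector_derivative[OF bounded_bilinear_inner]

lemma linear_axis_eq:
  fixes f g :: "real^'n::finite \<Rightarrow> 'b::real_vector"
  assumes "linear f" "linear g" "\<And>i. f (axis i 1) = g (axis i 1)"
  shows "f a = g a"
  using linear_eq_stdbasis[OF assms(1,2)] assms(3) by (fastforce simp: Basis_vec_def)

lemma trilinear_axis_eq:
  fixes f g :: "real^'n::finite \<Rightarrow> real^'n \<Rightarrow> real^'n \<Rightarrow> real"
  assumes "\<And>b w. linear (\<lambda>a. f a b w)" "\<And>a w. linear (\<lambda>b. f a b w)" "\<And>a b. linear (f a b)"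
    and "\<And>b w. linear (\<lambda>a. g a b w)" "\<And>a w. linear (\<lambda>b. g a b w)" "\<And>a b. linear (g a b)"
    and eq: "\<And>i j k. f (axis i 1) (axis j 1) (axis k 1) = g (axis i 1) (axis j 1) (axis k 1)"
  shows "f a b w = g a b w"
proof -
  have 1: "f (axis i 1) (axis j 1) w = g (axis i 1) (axis j 1) w" for i j w
    by (rule linear_axis_eq[of "f (axis i 1) (axis j 1)"]) (use assms in auto)
  have 2: "f (axis i 1) b w = g (axis i 1) b w" for i b w
    by (rule linear_axis_eq[of "\<lambda>b. f (axis i 1) b w"]) (use assms 1 in auto)
  show ?thesis
    by (rule linear_axis_eq[of "\<lambda>a. f a b w"]) (use assms 2 in auto)
qed

lemma matrix_inv_right: "det M \<noteq> 0 \<Longrightarrow> M ** matrix_inv M = mat 1" for M :: "real^'n::finite^'n"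
  unfolding invertible_det_nz[symmetric] invertible_def matrix_inv_def
  by (rule someI2_ex) blast+

lemma frechet_component:
  fixes f :: "'a::euclidean_space \<Rightarrow> 'b::real_normed_vector ^ 'n::finite"
  assumes "f differentiable (at x)"
  shows "frechet_derivative (\<lambda>y. f y $ i) (at x) a = frechet_derivative f (at x) a $ i"
proof -
  have "((\<lambda>y. f y $ i) has_derivative (\<lambda>a. frechet_derivative f (at x) a $ i)) (at x)"
    using assms frechet_derivative_works bounded_linear.has_derivative[OF bounded_linear_vec_nth] by blast
  then show ?thesis using frechet_derivative_at by metis
qed

definition D2f :: "('a::euclidean_space \<Rightarrow> 'b::real_normed_vector) \<Rightarrow> 'a \<Rightarrow> 'a \<Rightarrow> 'a \<Rightarrow> 'b" where
  "D2f f x e a = frechet_derivative (\<lambda>y. frechet_derivative f (at y) a) (at x) e"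

lemma D2f_sym:
  fixes f :: "'a::euclidean_space \<Rightarrow> real ^ 'n::finite"
  assumes U: "open U" and f: "Ck_on 2 U f" and x: "x \<in> U"
  shows "D2f f x a b = D2f f x b a"
proof -
  have f2: "Ck_on (Suc 1) U f" using f by (simp add: numeral_2_eq_2)
  have "D2f f x a b $ i = D2f (\<lambda>y. f y $ i) x a b" for a b i
  proof -
    have d: "(\<lambda>y. frechet_derivative f (at y) b) differentiable (at x)"
      using Ck_on_derivative[OF U f2 Ck_on_const[OF U, of 1 b]] x by auto
    have "D2f f x a b $ i = frechet_derivative (\<lambda>y. frechet_derivative f (at y) b $ i) (at x) a"
      unfolding D2f_def by (rule frechet_component[OF d, symmetric])
    also have "\<dots> = D2f (\<lambda>y. f y $ i) x a b"
      unfolding D2f_def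
    proof (rule fun_cong[OF frechet_derivative_cong_open(1)[OF U x]])
      fix y assume "y \<in> U"
      then have "f differentiable (at y)" using f2 by auto
      then show "frechet_derivative f (at y) b $ i = frechet_derivative (\<lambda>y. f y $ i) (at y) b"
        by (rule frechet_component[symmetric])
    qed
    finally show ?thesis .
  qed
  then show ?thesis
    using second_derivative_symmetric[OF U Ck_on_nth[OF U f] x] by (simp add: vec_eq_iff D2f_def)
qed

text \<open>The product rule for a derivative applied to a moving vector; expansion in the basis
  reduces it to derivatives at fixed vectors. With f a transition map it differentiates vectors
  along a curve after a change of chart.\<close>

lemma has_vector_derivative_D2f:
  fixes f :: "'a::euclidean_space \<Rightarrow> 'b::real_normed_vector"
  assumes U: "open U" and f: "Ck_on 2 U f" and x: "\<xi> t \<in> U"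
    and \<xi>: "(\<xi> has_vector_derivative e) (at t within S)" and \<omega>: "(\<omega> has_vector_derivative o') (at t within S)"
    and near: "\<And>s. s \<in> S \<Longrightarrow> \<xi> s \<in> U" and t: "t \<in> S"
  shows "((\<lambda>s. frechet_derivative f (at (\<xi> s)) (\<omega> s)) has_vector_derivative
    frechet_derivative f (at (\<xi> t)) o' + D2f f (\<xi> t) e (\<omega> t)) (at t within S)"
proof -
  let ?D = "\<lambda>y a. frechet_derivative f (at y) a"
  have f2: "Ck_on (Suc 1) U f" using f by (simp add: numeral_2_eq_2)
  have lin: "linear (?D y)" if "y \<in> U" for y
    using Ck_on_Suc_has_derivative[OF f2 that] has_derivative_linear by blast
  have exp: "?D y a = (\<Sum>b\<in>Basis. (a \<bullet> b) *\<^sub>R ?D y b)" if "y \<in> U" for y a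
    by (subst euclidean_representation[of a, symmetric]) (simp add: linear_sum[OF lin[OF that]] linear_scale[OF lin[OF that]])
  have dd: "((\<lambda>y. ?D y a) has_derivative (\<lambda>e. D2f f y e a)) (at y)" if "y \<in> U" for y a
    using Ck_on_Suc_has_derivative[OF _ that, of 0 "\<lambda>y. ?D y a"] Ck_on_derivative[OF U f2 Ck_on_const[OF U, of 1 a]]
    by (simp add: D2f_def[abs_def])
  have D2exp: "D2f f y e a = (\<Sum>b\<in>Basis. (a \<bullet> b) *\<^sub>R D2f f y e b)" if y: "y \<in> U" for y e a
  proof -
    have "((\<lambda>y. \<Sum>b\<in>Basis. (a \<bullet> b) *\<^sub>R ?D y b) has_derivative (\<lambda>e. \<Sum>b\<in>Basis. (a \<bullet> b) *\<^sub>R D2f f y e b)) (at y)"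
      by (intro has_derivative_sum has_derivative_scaleR_right dd y)
    then have "((\<lambda>y. ?D y a) has_derivative (\<lambda>e. \<Sum>b\<in>Basis. (a \<bullet> b) *\<^sub>R D2f f y e b)) (at y)"
      by (rule has_derivative_transform_within_open[OF _ U y]) (metis exp)
    then show ?thesis using has_derivative_unique[OF dd[OF y]] by metis
  qed
  have "((\<lambda>s. \<Sum>b\<in>Basis. (\<omega> s \<bullet> b) *\<^sub>R ?D (\<xi> s) b) has_vector_derivative
    (\<Sum>b\<in>Basis. (\<omega> t \<bullet> b) *\<^sub>R D2f f (\<xi> t) e b + (o' \<bullet> b) *\<^sub>R ?D (\<xi> t) b)) (at t within S)"
  proof (rule has_vector_derivative_sum, rule bounded_bilinear.has_vector_derivative[OF bounded_bilinear_scaleR])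
    show "((\<lambda>s. \<omega> s \<bullet> b) has_vector_derivative o' \<bullet> b) (at t within S)" for b
      by (rule bounded_linear.has_vector_derivative[OF bounded_linear_inner_left \<omega>])
    show "((\<lambda>s. ?D (\<xi> s) b) has_vector_derivative D2f f (\<xi> t) e b) (at t within S)" for b
      by (rule has_vector_derivative_chain[OF \<xi> dd[OF x]])
  qed
  then have "((\<lambda>s. \<Sum>b\<in>Basis. (\<omega> s \<bullet> b) *\<^sub>R ?D (\<xi> s) b) has_vector_derivative ?D (\<xi> t) o' + D2f f (\<xi> t) e (\<omega> t)) (at t within S)"
    by (simp add: sum.distrib exp[OF x, of o'] D2exp[OF x, of e "\<omega> t"] add.commute)
  then show ?thesis
    by (rule has_vector_derivative_transform[OF t, rotated]) (metis exp near)
qed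

locale riemannian = manifold A for A :: "('m::{t2_space,second_countable_topology}, 'n::finite) chart set" +
  fixes g :: "('m, 'n) metric"
  assumes riemannian_metric: "riemannian_metric A g"
begin

abbreviation gm :: "('m, 'n) chart \<Rightarrow> real^'n \<Rightarrow> real^'n^'n" where
  "gm \<equiv> metric_matrix A g"

section \<open>The metric and its derivatives in a chart\<close>

lemma metric_sym: "u \<in> tangent_space A p \<Longrightarrow> w \<in> tangent_space A p \<Longrightarrow> g p u w = g p w u"
  using riemannian_metric unfolding riemannian_metric_def by blast

lemma metric_comb: "u \<in> tangent_space A p \<Longrightarrow> v \<in> tangent_space A p \<Longrightarrow> w \<in> tangent_space A p \<Longrightarrow>
    g p (\<lambda>c. a *\<^sub>R u c + b *\<^sub>R v c) w = a * g p u w + b * g p v w"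
  using riemannian_metric unfolding riemannian_metric_def by blast

lemma metric_pos: "u \<in> tangent_space A p \<Longrightarrow> u \<noteq> (\<lambda>_. 0) \<Longrightarrow> 0 < g p u u"
  using riemannian_metric unfolding riemannian_metric_def by blast

lemma metric_smooth: "c \<in> A \<Longrightarrow> Ck_on k (cim c) (gm c)"
  using riemannian_metric unfolding riemannian_metric_def smooth_on_def by blast

lemma metric_tvec_of:
  assumes c: "c \<in> A" "p \<in> cdom c"
  shows "g p (tvec_of A c p a) (tvec_of A c p b) = (gm c (cmap c p) *v a) \<bullet> b"
proof -
  let ?B = "\<lambda>a b. g p (tvec_of A c p a) (tvec_of A c p b)"
  note inT = tvec_of_in[OF c]
  have comb: "?B (r *\<^sub>R a + s *\<^sub>R a') b = r * ?B a b + s * ?B a' b" for r s a a' b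
    unfolding tvec_of_comb[OF c] by (rule metric_comb[OF inT inT inT])
  have lin1: "linear (\<lambda>a. ?B a b)" for b
  proof (rule linearI)
    show "?B (a + a') b = ?B a b + ?B a' b" for a a' using comb[of 1 a 1 a' b] by simp
    show "?B (r *\<^sub>R a) b = r *\<^sub>R ?B a b" for r a using comb[of r a 0 0 b] by simp
  qed
  have lin2: "linear (\<lambda>b. ?B a b)" for a
  proof -
    have "(\<lambda>b. ?B a b) = (\<lambda>b. ?B b a)" by (rule ext, rule metric_sym[OF inT inT])
    with lin1[of a] show ?thesis by (simp only:)
  qed
  have lin3: "linear (\<lambda>a. (gm c (cmap c p) *v a) \<bullet> b)" and lin4: "linear (\<lambda>b. (gm c (cmap c p) *v a) \<bullet> b)" for a b
    by (auto intro!: linearI simp: algebra_simps)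
  have "?B (axis i 1) (axis j 1) = (gm c (cmap c p) *v axis i 1) \<bullet> axis j 1" for i j
  proof -
    have "(gm c (cmap c p) *v axis i 1) \<bullet> axis j 1 = gm c (cmap c p) $ j $ i"
      by (simp add: matrix_vector_mult_basis column_def inner_axis)
    then show ?thesis
      using metric_sym[OF inT inT, of "axis i 1" "axis j 1"] by (simp add: metric_matrix_def cinv_cmap c)
  qed
  from linear_axis_eq[OF lin2 lin4 this] have "?B (axis i 1) b = (gm c (cmap c p) *v axis i 1) \<bullet> b" for i .
  from linear_axis_eq[OF lin1 lin3 this] show ?thesis .
qed

lemma metric_chart:
  assumes "c \<in> A" "p \<in> cdom c" "u \<in> tangent_space A p" "w \<in> tangent_space A p"
  shows "g p u w = (gm c (cmap c p) *v u c) \<bullet> w c"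
  using metric_tvec_of[OF assms(1,2), of "u c" "w c"] by (simp add: tangent_spaceD assms)

lemma gm_sym: assumes "c \<in> A" "x \<in> cim c" shows "(gm c x *v a) \<bullet> b = (gm c x *v b) \<bullet> a"
  using metric_tvec_of[OF assms(1) cinv_in[OF assms], of a b] metric_tvec_of[OF assms(1) cinv_in[OF assms], of b a]
    metric_sym[OF tvec_of_in[OF assms(1) cinv_in[OF assms]] tvec_of_in[OF assms(1) cinv_in[OF assms]], of a b]
  by (simp add: cmap_cinv assms)

lemma gm_pos: assumes "c \<in> A" "x \<in> cim c" "a \<noteq> 0" shows "0 < (gm c x *v a) \<bullet> a"
proof -
  have p: "cinv c x \<in> cdom c" using cinv_in assms by blast
  have "tvec_of A c (cinv c x) a \<noteq> (\<lambda>_. 0)"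
    using tvec_of_self[OF assms(1) p, of a] assms(3) by auto
  from metric_pos[OF tvec_of_in[OF assms(1) p] this] show ?thesis
    using metric_tvec_of[OF assms(1) p] cmap_cinv assms by simp
qed

lemma gm_det: assumes "c \<in> A" "x \<in> cim c" shows "det (gm c x) \<noteq> 0"
proof -
  have "inj ((*v) (gm c x))"
  proof (rule injI)
    fix a b assume "gm c x *v a = gm c x *v b"
    then have "(gm c x *v (a - b)) \<bullet> (a - b) = 0" by (simp add: algebra_simps)
    then show "a = b" using gm_pos[OF assms, of "a - b"] by force
  qed
  then show ?thesis
    using matrix_left_invertible_injective[of "gm c x"] invertible_left_inverse invertible_det_nz by blast
qed

lemma gm_cancel: assumes "c \<in> A" "x \<in> cim c" "\<And>w. (gm c x *v a) \<bullet> w = (gm c x *v b) \<bullet> w" shows "a = b"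
proof -
  have "(gm c x *v (a - b)) \<bullet> (a - b) = 0" using assms(3)[of "a - b"] by (simp add: algebra_simps)
  then show "a = b" using gm_pos[OF assms(1,2), of "a - b"] by force
qed

abbreviation Dg :: "('m, 'n) chart \<Rightarrow> real^'n \<Rightarrow> real^'n \<Rightarrow> real^'n^'n" where
  "Dg c x \<equiv> frechet_derivative (gm c) (at x)"

lemma gm_has_derivative: "c \<in> A \<Longrightarrow> x \<in> cim c \<Longrightarrow> (gm c has_derivative Dg c x) (at x)"
  using Ck_on_Suc_has_derivative[OF metric_smooth] by blast

lemma Dg_linear: "c \<in> A \<Longrightarrow> x \<in> cim c \<Longrightarrow> linear (Dg c x)"
  using gm_has_derivative has_derivative_linear by blast

lemma line_deriv: "((\<lambda>t. x + t *\<^sub>R e) has_vector_derivative e) (at t within S)" for x e :: "'a::real_normed_vector"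
  by (auto intro!: derivative_eq_intros)

lemma gm_line:
  assumes "c \<in> A" "x \<in> cim c"
  shows "((\<lambda>t. (gm c (x + t *\<^sub>R e) *v a) \<bullet> b) has_vector_derivative (Dg c x e *v a) \<bullet> b) (at 0)"
proof -
  have "((\<lambda>t. gm c (x + t *\<^sub>R e)) has_vector_derivative Dg c x e) (at 0)"
    by (rule has_vector_derivative_chain[OF line_deriv]) (use gm_has_derivative assms in simp)
  from has_vector_derivative_inner[OF has_vector_derivative_mv[OF this has_vector_derivative_const] has_vector_derivative_const]
  show ?thesis by simp
qed

lemma line_near:
  fixes x e :: "'a::real_normed_vector"
  assumes "open U" "x \<in> U"
  obtains S where "open S" "(0::real) \<in> S" "\<And>t. t \<in> S \<Longrightarrow> x + t *\<^sub>R e \<in> U"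
proof
  show "open ((\<lambda>t. x + t *\<^sub>R e) -` U)" by (intro open_vimage assms continuous_intros)
qed (use assms in auto)

lemma Dg_sym:
  assumes c: "c \<in> A" "x \<in> cim c"
  shows "(Dg c x e *v a) \<bullet> b = (Dg c x e *v b) \<bullet> a"
proof -
  obtain S where S: "open S" "(0::real) \<in> S" "\<And>t. t \<in> S \<Longrightarrow> x + t *\<^sub>R e \<in> cim c"
    using line_near[OF chartD(2)[OF c(1)] c(2)] by blast
  have "((\<lambda>t. (gm c (x + t *\<^sub>R e) *v b) \<bullet> a) has_vector_derivative (Dg c x e *v a) \<bullet> b) (at 0)"
    by (rule has_vector_derivative_transform_within_open[OF gm_line[OF c] S(1,2)]) (use gm_sym c S in blast)
  from vector_derivative_unique_at[OF this gm_line[OF c]] show ?thesis .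
qed

text \<open>With the symbols contracted into a bilinear map, later computations rest on bilinearity,
  symmetry and \<open>koszul\<close> instead of index sums.\<close>

definition Gam :: "('m, 'n) chart \<Rightarrow> real^'n \<Rightarrow> real^'n \<Rightarrow> real^'n \<Rightarrow> real^'n" where
  "Gam c x a b = (\<chi> k. \<Sum>i\<in>UNIV. \<Sum>j\<in>UNIV. christoffel A g c k i j x * a $ i * b $ j)"

lemma Gam_linear: "linear (Gam c x a)" "linear (\<lambda>a. Gam c x a b)"
  by (auto intro!: linearI simp: Gam_def vec_eq_iff algebra_simps sum.distrib sum_distrib_left)

lemma Gam_axis: "Gam c x (axis i 1) (axis j 1) $ k = christoffel A g c k i j x"
  by (simp add: Gam_def axis_def if_distrib[of "(*) _"] cong: if_cong)

lemma partial_gm: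
  assumes "c \<in> A" "x \<in> cim c"
  shows "partial i (\<lambda>y. gm c y $ l $ j) x = (Dg c x (axis i 1) *v axis j 1) \<bullet> axis l 1"
proof -
  have "((\<lambda>y. gm c y $ l $ j) has_derivative (\<lambda>e. Dg c x e $ l $ j)) (at x)"
    by (intro bounded_linear.has_derivative[OF bounded_linear_vec_nth] gm_has_derivative assms)
  then have "partial i (\<lambda>y. gm c y $ l $ j) x = Dg c x (axis i 1) $ l $ j"
    unfolding partial_def using frechet_derivative_at by metis
  then show ?thesis by (simp add: matrix_vector_mult_basis column_def inner_axis)
qed

text \<open>Both sides are trilinear, so basis vectors suffice; for these the identity is the
  definition of the Christoffel symbols with the inverse metric moved to the other side. As the
  metric is nondegenerate, it determines \<open>Gam\<close>.\<close>

lemma koszul: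
  assumes c: "c \<in> A" "x \<in> cim c"
  shows "2 * ((gm c x *v Gam c x a b) \<bullet> w) =
    (Dg c x a *v b) \<bullet> w + (Dg c x b *v a) \<bullet> w - (Dg c x w *v a) \<bullet> b"
proof (rule trilinear_axis_eq[where f = "\<lambda>a b w. 2 * ((gm c x *v Gam c x a b) \<bullet> w)"
      and g = "\<lambda>a b w. (Dg c x a *v b) \<bullet> w + (Dg c x b *v a) \<bullet> w - (Dg c x w *v a) \<bullet> b"])
  note l = linear_add[OF Dg_linear[OF c]] linear_scale[OF Dg_linear[OF c]]
    linear_add[OF Gam_linear(1)] linear_add[OF Gam_linear(2)]
    linear_scale[OF Gam_linear(1)] linear_scale[OF Gam_linear(2)]
  note s = l algebra_simps matrix_vector_mult_add_rdistrib scaleR_matrix_vector_assoc[symmetric]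
  show "linear (\<lambda>a. 2 * ((gm c x *v Gam c x a b) \<bullet> w))" "linear (\<lambda>b. 2 * ((gm c x *v Gam c x a b) \<bullet> w))"
    "linear (\<lambda>w. 2 * ((gm c x *v Gam c x a b) \<bullet> w))"
    "linear (\<lambda>a. (Dg c x a *v b) \<bullet> w + (Dg c x b *v a) \<bullet> w - (Dg c x w *v a) \<bullet> b)"
    "linear (\<lambda>b. (Dg c x a *v b) \<bullet> w + (Dg c x b *v a) \<bullet> w - (Dg c x w *v a) \<bullet> b)"
    "linear (\<lambda>w. (Dg c x a *v b) \<bullet> w + (Dg c x b *v a) \<bullet> w - (Dg c x w *v a) \<bullet> b)" for a b w
    by (auto intro!: linearI simp: s)
  fix i j k
  define s where "s = (\<chi> l. (Dg c x (axis i 1) *v axis j 1) \<bullet> axis l 1 + (Dg c x (axis j 1) *v axis i 1) \<bullet> axis l 1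
     - (Dg c x (axis l 1) *v axis i 1) \<bullet> axis j 1)"
  have "Gam c x (axis i 1) (axis j 1) $ m = ((1/2) *\<^sub>R (matrix_inv (gm c x) *v s)) $ m" for m
  proof -
    have "(Dg c x (axis j 1) *v axis l 1) \<bullet> axis i 1 = (Dg c x (axis j 1) *v axis i 1) \<bullet> axis l 1"
      "(Dg c x (axis l 1) *v axis j 1) \<bullet> axis i 1 = (Dg c x (axis l 1) *v axis i 1) \<bullet> axis j 1" for l
      using Dg_sym[OF c] by blast+
    then show ?thesis
      by (simp add: Gam_axis christoffel_def partial_gm[OF c] s_def matrix_vector_mult_def)
  qed
  then have "Gam c x (axis i 1) (axis j 1) = (1/2) *\<^sub>R (matrix_inv (gm c x) *v s)" by (simp add: vec_eq_iff)
  then have "gm c x *v Gam c x (axis i 1) (axis j 1) = (1/2) *\<^sub>R s"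
    by (simp add: algebra_simps matrix_vector_mul_assoc matrix_inv_right gm_det c)
  then show "2 * ((gm c x *v Gam c x (axis i 1) (axis j 1)) \<bullet> axis k 1) =
      (Dg c x (axis i 1) *v axis j 1) \<bullet> axis k 1 + (Dg c x (axis j 1) *v axis i 1) \<bullet> axis k 1
      - (Dg c x (axis k 1) *v axis i 1) \<bullet> axis j 1"
    by (simp add: inner_axis) (simp add: s_def inner_axis)
qed

lemma Gam_sym: assumes c: "c \<in> A" "x \<in> cim c" shows "Gam c x a b = Gam c x b a"
proof (rule gm_cancel[OF c])
  show "(gm c x *v Gam c x a b) \<bullet> w = (gm c x *v Gam c x b a) \<bullet> w" for w
    using koszul[OF c, of a b w] koszul[OF c, of b a w] Dg_sym[OF c, of w a b] by simp
qed

lemma christoffel_smooth: assumes c: "c \<in> A" shows "Ck_on k (cim c) (christoffel A g c m i j)"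
proof -
  note U = chartD(2)[OF c]
  have p: "Ck_on k (cim c) (partial i (\<lambda>y. gm c y $ l $ j))" for i j l
    unfolding partial_def
    by (rule Ck_on_derivative[OF U Ck_on_nth[OF U Ck_on_nth[OF U metric_smooth[OF c]]] Ck_on_const[OF U]])
  show ?thesis
    unfolding christoffel_def divide_inverse
    by (intro Ck_on_mult Ck_on_sum Ck_on_add Ck_on_diff Ck_on_const p U Ck_on_nth Ck_on_matrix_inv metric_smooth c gm_det)
qed

lemma Gam_smooth:
  assumes c: "c \<in> A" and U: "open U" and f: "Ck_on k U f" "\<And>x. x \<in> U \<Longrightarrow> f x \<in> cim c"
    and a: "Ck_on k U a" and b: "Ck_on k U b"
  shows "Ck_on k U (\<lambda>x. Gam c (f x) (a x) (b x))"
  unfolding Gam_def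
  by (intro Ck_on_vec U, simp, intro Ck_on_sum Ck_on_mult Ck_on_compose[OF U chartD(2)[OF c] f(1) christoffel_smooth[OF c] f(2)]
      Ck_on_nth U a b)

text \<open>A trajectory solves the equations in every chart, so a solution found in one chart has to be
  transported to the others.\<close>

lemma Gam_change:
  assumes c: "c \<in> A" "d \<in> A" "p \<in> cdom c" "p \<in> cdom d"
  defines "T \<equiv> cmap d \<circ> cinv c"
  shows "Gam d (cmap d p) (TD c d p v) (TD c d p v) + D2f T (cmap c p) v v = TD c d p (Gam c (cmap c p) v v)"
proof -
  let ?x = "cmap c p" and ?y = "cmap d p"
  let ?U = "cmap c ` (cdom c \<inter> cdom d)"
  have U: "open ?U" and xU: "?x \<in> ?U" using open_chart_image chartD c by auto
  have x: "?x \<in> cim c" and y: "?y \<in> cim d" using c by auto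
  have T: "Ck_on 2 ?U T" unfolding T_def using smooth_onD[OF smooth_transition] c by blast
  have DT: "frechet_derivative T (at ?x) = TD c d p" by (simp add: T_def TD_def)
  let ?D = "TD c d p"
  \<comment> \<open>Invariance of the metric under the transition map; its derivative along a line,
    \<open>diff\<close>, relates the metric derivatives in both charts through second derivatives of
    the transition map.\<close>
  have id: "(gm c z *v a) \<bullet> b = (gm d (T z) *v frechet_derivative T (at z) a) \<bullet> frechet_derivative T (at z) b"
    if z: "z \<in> ?U" for z a b
  proof -
    obtain q where q: "z = cmap c q" "q \<in> cdom c" "q \<in> cdom d" using z by blast
    have "frechet_derivative T (at z) = TD c d q" "T z = cmap d q" by (simp_all add: T_def TD_def q cinv_cmap c)
    then show ?thesis
      using metric_tvec_of[OF c(1) q(2), of a b] metric_tvec_of[OF c(2) q(3), of "TD c d q a" "TD c d q b"]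
      by (simp add: tvec_of_change c q)
  qed
  have diff: "(Dg c ?x e *v a) \<bullet> b = (Dg d ?y (?D e) *v ?D a) \<bullet> ?D b
      + (gm d ?y *v D2f T ?x e a) \<bullet> ?D b + (gm d ?y *v ?D a) \<bullet> D2f T ?x e b" for e a b
  proof -
    obtain S where S: "open S" "(0::real) \<in> S" "\<And>t. t \<in> S \<Longrightarrow> ?x + t *\<^sub>R e \<in> ?U"
      using line_near[OF U xU] by blast
    have at0: "at 0 within S = at 0" using S at_within_open by blast
    have Tx: "T ?x = ?y" by (simp add: T_def cinv_cmap c)
    have TD: "((\<lambda>t. T (?x + t *\<^sub>R e)) has_vector_derivative ?D e) (at 0)"
    proof (rule has_vector_derivative_chain[OF line_deriv])
      have "(T has_derivative ?D) (at ?x)" unfolding T_def by (rule TD_has_derivative[OF c(1-4)])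
      then show "(T has_derivative ?D) (at (?x + 0 *\<^sub>R e))" by simp
    qed
    have gd: "((\<lambda>t. gm d (T (?x + t *\<^sub>R e))) has_vector_derivative Dg d ?y (?D e)) (at 0)"
      by (rule has_vector_derivative_chain[OF TD]) (use gm_has_derivative[OF c(2) y] Tx in simp)
    have Da: "((\<lambda>t. frechet_derivative T (at (?x + t *\<^sub>R e)) a) has_vector_derivative D2f T ?x e a) (at 0)" for a
      using has_vector_derivative_D2f[OF U T _ line_deriv[of ?x e 0 S] has_vector_derivative_const[of a] S(3) S(2)] xU
        linear_0[OF TD_linear[OF c]]
      by (simp add: at0 DT)
    have "((\<lambda>t. (gm d (T (?x + t *\<^sub>R e)) *v frechet_derivative T (at (?x + t *\<^sub>R e)) a) \<bullet> frechet_derivative T (at (?x + t *\<^sub>R e)) b)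
      has_vector_derivative (gm d ?y *v ?D a) \<bullet> D2f T ?x e b + (gm d ?y *v D2f T ?x e a + Dg d ?y (?D e) *v ?D a) \<bullet> ?D b) (at 0)"
      using has_vector_derivative_inner[OF has_vector_derivative_mv[OF gd Da] Da] by (simp add: Tx DT)
    moreover have "((\<lambda>t. (gm d (T (?x + t *\<^sub>R e)) *v frechet_derivative T (at (?x + t *\<^sub>R e)) a) \<bullet> frechet_derivative T (at (?x + t *\<^sub>R e)) b)
      has_vector_derivative (Dg c ?x e *v a) \<bullet> b) (at 0)"
      by (rule has_vector_derivative_transform_within_open[OF gm_line[OF c(1) x] S(1,2)]) (use id S(3) in blast)
    ultimately show ?thesis
      using vector_derivative_unique_at by (fastforce simp: inner_add_left)
  qed
  show ?thesis
  proof (rule gm_cancel[OF c(2) y])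
    fix w'
    define w where "w = TD d c p w'"
    have w': "w' = ?D w" unfolding w_def using TD_chain[of d c d p w'] TD_refl c by simp
    \<comment> \<open>In the combination of metric derivatives prescribed by \<open>koszul\<close>
      the terms pairing the image of v with the second derivative in v and w cancel by symmetry of
      second derivatives; the one pairing that in v and v with the image of w survives.\<close>
    have "2 * ((gm d ?y *v ?D (Gam c ?x v v)) \<bullet> ?D w) = 2 * ((gm c ?x *v Gam c ?x v v) \<bullet> w)"
      using id[OF xU, of "Gam c ?x v v" w] unfolding DT by (simp add: T_def cinv_cmap c)
    also have "\<dots> = 2 * ((Dg c ?x v *v v) \<bullet> w) - (Dg c ?x w *v v) \<bullet> v"
      using koszul[OF c(1) x, of v v w] by simp
    also have "\<dots> = 2 * ((Dg d ?y (?D v) *v ?D v) \<bullet> ?D w) - (Dg d ?y (?D w) *v ?D v) \<bullet> ?D v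
        + 2 * ((gm d ?y *v D2f T ?x v v) \<bullet> ?D w)"
      unfolding diff D2f_sym[OF U T xU, of w v]
      using gm_sym[OF c(2) y, of "D2f T ?x v w" "?D v"] by (simp add: algebra_simps)
    also have "\<dots> = 2 * ((gm d ?y *v Gam d ?y (?D v) (?D v)) \<bullet> ?D w) + 2 * ((gm d ?y *v D2f T ?x v v) \<bullet> ?D w)"
      using koszul[OF c(2) y, of "?D v" "?D v" "?D w"] by simp
    finally show "(gm d ?y *v (Gam d ?y (?D v) (?D v) + D2f T ?x v v)) \<bullet> w' = (gm d ?y *v ?D (Gam c ?x v v)) \<bullet> w'"
      unfolding w' by (simp add: algebra_simps)
  qed
qed

end

section \<open>Slice charts\<close>

lemma zero_coord_nth: "zero_coord i x $ j = (if j = i then 0 else x $ j)"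
  by (simp add: zero_coord_def)

lemma zero_coord_id: "x $ i = 0 \<Longrightarrow> zero_coord i x = x"
  by (simp add: vec_eq_iff zero_coord_nth)

lemma zero_coord_linear: "linear (zero_coord i :: real^'n::finite \<Rightarrow> _)"
  by (rule linearI) (auto simp: vec_eq_iff zero_coord_nth)

lemma zero_coord_smooth: "open U \<Longrightarrow> Ck_on k U (zero_coord i :: real^'n::finite \<Rightarrow> _)"
  by (rule Ck_on_linear) (simp add: zero_coord_linear linear_conv_bounded_linear[symmetric])

lemma zero_coord_line: "x $ i = 0 \<Longrightarrow> a $ i = 0 \<Longrightarrow> zero_coord i (x + t *\<^sub>R a) = x + t *\<^sub>R a"
  by (simp add: vec_eq_iff zero_coord_nth)

lemma continuous_on_zero_coord: "continuous_on U (zero_coord i :: real^'n::finite \<Rightarrow> _)"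
  using zero_coord_linear linear_continuous_on linear_conv_bounded_linear by blast

lemma open_zero_coord: "open W \<Longrightarrow> open {x. zero_coord i x \<in> (W :: (real^'n::finite) set)}"
  using open_vimage[OF _ continuous_on_zero_coord, of W i] by (simp add: vimage_def)

definition restrict_chart :: "('m, 'n::finite) chart \<Rightarrow> 'm set \<Rightarrow> ('m, 'n) chart" where
  "restrict_chart c X = \<lparr>cdom = cdom c \<inter> X, cmap = cmap c\<rparr>"

lemma restrict_chart_simps [simp]:
  "cdom (restrict_chart c X) = cdom c \<inter> X" "cmap (restrict_chart c X) = cmap c"
  by (simp_all add: restrict_chart_def)

context manifold begin

lemma restrict_chart:
  assumes "c \<in> A" "open X"
  shows "restrict_chart c X \<in> A" "x \<in> cmap c ` (cdom c \<inter> X) \<Longrightarrow> cinv (restrict_chart c X) x = cinv c x"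
proof -
  have "Ck_on k UNIV (\<lambda>x::real^'n. x)" for k by (rule Ck_on_id) simp
  then have s: "smooth_on UNIV (\<lambda>x::real^'n. x)" by (simp add: smooth_on_def)
  have eq: "\<lparr>cdom = cdom c \<inter> X, cmap = (\<lambda>x. x) \<circ> cmap c\<rparr> = restrict_chart c X"
    by (simp add: restrict_chart_def o_def)
  note m = chart_modify[OF assms s s, unfolded eq]
  show "restrict_chart c X \<in> A" by (rule m) auto
  show "x \<in> cmap c ` (cdom c \<inter> X) \<Longrightarrow> cinv (restrict_chart c X) x = cinv c x"
    using m(2)[of x] by simp
qed

lemma slice_chartD: "slice_chart A S c i \<Longrightarrow> c \<in> A"
  by (simp add: slice_chart_def)

lemma slice_mem:
  assumes "slice_chart A S c i" "p \<in> cdom c"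
  shows "p \<in> S \<longleftrightarrow> cmap c p $ i = 0"
proof -
  note c = slice_chartD[OF assms(1)]
  have eq: "cmap c ` (cdom c \<inter> S) = cim c \<inter> {x. x $ i = 0}" using assms by (simp add: slice_chart_def)
  show ?thesis
  proof
    assume "cmap c p $ i = 0"
    then have "cmap c p \<in> cmap c ` (cdom c \<inter> S)" using eq assms by auto
    then obtain q where "cmap c p = cmap c q" "q \<in> cdom c" "q \<in> S" by blast
    then show "p \<in> S" using cinv_cmap[OF c] assms(2) by metis
  qed (use eq assms in blast)
qed

lemma slice_chartI: "c \<in> A \<Longrightarrow> (\<And>p. p \<in> cdom c \<Longrightarrow> p \<in> S \<longleftrightarrow> cmap c p $ i = 0) \<Longrightarrow> slice_chart A S c i"
  unfolding slice_chart_def by blast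

lemma slice_restrict:
  assumes "slice_chart A S c i" "open X" "S' \<inter> X = S \<inter> X"
  shows "slice_chart A S' (restrict_chart c X) i"
proof (rule slice_chartI)
  show "restrict_chart c X \<in> A" using restrict_chart[OF slice_chartD[OF assms(1)] assms(2)] by blast
  fix p assume "p \<in> cdom (restrict_chart c X)"
  then have p: "p \<in> cdom c" "p \<in> X" by auto
  then have "p \<in> S' \<longleftrightarrow> p \<in> S" using assms(3) by blast
  then show "p \<in> S' \<longleftrightarrow> cmap (restrict_chart c X) p $ i = 0" using slice_mem[OF assms(1) p(1)] by simp
qed

lemma slice_point: "slice_chart A S c i \<Longrightarrow> x \<in> cim c \<Longrightarrow> x $ i = 0 \<Longrightarrow> cinv c x \<in> S \<inter> cdom c"
  using slice_mem[of S c i "cinv c x"] cinv_in[of c x] cmap_cinv[of c x] slice_chartD[of S c i] by auto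

text \<open>In slice charts the inclusion becomes a continuous injection of an open piece of one
  hyperplane into another of equal dimension, hence an open map by invariance of domain. So a piece
  S' of S, known only to be a hypersurface, agrees with S near each of its points.\<close>

lemma hypersurface_subset_open:
  assumes h1: "hypersurface A S1" and h2: "hypersurface A S2" and sub: "S1 \<subseteq> S2" and p: "p \<in> S1"
  obtains X where "open X" "p \<in> X" "S1 \<inter> X = S2 \<inter> X"
proof -
  obtain c i where c: "slice_chart A S1 c i" "p \<in> cdom c" using h1 p by (auto simp: hypersurface_def)
  obtain d j where d: "slice_chart A S2 d j" "p \<in> cdom d" using h2 p sub unfolding hypersurface_def by blast
  note cA = slice_chartD[OF c(1)] and dA = slice_chartD[OF d(1)]
  let ?H = "\<lambda>i. {x::real^'n. axis i 1 \<bullet> x = 0}"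
  have H: "axis i 1 \<bullet> x = x $ i" for i and x :: "real^'n" by (simp add: inner_axis')
  define U where "U = cmap c ` (cdom c \<inter> cdom d)"
  define f where "f = cmap d \<circ> cinv c"
  have U: "open U" unfolding U_def using open_chart_image[OF cA chartD(1)[OF dA]] .
  have "openin (top_of_set (?H j)) (f ` (?H i \<inter> U))"
  proof (rule invariance_of_domain_subspaces[where U = "?H i"])
    show "openin (top_of_set (?H i)) (?H i \<inter> U)" using U by (auto simp: openin_open)
    show "subspace (?H i)" "subspace (?H j)" by (rule subspace_hyperplane)+
    show "dim (?H j) \<le> dim (?H i)" by (simp add: dim_hyperplane)
    have "continuous_on U f"
      using Ck_on_imp_continuous_on[OF smooth_onD[OF smooth_transition[OF cA dA]]] by (simp add: U_def f_def)
    then show "continuous_on (?H i \<inter> U) f" using continuous_on_subset by blast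
    show "f \<in> ?H i \<inter> U \<rightarrow> ?H j"
    proof
      fix x assume x: "x \<in> ?H i \<inter> U"
      then obtain q where q: "x = cmap c q" "q \<in> cdom c" "q \<in> cdom d" by (auto simp: U_def)
      then have "q \<in> S1" using slice_mem[OF c(1) q(2)] x by (auto simp: H)
      then show "f x \<in> ?H j" using slice_mem[OF d(1) q(3)] sub cinv_cmap[OF cA q(2)] by (auto simp: f_def q H)
    qed
    show "inj_on f (?H i \<inter> U)"
    proof (rule inj_on_inverseI[where g = "cmap c \<circ> cinv d"])
      fix x assume "x \<in> ?H i \<inter> U"
      then show "(cmap c \<circ> cinv d) (f x) = x" by (auto simp: U_def f_def cinv_cmap cA dA)
    qed
  qed
  then obtain W where W: "open W" "f ` (?H i \<inter> U) = ?H j \<inter> W" by (auto simp: openin_open)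
  define X where "X = {q \<in> cdom d. cmap d q \<in> W}"
  show ?thesis
  proof
    show "open X" unfolding X_def by (rule open_chart_preimage[OF dA W(1)])
    have "cmap c p \<in> ?H i \<inter> U" using slice_mem[OF c] p c d by (auto simp: H U_def)
    moreover have "f (cmap c p) = cmap d p" by (simp add: f_def cinv_cmap cA c)
    ultimately show "p \<in> X" using W(2) d by (force simp: X_def)
    have "q \<in> S1" if q: "q \<in> S2" "q \<in> X" for q
    proof -
      have qd: "q \<in> cdom d" "cmap d q \<in> W" using q by (auto simp: X_def)
      then have "cmap d q \<in> ?H j \<inter> W" using slice_mem[OF d(1) qd(1)] q by (simp add: H)
      then obtain x where x: "x \<in> ?H i \<inter> U" "cmap d q = f x" using W(2) by blast
      then obtain r where r: "x = cmap c r" "r \<in> cdom c" "r \<in> cdom d" by (auto simp: U_def)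
      have "cmap d q = cmap d r" using x r by (simp add: f_def cinv_cmap cA)
      then have "q = r" using cinv_cmap[OF dA] qd r by metis
      then show ?thesis using slice_mem[OF c(1) r(2)] x r by (simp add: H)
    qed
    then show "S1 \<inter> X = S2 \<inter> X" using sub by blast
  qed
qed

text \<open>Smooth functions and normal fields must be smooth in all slice charts. This reduces the
  task to one convenient chart around each point, where h need only agree on S with a smooth
  function of the coordinates.\<close>

lemma smooth_in_slice_local:
  assumes d: "slice_chart A S d j"
    and loc: "\<And>p. p \<in> S \<Longrightarrow> p \<in> cdom d \<Longrightarrow> \<exists>c\<in>A. p \<in> cdom c \<and> (\<exists>W h'. open W \<and> cmap c p \<in> W \<and> smooth_on W h' \<and>
       (\<forall>q\<in>S. q \<in> cdom c \<longrightarrow> cmap c q \<in> W \<longrightarrow> h q = h' (cmap c q)))"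
  shows "smooth_in_slice d j h"
  unfolding smooth_in_slice_def
proof (rule smooth_on_local)
  note dA = slice_chartD[OF d]
  fix x assume "x \<in> {x. zero_coord j x \<in> cim d}"
  then have x: "zero_coord j x \<in> cim d" by simp
  let ?p = "cinv d (zero_coord j x)"
  have p: "?p \<in> S" "?p \<in> cdom d" using slice_point[OF d x] by (auto simp: zero_coord_nth)
  obtain c W h' where c: "c \<in> A" "?p \<in> cdom c" and W: "open W" "cmap c ?p \<in> W" "smooth_on W h'"
    and eq: "\<And>q. q \<in> S \<Longrightarrow> q \<in> cdom c \<Longrightarrow> cmap c q \<in> W \<Longrightarrow> h q = h' (cmap c q)"
    using loc[OF p] by blast
  define X where "X = {q \<in> cdom c. cmap c q \<in> W}"
  define V where "V = {x. zero_coord j x \<in> cmap d ` (cdom d \<inter> X)}"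
  have Xo: "open X" unfolding X_def by (rule open_chart_preimage[OF c(1) W(1)])
  have V: "open V" unfolding V_def by (intro open_zero_coord open_chart_image[OF dA Xo])
  have "smooth_on V (\<lambda>x. (cmap c \<circ> cinv d) (zero_coord j x))"
  proof (rule smooth_on_compose[OF V open_chart_image[OF dA chartD(1)[OF c(1)]] _ smooth_transition[OF dA c(1)]])
    show "smooth_on V (zero_coord j)" using zero_coord_smooth[OF V] by (simp add: smooth_on_def)
  qed (auto simp: V_def X_def)
  then have "smooth_on V (\<lambda>x. h' ((cmap c \<circ> cinv d) (zero_coord j x)))"
  proof (rule smooth_on_compose[OF V W(1) _ W(3)])
    fix y assume "y \<in> V"
    then obtain q where "zero_coord j y = cmap d q" "q \<in> cdom d" "q \<in> X" by (auto simp: V_def)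
    then show "(cmap c \<circ> cinv d) (zero_coord j y) \<in> W" by (auto simp: cinv_cmap dA X_def)
  qed
  moreover have "h' ((cmap c \<circ> cinv d) (zero_coord j y)) = h (cinv d (zero_coord j y))" if y: "y \<in> V" for y
  proof -
    obtain q where q: "zero_coord j y = cmap d q" "q \<in> cdom d" "q \<in> X" using y by (auto simp: V_def)
    have "q \<in> S" using slice_mem[OF d q(2)] q(1) by (metis zero_coord_nth)
    then show ?thesis using eq[of q] q by (auto simp: X_def cinv_cmap dA)
  qed
  ultimately have "smooth_on V (\<lambda>x. h (cinv d (zero_coord j x)))"
    using smooth_on_cong[OF V, of "\<lambda>x. h' ((cmap c \<circ> cinv d) (zero_coord j x))" "\<lambda>x. h (cinv d (zero_coord j x))"] by blast
  moreover have "zero_coord j x = cmap d ?p" using cmap_cinv[OF dA x] by simp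
  then have "x \<in> V" using p c W by (auto simp: V_def X_def intro!: image_eqI[of _ _ ?p])
  ultimately show "\<exists>V. x \<in> V \<and> open V \<and> smooth_on V (\<lambda>x. h (cinv d (zero_coord j x)))" using V by blast
qed

text \<open>The function is given as smooth in slice charts of the bigger hypersurface, which need
  not be slice charts of S; the extension constant in the transverse coordinate supplies the smooth
  function for \<open>smooth_in_slice_local\<close>.\<close>

lemma transformation_function_smooth:
  assumes S: "hypersurface A S" and \<nu>: "transformation_function A S \<nu>"
  shows "smooth_function_on A S \<nu>"
  unfolding smooth_function_on_def
proof (intro allI impI)
  fix d j assume d: "slice_chart A S d j"
  obtain S' \<nu>' where S': "relatively_compact_in A S S'" "smooth_function_on A S' \<nu>'" "\<And>p. p \<in> S \<Longrightarrow> \<nu>' p = \<nu> p"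
    using \<nu> unfolding transformation_function_def by blast
  have h': "hypersurface A S'" "S \<subseteq> S'" using S'(1) closure_subset[of S] unfolding relatively_compact_in_def by blast+
  show "smooth_in_slice d j \<nu>"
  proof (rule smooth_in_slice_local[OF d])
    fix p assume p: "p \<in> S" "p \<in> cdom d"
    obtain c i where c: "slice_chart A S' c i" "p \<in> cdom c" using h' p unfolding hypersurface_def by blast
    note cA = slice_chartD[OF c(1)]
    let ?W = "{x. zero_coord i x \<in> cim c}"
    have "smooth_on ?W (\<lambda>x. \<nu>' (cinv c (zero_coord i x)))"
      using S'(2) c(1) unfolding smooth_function_on_def smooth_in_slice_def by blast
    moreover have "open ?W" by (intro open_zero_coord chartD cA)
    moreover have sl: "zero_coord i (cmap c q) = cmap c q" if "q \<in> S" "q \<in> cdom c" for q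
      using slice_mem[OF c(1) that(2)] that(1) h'(2) by (intro zero_coord_id) auto
    then have "cmap c p \<in> ?W" using p c by auto
    moreover have "\<nu> q = \<nu>' (cinv c (zero_coord i (cmap c q)))" if "q \<in> S" "q \<in> cdom c" for q
      using that S'(3) sl cinv_cmap[OF cA] by simp
    ultimately show "\<exists>c\<in>A. p \<in> cdom c \<and> (\<exists>W h'. open W \<and> cmap c p \<in> W \<and> smooth_on W h' \<and>
       (\<forall>q\<in>S. q \<in> cdom c \<longrightarrow> cmap c q \<in> W \<longrightarrow> \<nu> q = h' (cmap c q)))"
      using cA c(2) by blast
  qed
qed

lemma slice_line:
  assumes c: "slice_chart A S c i" and p: "p \<in> S" "p \<in> cdom c" and a: "a $ i = 0"
  obtains s0 where "0 < s0" "\<And>s. \<bar>s\<bar> < s0 \<Longrightarrow> cmap c p + s *\<^sub>R a \<in> cim c \<and> cinv c (cmap c p + s *\<^sub>R a) \<in> S \<inter> cdom c"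
proof -
  note cA = slice_chartD[OF c]
  have x: "cmap c p \<in> cim c" using p by blast
  obtain T where T: "open T" "(0::real) \<in> T" "\<And>t. t \<in> T \<Longrightarrow> cmap c p + t *\<^sub>R a \<in> cim c"
    using chartD(2)[OF cA] x open_vimage[of "cim c" "\<lambda>t. cmap c p + t *\<^sub>R a"]
    by (auto intro!: that[of "(\<lambda>t. cmap c p + t *\<^sub>R a) -` cim c"] continuous_intros)
  obtain s0 where s0: "0 < s0" "ball 0 s0 \<subseteq> T" using T open_contains_ball by blast
  show ?thesis
  proof (rule that[OF s0(1)])
    fix s :: real assume "\<bar>s\<bar> < s0"
    then have "s \<in> T" using s0 by (auto simp: dist_norm)
    then show "cmap c p + s *\<^sub>R a \<in> cim c \<and> cinv c (cmap c p + s *\<^sub>R a) \<in> S \<inter> cdom c"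
      using T(3) slice_point[OF c] slice_mem[OF c p(2)] p(1) a by simp
  qed
qed

text \<open>\<open>tangent_to\<close> requires a condition in every slice chart. The vector is the
  velocity of a curve running in S, along which the transverse coordinate of every other slice chart
  is constantly 0.\<close>

lemma tangent_to_slice:
  assumes c: "slice_chart A S c i" and p: "p \<in> S" "p \<in> cdom c" and a: "a $ i = 0"
  shows "tvec_of A c p a \<in> tangent_to A S p"
proof -
  note cA = slice_chartD[OF c]
  have "tvec_of A c p a d $ j = 0" if d: "slice_chart A S d j" "p \<in> cdom d" for d j
  proof -
    note dA = slice_chartD[OF d(1)]
    let ?\<gamma> = "\<lambda>s. cinv c (cmap c p + s *\<^sub>R a)"
    obtain s0 where s0: "0 < s0" "\<And>s. \<bar>s\<bar> < s0 \<Longrightarrow> cmap c p + s *\<^sub>R a \<in> cim c \<and> ?\<gamma> s \<in> S \<inter> cdom c"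
      using slice_line[OF c p a] by blast
    have "((\<lambda>s. (cmap d \<circ> cinv c) (cmap c p + s *\<^sub>R a)) has_vector_derivative TD c d p a) (at 0)"
      by (rule has_vector_derivative_chain[where f = "cmap d \<circ> cinv c" and \<xi> = "\<lambda>s. cmap c p + s *\<^sub>R a"])
        (use TD_has_derivative[OF cA dA p(2) d(2)] in \<open>auto intro!: derivative_eq_intros simp del: o_apply\<close>)
    then have D: "((\<lambda>s. (cmap d \<circ> cinv c) (cmap c p + s *\<^sub>R a) $ j) has_vector_derivative TD c d p a $ j) (at 0)"
      by (rule bounded_linear.has_vector_derivative[OF bounded_linear_vec_nth])
    have "isCont ?\<gamma> 0"
    proof (rule isCont_o2[of 0 "\<lambda>s. cmap c p + s *\<^sub>R a"])
      show "isCont (cinv c) (cmap c p + 0 *\<^sub>R a)" using isCont_cinv[OF cA] p by simp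
    qed (intro continuous_intros)
    then have "\<forall>\<^sub>F s in nhds 0. ?\<gamma> s \<in> cdom d"
      using chartD(1)[OF dA] d(2) p cinv_cmap[OF cA]
      by (auto simp: isCont_def tendsto_def eventually_at_filter elim!: eventually_mono)
    moreover have "\<forall>\<^sub>F s in nhds 0. \<bar>s\<bar> < s0" unfolding eventually_nhds_metric using s0(1) by (auto simp: dist_norm)
    ultimately have ev: "\<forall>\<^sub>F s in nhds 0. s \<in> UNIV \<longrightarrow> (cmap d \<circ> cinv c) (cmap c p + s *\<^sub>R a) $ j = 0"
      by eventually_elim (use s0(2) slice_mem[OF d(1)] in auto)
    then have "((\<lambda>s. 0) has_vector_derivative TD c d p a $ j) (at 0)"
      using D has_vector_derivative_cong_ev[OF ev] eventually_nhds_x_imp_x[OF ev] by simp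
    then have "TD c d p a $ j = 0" using vector_derivative_unique_at has_vector_derivative_const by blast
    then show ?thesis using dA d(2) by (simp add: tvec_of_apply)
  qed
  then show ?thesis using tvec_of_in[OF cA p(2)] by (auto simp: tangent_to_def)
qed

lemma smooth_in_slice_has_derivative:
  assumes c: "slice_chart A S c i" and h: "smooth_in_slice c i h" and x: "zero_coord i x \<in> cim c"
  shows "((\<lambda>x. h (cinv c (zero_coord i x))) has_derivative frechet_derivative (\<lambda>x. h (cinv c (zero_coord i x))) (at x)) (at x)"
  using smooth_on_has_derivative[of "{x. zero_coord i x \<in> cim c}"] h x unfolding smooth_in_slice_def by blast

lemma slice_derivative:
  assumes c: "slice_chart A S c i" and h: "smooth_in_slice c i h" and p: "p \<in> S" "p \<in> cdom c" and a: "a $ i = 0"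
  shows "((\<lambda>s. h (cinv c (cmap c p + s *\<^sub>R a))) has_vector_derivative
    frechet_derivative (\<lambda>x. h (cinv c (zero_coord i x))) (at (cmap c p)) a) (at 0)"
proof -
  have z: "cmap c p $ i = 0" using slice_mem[OF c p(2)] p by simp
  have "((\<lambda>s. h (cinv c (zero_coord i (cmap c p + s *\<^sub>R a)))) has_vector_derivative
    frechet_derivative (\<lambda>x. h (cinv c (zero_coord i x))) (at (cmap c p)) a) (at 0)"
    by (rule has_vector_derivative_chain[where f = "\<lambda>x. h (cinv c (zero_coord i x))"])
      (use smooth_in_slice_has_derivative[OF c h, of "cmap c p"] p z in \<open>auto simp: zero_coord_id intro!: derivative_eq_intros\<close>)
  then show ?thesis by (simp add: zero_coord_line z a)
qed

end

section \<open>Trajectories and the deviation functions\<close>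

text \<open>Continuity induction: \<open>close\<close> makes P hold at the infimum of the failures,
  and \<open>step\<close> then carries P beyond it.\<close>

lemma real_induction:
  fixes T :: real
  assumes 0: "P 0" and T: "t \<in> {0..T}"
    and step: "\<And>t. 0 \<le> t \<Longrightarrow> t < T \<Longrightarrow> (\<And>s. s \<in> {0..t} \<Longrightarrow> P s) \<Longrightarrow> \<exists>e>0. \<forall>s. t < s \<and> s < t + e \<longrightarrow> P s"
    and close: "\<And>t. 0 < t \<Longrightarrow> t \<le> T \<Longrightarrow> (\<And>s. s \<in> {0..<t} \<Longrightarrow> P s) \<Longrightarrow> P t"
  shows "P t"
proof (rule ccontr)
  assume "\<not> P t"
  define X where "X = {t \<in> {0..T}. \<not> P t}"
  have ne: "X \<noteq> {}" using \<open>\<not> P t\<close> T by (auto simp: X_def)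
  have bd: "bdd_below X" by (auto simp: X_def intro!: bdd_belowI[of _ 0])
  define i where "i = Inf X"
  have i: "0 \<le> i" "i \<le> T"
    using cInf_greatest[OF ne, of 0] cInf_lower[OF _ bd] ne by (auto simp: i_def X_def intro: order_trans)
  have below: "P s" if "0 \<le> s" "s < i" for s
    using cInf_lower[OF _ bd, of s] that i by (force simp: X_def i_def)
  have Pi: "P i" using close[of i] below i 0 by (cases "i = 0") auto
  have "i < T"
  proof (rule ccontr)
    assume "\<not> i < T"
    then have "x = i" if "x \<in> X" for x
    proof -
      have "i \<le> x" using cInf_lower[OF that bd] by (simp add: i_def)
      then show ?thesis using that i \<open>\<not> i < T\<close> by (simp add: X_def)
    qed
    then show False using ne Pi by (auto simp: X_def)
  qed
  moreover have "P s" if "s \<in> {0..i}" for s using below[of s] that Pi by (cases "s = i") auto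
  ultimately obtain e where e: "e > 0" "\<And>s. i < s \<Longrightarrow> s < i + e \<Longrightarrow> P s" using step[OF i(1)] by blast
  obtain s where s: "s \<in> X" "s < i + e" using cInf_lessD[OF ne, of "i + e"] e(1) by (auto simp: i_def)
  then have "i \<le> s" "s \<noteq> i" using cInf_lower[OF _ bd, of s] Pi by (auto simp: i_def X_def)
  then show False using e(2)[of s] s by (auto simp: X_def)
qed

locale newtonian = riemannian A g for A :: "('m::{t2_space,second_countable_topology}, 'n::finite) chart set" and g +
  fixes F :: "('m, 'n) force"
  assumes force_field: "force_field A F"
begin

abbreviation Fu :: "('m, 'n) chart \<Rightarrow> real^'n \<Rightarrow> real^'n \<Rightarrow> real^'n" where
  "Fu \<equiv> force_up A F"

lemma force_in: "v \<in> tangent_space A p \<Longrightarrow> F p v \<in> tangent_space A p"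
  using force_field unfolding force_field_def by blast

lemma force_smooth: "c \<in> A \<Longrightarrow> Ck_on k (cim c \<times> UNIV) (\<lambda>z. Fu c (fst z) (snd z))"
  using force_field unfolding force_field_def smooth_on_def by (simp add: case_prod_beta')

lemma force_chart: "c \<in> A \<Longrightarrow> p \<in> cdom c \<Longrightarrow> v \<in> tangent_space A p \<Longrightarrow> F p v c = Fu c (cmap c p) (v c)"
  by (simp add: force_up_def cinv_cmap tangent_spaceD)

text \<open>The geodesic-type field on the phase space of a chart: the second order equations of
  motion as a first order system for position and velocity.\<close>

definition GG :: "('m, 'n) chart \<Rightarrow> (real^'n) \<times> (real^'n) \<Rightarrow> (real^'n) \<times> (real^'n)" where
  "GG c z = (snd z, Fu c (fst z) (snd z) - Gam c (fst z) (snd z) (snd z))"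

lemma open_phase: "c \<in> A \<Longrightarrow> open (cim c \<times> (UNIV :: (real^'n) set))"
  using chartD(2) by (intro open_Times) auto

lemma GG_smooth: assumes c: "c \<in> A" shows "Ck_on k (cim c \<times> UNIV) (GG c)"
proof -
  note U = open_phase[OF c]
  have "Ck_on k (cim c \<times> UNIV) (\<lambda>z. (snd z, Fu c (fst z) (snd z) - Gam c (fst z) (snd z) (snd z)))"
    by (intro Ck_on_Pair Ck_on_diff force_smooth c U Gam_smooth Ck_on_fst Ck_on_snd Ck_on_id) auto
  then show ?thesis unfolding GG_def[abs_def] .
qed

lemma trajectory_chart:
  assumes tr: "trajectory A g F I \<gamma>" and I: "open I" "t \<in> I" and c: "c \<in> A" "\<gamma> t \<in> cdom c"
  shows "velocity A \<gamma> t = tvec_of A c (\<gamma> t) (velocity A \<gamma> t c)" (is ?A)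
    and "((\<lambda>s. (cmap c (\<gamma> s), velocity A \<gamma> s c)) has_vector_derivative GG c (cmap c (\<gamma> t), velocity A \<gamma> t c)) (at t)" (is ?B)
    and "isCont \<gamma> t"
proof -
  show ct: "isCont \<gamma> t" using tr I by (auto simp: trajectory_def continuous_on_eq_continuous_at)
  have "(cmap c \<circ> \<gamma>) differentiable (at t)" using tr I(2) c unfolding trajectory_def by blast
  then have D: "((cmap c \<circ> \<gamma>) has_vector_derivative vector_derivative (cmap c \<circ> \<gamma>) (at t)) (at t)"
    using vector_derivative_works by blast
  have vc: "velocity A \<gamma> t c = vector_derivative (cmap c \<circ> \<gamma>) (at t)" using c by (simp add: velocity_def)
  show A: ?A unfolding vc by (rule velocity_eq[OF c ct D])
  obtain a where a: "((\<lambda>s. velocity A \<gamma> s c) has_vector_derivative a) (at t)"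
    "\<And>k. a $ k + (\<Sum>i\<in>UNIV. \<Sum>j\<in>UNIV. christoffel A g c k i j (cmap c (\<gamma> t)) * velocity A \<gamma> t c $ i * velocity A \<gamma> t c $ j)
                = F (\<gamma> t) (velocity A \<gamma> t) c $ k"
    using tr I(2) c unfolding trajectory_def by blast
  have "F (\<gamma> t) (velocity A \<gamma> t) c = Fu c (cmap c (\<gamma> t)) (velocity A \<gamma> t c)"
    by (rule force_chart[OF c]) (subst A, rule tvec_of_in[OF c])
  then have "a = Fu c (cmap c (\<gamma> t)) (velocity A \<gamma> t c) - Gam c (cmap c (\<gamma> t)) (velocity A \<gamma> t c) (velocity A \<gamma> t c)"
    using a(2) by (simp add: vec_eq_iff Gam_def algebra_simps)
  then show ?B using has_vector_derivative_Pair[OF D a(1)] vc by (simp add: GG_def o_def)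
qed

text \<open>Differentiating the velocity in another chart produces the second derivative of the
  transition map; \<open>Gam_change\<close> absorbs it into the Christoffel term of that
  chart.\<close>

lemma trajectory_of_chart:
  assumes c: "c \<in> A" and I: "open I" and z: "\<And>t. t \<in> I \<Longrightarrow> fst (z t) \<in> cim c"
    "\<And>t. t \<in> I \<Longrightarrow> (z has_vector_derivative GG c (z t)) (at t)"
  defines "\<gamma> \<equiv> \<lambda>t. cinv c (fst (z t))"
  shows "trajectory A g F I \<gamma>" and "\<And>t. t \<in> I \<Longrightarrow> velocity A \<gamma> t = tvec_of A c (\<gamma> t) (snd (z t))"
proof -
  have D1: "((\<lambda>t. fst (z t)) has_vector_derivative snd (z t)) (at t)"
    and D2: "((\<lambda>t. snd (z t)) has_vector_derivative Fu c (fst (z t)) (snd (z t)) - Gam c (fst (z t)) (snd (z t)) (snd (z t))) (at t)"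
    if "t \<in> I" for t
    using bounded_linear.has_vector_derivative[OF bounded_linear_fst z(2)[OF that]]
      bounded_linear.has_vector_derivative[OF bounded_linear_snd z(2)[OF that]] by (auto simp: GG_def)
  have \<gamma>c: "\<gamma> t \<in> cdom c" "cmap c (\<gamma> t) = fst (z t)" if "t \<in> I" for t
    using z(1)[OF that] cinv_in[OF c] cmap_cinv[OF c] by (auto simp: \<gamma>_def)
  have ct: "isCont \<gamma> t" if "t \<in> I" for t
    unfolding \<gamma>_def
    by (rule isCont_o2[where g = "cinv c", OF has_vector_derivative_continuous[OF D1[OF that]] isCont_cinv[OF c z(1)[OF that]]])
  have "((cmap c \<circ> \<gamma>) has_vector_derivative snd (z t)) (at t)" if "t \<in> I" for t
    by (rule has_vector_derivative_transform_within_open[OF D1[OF that] I that]) (simp add: \<gamma>c)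
  then have Dd: "velocity A \<gamma> t = tvec_of A c (\<gamma> t) (snd (z t))"
    "d \<in> A \<Longrightarrow> \<gamma> t \<in> cdom d \<Longrightarrow> ((cmap d \<circ> \<gamma>) has_vector_derivative TD c d (\<gamma> t) (snd (z t))) (at t)" if "t \<in> I" for t d
    using velocity_eq[OF c _ ct] curve_change[OF c _ _ _ ct] \<gamma>c that by blast+
  show "\<And>t. t \<in> I \<Longrightarrow> velocity A \<gamma> t = tvec_of A c (\<gamma> t) (snd (z t))" by (rule Dd(1))
  show "trajectory A g F I \<gamma>"
    unfolding trajectory_def
  proof (intro conjI ballI impI)
    show "continuous_on I \<gamma>" using ct continuous_at_imp_continuous_on by blast
    fix t d assume t: "t \<in> I" and d: "d \<in> A" "\<gamma> t \<in> cdom d"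
    show "(cmap d \<circ> \<gamma>) differentiable (at t)" using Dd(2)[OF t d] differentiableI_vector by blast
    let ?T = "cmap d \<circ> cinv c" and ?U = "cmap c ` (cdom c \<inter> cdom d)"
    let ?v = "snd (z t)" and ?x = "fst (z t)"
    have U: "open ?U" using open_chart_image[OF c chartD(1)[OF d(1)]] .
    have T2: "Ck_on 2 ?U ?T" using smooth_onD[OF smooth_transition[OF c d(1)]] .
    have "\<forall>\<^sub>F s in nhds t. \<gamma> s \<in> cdom d"
      using ct[OF t] chartD(1)[OF d(1)] d(2)
      by (auto simp: isCont_def tendsto_def eventually_at_filter elim!: eventually_mono)
    then obtain X where X: "open X" "t \<in> X" "\<And>s. s \<in> X \<Longrightarrow> \<gamma> s \<in> cdom d" by (auto simp: eventually_nhds)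
    define J where "J = I \<inter> X"
    have J: "open J" "t \<in> J" "J \<subseteq> I" using I X t by (auto simp: J_def)
    have atJ: "at t within J = at t" using at_within_open[OF J(2,1)] .
    have inU: "fst (z s) \<in> ?U" if "s \<in> J" for s
      using that \<gamma>c[of s] X(3)[of s] by (auto simp: J_def image_iff intro!: bexI[of _ "\<gamma> s"])
    have "((\<lambda>s. frechet_derivative ?T (at (fst (z s))) (snd (z s))) has_vector_derivative
      frechet_derivative ?T (at ?x) (Fu c ?x ?v - Gam c ?x ?v ?v) + D2f ?T ?x ?v ?v) (at t within J)"
      by (rule has_vector_derivative_D2f[OF U T2, where \<xi> = "\<lambda>s. fst (z s)" and \<omega> = "\<lambda>s. snd (z s)"])
        (use inU J D1[OF t] D2[OF t] atJ in auto)
    then have "((\<lambda>s. frechet_derivative ?T (at (fst (z s))) (snd (z s))) has_vector_derivative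
      TD c d (\<gamma> t) (Fu c ?x ?v - Gam c ?x ?v ?v) + D2f ?T ?x ?v ?v) (at t)"
      unfolding atJ by (simp add: TD_def \<gamma>c t)
    then have "((\<lambda>s. velocity A \<gamma> s d) has_vector_derivative
      TD c d (\<gamma> t) (Fu c ?x ?v - Gam c ?x ?v ?v) + D2f ?T ?x ?v ?v) (at t)"
    proof (rule has_vector_derivative_transform_within_open[OF _ J(1,2)])
      fix s assume s: "s \<in> J"
      then have "s \<in> I" "\<gamma> s \<in> cdom d" using J X by (auto simp: J_def)
      then show "frechet_derivative ?T (at (fst (z s))) (snd (z s)) = velocity A \<gamma> s d"
        using Dd(1) \<gamma>c d by (simp add: tvec_of_apply TD_def)
    qed
    moreover have "TD c d (\<gamma> t) (Fu c ?x ?v - Gam c ?x ?v ?v) + D2f ?T ?x ?v ?v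
        = F (\<gamma> t) (velocity A \<gamma> t) d - Gam d (cmap d (\<gamma> t)) (velocity A \<gamma> t d) (velocity A \<gamma> t d)"
    proof -
      have lin: "linear (TD c d (\<gamma> t))" by (rule TD_linear) (use c d \<gamma>c t in auto)
      have v: "velocity A \<gamma> t = tvec_of A c (\<gamma> t) ?v" by (rule Dd(1)[OF t])
      have "F (\<gamma> t) (velocity A \<gamma> t) \<in> tangent_space A (\<gamma> t)"
        unfolding v by (intro force_in tvec_of_in c \<gamma>c t)
      from tangent_spaceD[OF this c \<gamma>c(1)[OF t]]
      have "F (\<gamma> t) (velocity A \<gamma> t) d = TD c d (\<gamma> t) (F (\<gamma> t) (velocity A \<gamma> t) c)"
        using d by (metis tvec_of_apply)
      also have "F (\<gamma> t) (velocity A \<gamma> t) c = Fu c ?x ?v"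
        by (subst force_chart[OF c \<gamma>c(1)[OF t]]) (simp_all add: v tvec_of_in tvec_of_self c \<gamma>c t)
      finally have F: "F (\<gamma> t) (velocity A \<gamma> t) d = TD c d (\<gamma> t) (Fu c ?x ?v)" .
      have "velocity A \<gamma> t d = TD c d (\<gamma> t) ?v" by (simp add: v tvec_of_apply d)
      with Gam_change[OF c d(1) \<gamma>c(1)[OF t] d(2), of ?v] F \<gamma>c(2)[OF t] show ?thesis
        by (simp add: linear_diff[OF lin] algebra_simps)
    qed
    ultimately show "\<exists>a. ((\<lambda>s. velocity A \<gamma> s d) has_vector_derivative a) (at t) \<and>
        (\<forall>k. a $ k + (\<Sum>i\<in>UNIV. \<Sum>j\<in>UNIV. christoffel A g d k i j (cmap d (\<gamma> t)) * velocity A \<gamma> t d $ i * velocity A \<gamma> t d $ j)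
          = F (\<gamma> t) (velocity A \<gamma> t) d $ k)"
      by (intro exI conjI) (auto simp: Gam_def)
  qed
qed

text \<open>A trajectory is a curve in M and might leave the chart. The bound on the field confines
  it to the ball for a time T that serves all initial data in the half ball. Membership in the chart
  and in the ball are propagated together, as the estimate makes sense only inside the
  chart.\<close>

lemma trajectory_stays:
  assumes tr: "trajectory A g F {-\<delta><..<\<delta>} \<gamma>" and c: "c \<in> A" "\<gamma> 0 \<in> cdom c"
    and K: "cball z0 R \<subseteq> cim c \<times> UNIV" and M: "\<And>z. z \<in> cball z0 R \<Longrightarrow> norm (GG c z) \<le> M"
    and T: "0 < T" "T < \<delta>" "M * T < R / 2"
  defines "Z \<equiv> \<lambda>t. (cmap c (\<gamma> t), velocity A \<gamma> t c)"
  assumes Z0: "Z 0 \<in> cball z0 (R / 2)" and t: "\<bar>t\<bar> \<le> T"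
  shows "\<gamma> t \<in> cdom c" "Z t \<in> cball z0 R"
proof -
  have R: "0 \<le> R" using Z0 zero_le_dist[of z0 "Z 0"] unfolding mem_cball by linarith
  then have M0: "0 \<le> M" using M[of z0] order_trans[OF norm_ge_zero] by auto
  \<comment> \<open>The sign lets the induction over nonnegative parameters treat both directions of
    time.\<close>
  define \<sigma> where "\<sigma> = (if t \<ge> 0 then 1 else -1 :: real)"
  have \<sigma>: "\<bar>\<sigma>\<bar> = 1" "t = \<sigma> * \<bar>t\<bar>" by (auto simp: \<sigma>_def)
  have inI: "\<sigma> * s \<in> {-\<delta><..<\<delta>}" if "s \<in> {0..T}" for s
    using that T by (auto simp: \<sigma>_def)
  have I: "open {-\<delta><..<\<delta>}" by simp
  note ch = trajectory_chart[OF tr I _ c(1)]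
  have ZD: "((\<lambda>s. Z (\<sigma> * s)) has_vector_derivative \<sigma> *\<^sub>R GG c (Z (\<sigma> * s))) (at s)"
    if "s \<in> {0..T}" "\<gamma> (\<sigma> * s) \<in> cdom c" for s
  proof -
    have "((\<lambda>s. \<sigma> * s) has_vector_derivative \<sigma>) (at s)" by (auto intro!: derivative_eq_intros)
    from vector_diff_chain_at[OF this ch(2)[OF inI[OF that(1)] that(2)]]
    show ?thesis by (simp add: Z_def o_def)
  qed
  have cont: "isCont \<gamma> (\<sigma> * s)" if "s \<in> {0..T}" for s
    using tr inI[OF that] continuous_on_eq_continuous_at[OF I] unfolding trajectory_def by blast
  have cont': "isCont (\<lambda>s. \<gamma> (\<sigma> * s)) s" if "s \<in> {0..T}" for s
    by (rule isCont_o2[where f = "\<lambda>s. \<sigma> * s" and g = \<gamma>, OF _ cont[OF that]]) (intro continuous_intros)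
  have "\<gamma> (\<sigma> * \<bar>t\<bar>) \<in> cdom c \<and> Z (\<sigma> * \<bar>t\<bar>) \<in> cball z0 R"
  proof (rule real_induction[where T = T and P = "\<lambda>s. \<gamma> (\<sigma> * s) \<in> cdom c \<and> Z (\<sigma> * s) \<in> cball z0 R"])
    show "\<gamma> (\<sigma> * 0) \<in> cdom c \<and> Z (\<sigma> * 0) \<in> cball z0 R" using c Z0 R by auto
    show "\<bar>t\<bar> \<in> {0..T}" using t by auto
  next
    fix \<tau> assume \<tau>: "0 \<le> \<tau>" "\<tau> < T" and P: "\<And>s. s \<in> {0..\<tau>} \<Longrightarrow> \<gamma> (\<sigma> * s) \<in> cdom c \<and> Z (\<sigma> * s) \<in> cball z0 R"
    have \<tau>T: "\<tau> \<in> {0..T}" using \<tau> by auto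
    have "norm (Z (\<sigma> * \<tau>) - Z (\<sigma> * 0)) \<le> M * norm (\<tau> - 0)"
    proof (rule differentiable_bound[of "{0..\<tau>}" "\<lambda>s. Z (\<sigma> * s)" "\<lambda>s h. h *\<^sub>R (\<sigma> *\<^sub>R GG c (Z (\<sigma> * s)))"])
      fix s assume s: "s \<in> {0..\<tau>}"
      show "((\<lambda>s. Z (\<sigma> * s)) has_derivative (\<lambda>h. h *\<^sub>R \<sigma> *\<^sub>R GG c (Z (\<sigma> * s)))) (at s within {0..\<tau>})"
        using ZD[of s] s P[OF s] \<tau> by (auto simp: has_vector_derivative_def intro: has_derivative_at_withinI)
      show "onorm (\<lambda>h. h *\<^sub>R \<sigma> *\<^sub>R GG c (Z (\<sigma> * s))) \<le> M"
      proof (rule onorm_bound[OF M0])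
        show "norm (h *\<^sub>R \<sigma> *\<^sub>R GG c (Z (\<sigma> * s))) \<le> M * norm h" for h
          using mult_left_mono[OF M[of "Z (\<sigma> * s)"], of "\<bar>h\<bar>"] P[OF s] \<sigma>(1) by (simp add: mult.commute abs_mult)
      qed
    qed (use \<tau> in auto)
    also have "\<dots> \<le> M * T" using \<tau> M0 by (intro mult_left_mono) auto
    \<comment> \<open>The start lies within R/2 and the motion adds less than R/2. The inequality is
      strict, so continuity extends the statement past \<tau>.\<close>
    finally have "dist z0 (Z (\<sigma> * \<tau>)) < R"
      using T(3) Z0 dist_triangle[of z0 "Z (\<sigma> * \<tau>)" "Z 0"] by (simp add: dist_norm norm_minus_commute)
    then have "Z (\<sigma> * \<tau>) \<in> ball z0 R" by simp
    moreover have "isCont (\<lambda>s. Z (\<sigma> * s)) \<tau>"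
      using has_vector_derivative_continuous[OF ZD[OF \<tau>T]] P[of \<tau>] \<tau> by auto
    ultimately have "\<forall>\<^sub>F s in at \<tau>. Z (\<sigma> * s) \<in> ball z0 R"
      unfolding isCont_def tendsto_def using open_ball by blast
    moreover have "\<forall>\<^sub>F s in at \<tau>. \<gamma> (\<sigma> * s) \<in> cdom c"
      using cont'[OF \<tau>T] P[of \<tau>] \<tau> chartD(1)[OF c(1)] unfolding isCont_def tendsto_def by auto
    ultimately have "\<forall>\<^sub>F s in at \<tau>. \<gamma> (\<sigma> * s) \<in> cdom c \<and> Z (\<sigma> * s) \<in> cball z0 R"
      by eventually_elim auto
    then obtain e where "e > 0" "\<And>s. s \<noteq> \<tau> \<Longrightarrow> dist s \<tau> < e \<Longrightarrow> \<gamma> (\<sigma> * s) \<in> cdom c \<and> Z (\<sigma> * s) \<in> cball z0 R"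
      unfolding eventually_at by auto
    then show "\<exists>e>0. \<forall>s. \<tau> < s \<and> s < \<tau> + e \<longrightarrow> \<gamma> (\<sigma> * s) \<in> cdom c \<and> Z (\<sigma> * s) \<in> cball z0 R"
      by (intro exI[of _ e]) (auto simp: dist_real_def)
  next
    fix \<tau> assume \<tau>: "0 < \<tau>" "\<tau> \<le> T" and P: "\<And>s. s \<in> {0..<\<tau>} \<Longrightarrow> \<gamma> (\<sigma> * s) \<in> cdom c \<and> Z (\<sigma> * s) \<in> cball z0 R"
    have \<tau>T: "\<tau> \<in> {0..T}" using \<tau> by auto
    have ev: "\<forall>\<^sub>F s in at_left \<tau>. s \<in> {0..<\<tau>}"
      using eventually_at_left_real[OF \<tau>(1)] by eventually_elim auto
    \<comment> \<open>The curve cannot leave the chart in the limit: the positions stay in the image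
      of a compact set, which is closed because M is Hausdorff.\<close>
    let ?K = "cinv c ` (fst ` cball z0 R)"
    have sub: "fst ` cball z0 R \<subseteq> cim c" using K by auto
    have "compact (fst ` cball z0 R)" by (intro compact_continuous_image continuous_intros compact_cball)
    then have "closed ?K"
      using compact_continuous_image[OF continuous_on_subset[OF continuous_on_cinv[OF c(1)] sub]] compact_imp_closed by blast
    moreover have "\<forall>\<^sub>F s in at_left \<tau>. \<gamma> (\<sigma> * s) \<in> ?K"
      using ev
    proof eventually_elim
      fix s assume "s \<in> {0..<\<tau>}"
      note P[OF this]
      then have "\<gamma> (\<sigma> * s) = cinv c (cmap c (\<gamma> (\<sigma> * s)))" "cmap c (\<gamma> (\<sigma> * s)) \<in> fst ` cball z0 R"
        using cinv_cmap[OF c(1)] by (auto simp: Z_def image_iff intro!: bexI[of _ "Z (\<sigma> * s)"])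
      then show "\<gamma> (\<sigma> * s) \<in> ?K" by blast
    qed
    moreover have "((\<lambda>s. \<gamma> (\<sigma> * s)) \<longlongrightarrow> \<gamma> (\<sigma> * \<tau>)) (at_left \<tau>)"
      using cont'[OF \<tau>T] unfolding isCont_def by (rule tendsto_within_subset) auto
    ultimately have "\<gamma> (\<sigma> * \<tau>) \<in> ?K"
      using Lim_in_closed_set[of ?K "\<lambda>s. \<gamma> (\<sigma> * s)" "at_left \<tau>" "\<gamma> (\<sigma> * \<tau>)"] by simp
    then obtain y where y: "y \<in> fst ` cball z0 R" "\<gamma> (\<sigma> * \<tau>) = cinv c y" by (rule imageE)
    then have d: "\<gamma> (\<sigma> * \<tau>) \<in> cdom c" using subsetD[OF sub y(1)] cinv_in[OF c(1)] by simp
    have "isCont (\<lambda>s. Z (\<sigma> * s)) \<tau>" using has_vector_derivative_continuous[OF ZD[OF \<tau>T d]] .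
    then have "((\<lambda>s. Z (\<sigma> * s)) \<longlongrightarrow> Z (\<sigma> * \<tau>)) (at_left \<tau>)"
      unfolding isCont_def by (rule tendsto_within_subset) auto
    moreover have "\<forall>\<^sub>F s in at_left \<tau>. Z (\<sigma> * s) \<in> cball z0 R" using ev by eventually_elim (use P in blast)
    ultimately have "Z (\<sigma> * \<tau>) \<in> cball z0 R"
      using Lim_in_closed_set[of "cball z0 R" "\<lambda>s. Z (\<sigma> * s)" "at_left \<tau>" "Z (\<sigma> * \<tau>)"] by simp
    with d show "\<gamma> (\<sigma> * \<tau>) \<in> cdom c \<and> Z (\<sigma> * \<tau>) \<in> cball z0 R" by blast
  qed
  then show "\<gamma> t \<in> cdom c" "Z t \<in> cball z0 R" using \<sigma>(2) by auto
qed

text \<open>The covariant derivative of v along the slice, paired with v, is half the derivative of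
  |v|^2 = nu^2, which is the first summand. The derivative of the normal therefore does not occur in
  the result.\<close>

lemma deviation_derivative:
  assumes c: "slice_chart A S c i" and k: "k \<noteq> i" and p: "p \<in> S" "p \<in> cdom c"
    and n: "unit_normal_field A g S n" and \<nu>: "smooth_function_on A S \<nu>" and f: "is_shift A g F S n \<nu> \<delta> f"
  shows "(deviation A g f c k p has_real_derivative
    \<nu> p * frechet_derivative (\<lambda>x. \<nu> (cinv c (zero_coord i x))) (at (cmap c p)) (axis k 1)
      + g p (F p (\<lambda>d. \<nu> p *\<^sub>R n p d)) (tvec_of A c p (axis k 1))) (at 0)"
proof -
  note cA = slice_chartD[OF c]
  let ?x = "cmap c p" and ?e = "axis k 1 :: real^'n"
  let ?D\<nu> = "frechet_derivative (\<lambda>x. \<nu> (cinv c (zero_coord i x))) (at ?x) ?e"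
  have e: "?e $ i = 0" using k by (simp add: axis_def)
  \<comment> \<open>A coordinate line in S; the variation vector is the velocity in s of its image
    under the shift.\<close>
  define q where "q s = cinv c (?x + s *\<^sub>R ?e)" for s
  obtain s0 where s0: "0 < s0" "\<And>s. \<bar>s\<bar> < s0 \<Longrightarrow> ?x + s *\<^sub>R ?e \<in> cim c \<and> q s \<in> S \<inter> cdom c"
    using slice_line[OF c p e] unfolding q_def by blast
  have cq: "cmap c (q s) = ?x + s *\<^sub>R ?e" if "\<bar>s\<bar> < s0" for s using s0(2)[OF that] cmap_cinv[OF cA] by (simp add: q_def)
  have q0: "q 0 = p" by (simp add: q_def cinv_cmap cA p)
  have xc: "?x \<in> cim c" using p by blast
  have nT: "n r \<in> tangent_space A r" "g r (n r) (n r) = 1" if "r \<in> S" for r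
    using n that unfolding unit_normal_field_def by blast+
  have \<nu>D: "((\<lambda>s. \<nu> (q s)) has_vector_derivative ?D\<nu>) (at 0)"
    unfolding q_def by (rule slice_derivative[OF c _ p e]) (use \<nu> c in \<open>auto simp: smooth_function_on_def\<close>)
  obtain n' where nD: "((\<lambda>s. n (q s) c) has_vector_derivative n') (at 0)"
    unfolding q_def using slice_derivative[OF c _ p e, of "\<lambda>p. n p c"] n c unfolding unit_normal_field_def by blast
  define V where "V s = \<nu> (q s) *\<^sub>R n (q s) c" for s
  define V' where "V' = \<nu> p *\<^sub>R n' + ?D\<nu> *\<^sub>R n p c"
  have VD: "(V has_vector_derivative V') (at 0)"
    using bounded_bilinear.has_vector_derivative[OF bounded_bilinear_scaleR \<nu>D nD] unfolding V_def[abs_def] V'_def q0 .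
  have \<delta>: "\<delta> > 0" and tr: "\<And>s. \<bar>s\<bar> < s0 \<Longrightarrow> trajectory A g F {-\<delta><..<\<delta>} (\<lambda>t. f t (q s))"
    and f0: "\<And>s. \<bar>s\<bar> < s0 \<Longrightarrow> f 0 (q s) = q s"
    and v0: "\<And>s. \<bar>s\<bar> < s0 \<Longrightarrow> velocity A (\<lambda>t. f t (q s)) 0 = (\<lambda>d. \<nu> (q s) *\<^sub>R n (q s) d)"
    using f s0(2) unfolding is_shift_def by blast+
  define z where "z t s = (cmap c (f t (q s)), velocity A (\<lambda>t. f t (q s)) t c)" for t s
  have z0: "z 0 s = (?x + s *\<^sub>R ?e, V s)" if "\<bar>s\<bar> < s0" for s
    using f0[OF that] v0[OF that] cq[OF that] by (simp add: z_def V_def)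
  let ?Z = "(?x, V 0)" and ?U = "cim c \<times> (UNIV :: (real^'n) set)"
  have z00: "z 0 0 = ?Z" using z0[of 0] s0 by simp
  note U = open_phase[OF cA]
  have "?Z \<in> ?U" using xc by simp
  then obtain R where R: "0 < R" "cball ?Z R \<subseteq> ?U" using U open_contains_cball by blast
  have "compact (GG c ` cball ?Z R)"
    by (rule compact_continuous_image[OF continuous_on_subset[OF Ck_on_imp_continuous_on[OF GG_smooth[OF cA]] R(2)]]) simp
  then obtain M where M: "0 < M" "\<And>z. z \<in> cball ?Z R \<Longrightarrow> norm (GG c z) \<le> M"
    using compact_imp_bounded bounded_pos by (metis imageI)
  \<comment> \<open>M T is at most R/4, so trajectories starting in the half ball remain in the
    whole ball up to time T.\<close>
  define T where "T = min (\<delta> / 2) (R / (4 * M))"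
  have T: "0 < T" "T < \<delta>" "M * T < R / 2"
  proof -
    show "0 < T" "T < \<delta>" using \<delta> R M by (auto simp: T_def)
    have "M * T \<le> M * (R / (4 * M))" using M by (intro mult_left_mono) (auto simp: T_def)
    also have "\<dots> < R / 2" using M R by simp
    finally show "M * T < R / 2" .
  qed
  have zi: "((\<lambda>s. z 0 s) has_vector_derivative (?e, V')) (at 0)"
  proof (rule has_vector_derivative_transform_within_open[of _ _ _ "ball 0 s0"])
    show "((\<lambda>s. (?x + s *\<^sub>R ?e, V s)) has_vector_derivative (?e, V')) (at 0)"
      by (intro has_vector_derivative_Pair VD line_deriv)
  qed (use s0 z0 in \<open>auto simp: dist_norm\<close>)
  have "isCont (\<lambda>s. z 0 s) 0" using has_vector_derivative_continuous[OF zi] .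
  then obtain s1 where s1: "s1 > 0" "\<And>s. dist s 0 < s1 \<Longrightarrow> dist (z 0 s) (z 0 0) < R / 2"
    unfolding continuous_at_eps_delta using half_gt_zero[OF R(1)] by metis
  define s2 where "s2 = min s0 s1"
  have s2: "0 < s2" "s2 \<le> s0" "s2 \<le> s1" using s0 s1 by (auto simp: s2_def)
  have stay: "f t (q s) \<in> cdom c" "z t s \<in> cball ?Z R" if "\<bar>t\<bar> \<le> T" "\<bar>s\<bar> < s2" for t s
  proof -
    have s: "\<bar>s\<bar> < s0" "\<bar>s\<bar> < s1" using that s2 by auto
    have "f 0 (q s) \<in> cdom c" using f0[OF s(1)] s0(2)[OF s(1)] by simp
    note st = trajectory_stays[OF tr[OF s(1)] cA this R(2) M(2) T _ that(1)]
    have "z 0 s \<in> cball ?Z (R / 2)" using s1(2)[of s] s(2) by (simp add: z00 dist_commute)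
    then show "f t (q s) \<in> cdom c" "z t s \<in> cball ?Z R" using st unfolding z_def by blast+
  qed
  have zD: "((\<lambda>t. z t s) has_vector_derivative GG c (z t s)) (at t)" if "\<bar>t\<bar> < T" "\<bar>s\<bar> < s2" for t s
  proof -
    have "\<bar>s\<bar> < s0" "t \<in> {-\<delta><..<\<delta>}" "\<bar>t\<bar> \<le> T" using that s2 T by auto
    then show ?thesis unfolding z_def using trajectory_chart(2)[OF tr _ _ cA] stay(1) that by simp
  qed
  obtain T' Y where T': "0 < T'" and Y0: "Y 0 = (?e, V')"
    and YD: "(Y has_vector_derivative frechet_derivative (GG c) (at ?Z) (?e, V')) (at 0)"
    and Y: "\<And>t. \<bar>t\<bar> < T' \<Longrightarrow> ((\<lambda>s. z t s) has_vector_derivative Y t) (at 0)"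
    using ode_dependence[OF U GG_smooth[OF cA] R(2) T(1) s2(1) stay(2) zD zi] z00 by (metis less_imp_le)
  define T2 where "T2 = min T T'"
  have T2: "0 < T2" using T T' by (simp add: T2_def)
  define \<xi> where "\<xi> t = fst (z t 0)" for t
  define \<omega> where "\<omega> t = snd (z t 0)" for t
  have dev: "deviation A g f c k p t = (gm c (\<xi> t) *v fst (Y t)) \<bullet> \<omega> t" if t: "t \<in> ball 0 T2" for t
  proof -
    have t': "\<bar>t\<bar> < T" "\<bar>t\<bar> < T'" "t \<in> {-\<delta><..<\<delta>}" using t T by (auto simp: T2_def dist_norm)
    have fc: "f t (q s) \<in> cdom c" if "\<bar>s\<bar> < s2" for s using stay(1)[of t s] t' that by simp
    have fp: "f t p \<in> cdom c" using fc[of 0] s2 q0 by simp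
    have D: "((cmap c \<circ> (\<lambda>s. f t (q s))) has_vector_derivative fst (Y t)) (at 0)"
      using bounded_linear.has_vector_derivative[OF bounded_linear_fst Y[OF t'(2)]] by (simp add: z_def o_def)
    have "isCont (\<lambda>s. cinv c (cmap c (f t (q s)))) 0"
      by (rule isCont_o2[where g = "cinv c", OF has_vector_derivative_continuous[OF D[unfolded o_def]] isCont_cinv[OF cA]])
        (use fp q0 in auto)
    then have "continuous (at 0) (\<lambda>s. f t (q s))"
      by (rule continuous_transform_within[OF _ s2(1)]) (use fc cinv_cmap[OF cA] in \<open>auto simp: dist_norm\<close>)
    then have "velocity A (\<lambda>s. f t (q s)) 0 = tvec_of A c (f t (q 0)) (fst (Y t))"
      by (intro velocity_eq[OF cA _ _ D]) (use fp q0 in auto)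
    then have var: "variation A f c k p t = tvec_of A c (f t p) (fst (Y t))"
      by (simp add: variation_def q_def[abs_def] cinv_cmap cA p)
    have "velocity A (\<lambda>s. f s p) t = tvec_of A c (f t p) (\<omega> t)"
      using trajectory_chart(1)[OF tr[of 0] _ t'(3) cA] s0 fp q0 by (simp add: \<omega>_def z_def)
    then show ?thesis
      unfolding deviation_def var using metric_tvec_of[OF cA fp] q0 by (simp add: \<xi>_def z_def)
  qed
  have Z0: "\<xi> 0 = ?x" "\<omega> 0 = V 0" by (simp_all add: \<xi>_def \<omega>_def z00)
  have zD0: "((\<lambda>t. z t 0) has_vector_derivative GG c ?Z) (at 0)" using zD[of 0 0] T s2 z00 by simp
  have \<xi>D: "(\<xi> has_vector_derivative V 0) (at 0)"
    using bounded_linear.has_vector_derivative[OF bounded_linear_fst zD0] by (simp add: \<xi>_def[abs_def] GG_def)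
  have \<omega>D: "(\<omega> has_vector_derivative Fu c ?x (V 0) - Gam c ?x (V 0) (V 0)) (at 0)"
    using bounded_linear.has_vector_derivative[OF bounded_linear_snd zD0] by (simp add: \<omega>_def[abs_def] GG_def)
  \<comment> \<open>The first component of the field is the velocity itself. Hence the time
    derivative of the variation vector at 0 is V', the derivative of the initial velocity along the
    slice: the two derivatives commute.\<close>
  have Y1: "((\<lambda>t. fst (Y t)) has_vector_derivative V') (at 0)"
  proof -
    have "(GG c has_derivative frechet_derivative (GG c) (at ?Z)) (at ?Z)"
      using Ck_on_Suc_has_derivative[OF GG_smooth[OF cA]] xc by blast
    from bounded_linear.has_derivative[OF bounded_linear_fst this]
    have "(snd has_derivative (\<lambda>h. fst (frechet_derivative (GG c) (at ?Z) h))) (at ?Z)" by (simp add: GG_def)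
    from has_derivative_unique[OF this bounded_linear_imp_has_derivative[OF bounded_linear_snd]]
    have "fst (frechet_derivative (GG c) (at ?Z) (?e, V')) = V'" by (metis snd_conv)
    then show ?thesis using bounded_linear.has_vector_derivative[OF bounded_linear_fst YD] by simp
  qed
  have gD: "((\<lambda>t. gm c (\<xi> t)) has_vector_derivative Dg c ?x (V 0)) (at 0)"
    by (rule has_vector_derivative_chain[OF \<xi>D]) (simp add: Z0 gm_has_derivative cA xc)
  have "((\<lambda>t. (gm c (\<xi> t) *v fst (Y t)) \<bullet> \<omega> t) has_vector_derivative
      (gm c ?x *v ?e) \<bullet> (Fu c ?x (V 0) - Gam c ?x (V 0) (V 0)) + (gm c ?x *v V' + Dg c ?x (V 0) *v ?e) \<bullet> V 0) (at 0)"
    using has_vector_derivative_inner[OF has_vector_derivative_mv[OF gD Y1] \<omega>D] by (simp add: Z0 Y0)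
  then have devD: "(deviation A g f c k p has_vector_derivative
      (gm c ?x *v ?e) \<bullet> (Fu c ?x (V 0) - Gam c ?x (V 0) (V 0)) + (gm c ?x *v V' + Dg c ?x (V 0) *v ?e) \<bullet> V 0) (at 0)"
    by (rule has_vector_derivative_transform_within_open[of _ _ _ "ball 0 T2"]) (use dev T2 in auto)
  \<comment> \<open>Differentiating this identity in s yields \<open>sq\<close>, through which V',
    and with it the unknown derivative of the normal, is eliminated.\<close>
  have unit: "(gm c (?x + s *\<^sub>R ?e) *v V s) \<bullet> V s = (\<nu> (q s))\<^sup>2" if "\<bar>s\<bar> < s0" for s
  proof -
    have "q s \<in> cdom c" "q s \<in> S" using s0(2)[OF that] by auto
    then have "(gm c (?x + s *\<^sub>R ?e) *v n (q s) c) \<bullet> n (q s) c = 1"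
      using metric_chart[OF cA _ nT(1) nT(1)] nT(2) cq[OF that] by metis
    then show ?thesis by (simp add: V_def power2_eq_square algebra_simps)
  qed
  have geD: "((\<lambda>s. gm c (?x + s *\<^sub>R ?e)) has_vector_derivative Dg c ?x ?e) (at 0)"
    by (rule has_vector_derivative_chain[OF line_deriv]) (simp add: gm_has_derivative cA xc)
  have "((\<lambda>s. (\<nu> (q s))\<^sup>2) has_vector_derivative (gm c ?x *v V 0) \<bullet> V' + (gm c ?x *v V' + Dg c ?x ?e *v V 0) \<bullet> V 0) (at 0)"
    by (rule has_vector_derivative_transform_within_open[of _ _ _ "ball 0 s0", OF
        has_vector_derivative_inner[OF has_vector_derivative_mv[OF geD VD] VD, simplified]])
      (use unit s0 in \<open>auto simp: dist_norm\<close>)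
  moreover have "((\<lambda>s. (\<nu> (q s))\<^sup>2) has_vector_derivative 2 * (\<nu> p * ?D\<nu>)) (at 0)"
    using \<nu>D unfolding has_real_derivative_iff_has_vector_derivative[symmetric]
    by (auto intro!: derivative_eq_intros simp: q0)
  ultimately have sq: "(gm c ?x *v V 0) \<bullet> V' + (gm c ?x *v V' + Dg c ?x ?e *v V 0) \<bullet> V 0 = 2 * (\<nu> p * ?D\<nu>)"
    by (rule vector_derivative_unique_at)
  have Vn: "V 0 = \<nu> p *\<^sub>R n p c" by (simp add: V_def q0)
  have gF: "g p (F p (\<lambda>d. \<nu> p *\<^sub>R n p d)) (tvec_of A c p ?e) = (gm c ?x *v ?e) \<bullet> Fu c ?x (V 0)"
  proof -
    have w: "(\<lambda>d. \<nu> p *\<^sub>R n p d) \<in> tangent_space A p" by (intro tangent_space_scaleR nT p)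
    have "F p (\<lambda>d. \<nu> p *\<^sub>R n p d) c = Fu c ?x (V 0)" using force_chart[OF cA p(2) w] by (simp add: Vn)
    then show ?thesis
      using metric_chart[OF cA p(2) force_in[OF w] tvec_of_in[OF cA p(2)], of ?e] gm_sym[OF cA xc]
      by (simp add: tvec_of_self cA p)
  qed
  \<comment> \<open>By \<open>koszul\<close> the Christoffel term equals metric derivatives, of
    which the one in direction \<open>V 0\<close> cancels and the one in direction \<open>?e\<close>
    combines with V' to half of \<open>sq\<close>.\<close>
  have "(gm c ?x *v ?e) \<bullet> (Fu c ?x (V 0) - Gam c ?x (V 0) (V 0)) + (gm c ?x *v V' + Dg c ?x (V 0) *v ?e) \<bullet> V 0
      = \<nu> p * ?D\<nu> + g p (F p (\<lambda>d. \<nu> p *\<^sub>R n p d)) (tvec_of A c p ?e)"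
    unfolding gF
    using sq koszul[OF cA xc, of "V 0" "V 0" ?e] gm_sym[OF cA xc, of "V 0" V'] gm_sym[OF cA xc, of "Gam c ?x (V 0) (V 0)" ?e]
      Dg_sym[OF cA xc, of "V 0" ?e "V 0"]
    by (simp add: inner_diff_right inner_add_left)
  with devD show ?thesis unfolding has_real_derivative_iff_has_vector_derivative by simp
qed

end

section \<open>The normality equations without indices\<close>

lemma bilinear_axis_sum:
  fixes \<beta> :: "real^'n::finite \<Rightarrow> real^'n \<Rightarrow> real"
  assumes "\<And>b. linear (\<lambda>a. \<beta> a b)" "\<And>a. linear (\<beta> a)"
  shows "(\<Sum>i\<in>UNIV. \<Sum>j\<in>UNIV. a $ i * b $ j * \<beta> (axis i 1) (axis j 1)) = \<beta> a b"
proof -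
  have e: "a = (\<Sum>i\<in>UNIV. a $ i *\<^sub>R axis i 1)" for a :: "real^'n"
    by (simp add: vec_eq_iff axis_def if_distrib[of "(*) _"] cong: if_cong)
  have "\<beta> a b = (\<Sum>i\<in>UNIV. a $ i * \<beta> (axis i 1) b)"
    by (subst e[of a]) (simp add: linear_sum[OF assms(1)] linear_scale[OF assms(1)])
  also have "\<dots> = (\<Sum>i\<in>UNIV. a $ i * (\<Sum>j\<in>UNIV. b $ j * \<beta> (axis i 1) (axis j 1)))"
    by (subst e[of b]) (simp add: linear_sum[OF assms(2)] linear_scale[OF assms(2)])
  finally show ?thesis by (simp add: sum_distrib_left mult.assoc)
qed

lemma linear_axis_sum:
  fixes f :: "real^'n::finite \<Rightarrow> 'b::real_vector"
  assumes "linear f"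
  shows "(\<Sum>i\<in>UNIV. a $ i *\<^sub>R f (axis i 1)) = f a"
proof -
  have e: "a = (\<Sum>i\<in>UNIV. a $ i *\<^sub>R axis i 1)"
    by (simp add: vec_eq_iff axis_def if_distrib[of "(*) _"] cong: if_cong)
  show ?thesis by (subst (2) e) (simp add: linear_sum[OF assms] linear_scale[OF assms])
qed

lemma bilinear_axis_eq:
  fixes \<beta> \<gamma> :: "real^'n::finite \<Rightarrow> real^'n \<Rightarrow> real"
  assumes "\<And>b. linear (\<lambda>a. \<beta> a b)" "\<And>a. linear (\<beta> a)" "\<And>b. linear (\<lambda>a. \<gamma> a b)" "\<And>a. linear (\<gamma> a)"
    and "\<And>i j. \<beta> (axis i 1) (axis j 1) = \<gamma> (axis i 1) (axis j 1)"
  shows "\<beta> a b = \<gamma> a b"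
  using bilinear_axis_sum[OF assms(1,2), of a b] bilinear_axis_sum[OF assms(3,4), of a b] assms(5) by simp

context newtonian begin

abbreviation Fd :: "('m, 'n) chart \<Rightarrow> real^'n \<Rightarrow> real^'n \<Rightarrow> real^'n" where
  "Fd \<equiv> force_down A g F"

lemma Fd_smooth: "c \<in> A \<Longrightarrow> Ck_on k (cim c \<times> UNIV) (\<lambda>z. Fd c (fst z) (snd z))"
  unfolding force_down_def
  by (intro Ck_on_matrix_vector open_phase force_smooth
      Ck_on_compose[OF open_phase chartD(2) _ metric_smooth, of c c] Ck_on_fst Ck_on_id) auto

definition DvF :: "('m, 'n) chart \<Rightarrow> real^'n \<Rightarrow> real^'n \<Rightarrow> real^'n \<Rightarrow> real^'n" where
  "DvF c x v = frechet_derivative (\<lambda>w. Fd c x w) (at v)"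

definition DxF :: "('m, 'n) chart \<Rightarrow> real^'n \<Rightarrow> real^'n \<Rightarrow> real^'n \<Rightarrow> real^'n" where
  "DxF c x v = frechet_derivative (\<lambda>y. Fd c y v) (at x)"

lemma Fd_derivatives:
  assumes c: "c \<in> A" "x \<in> cim c"
  shows "((\<lambda>w. Fd c x w) has_derivative DvF c x v) (at v)"
    and "((\<lambda>y. Fd c y v) has_derivative DxF c x v) (at x)"
    and "((\<lambda>z. Fd c (fst z) (snd z)) has_derivative (\<lambda>h. DxF c x v (fst h) + DvF c x v (snd h))) (at (x, v))"
proof -
  let ?f = "\<lambda>z. Fd c (fst z) (snd z)"
  let ?D = "frechet_derivative ?f (at (x, v))"
  have D: "(?f has_derivative ?D) (at (x, v))"
    using Ck_on_Suc_has_derivative[OF Fd_smooth[OF c(1)], of "(x, v)"] c(2) by simp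
  have 1: "((\<lambda>w. (x, w)) has_derivative (\<lambda>h. (0, h))) (at v)" "((\<lambda>y. (y, v)) has_derivative (\<lambda>h. (h, 0))) (at x)"
    by (auto intro!: derivative_eq_intros)
  from has_derivative_compose[OF 1(1) D] has_derivative_compose[OF 1(2) D]
  have v: "((\<lambda>w. Fd c x w) has_derivative (\<lambda>h. ?D (0, h))) (at v)"
    and x: "((\<lambda>y. Fd c y v) has_derivative (\<lambda>h. ?D (h, 0))) (at x)" by simp_all
  have eq: "DvF c x v = (\<lambda>h. ?D (0, h))" "DxF c x v = (\<lambda>h. ?D (h, 0))"
    unfolding DvF_def DxF_def using frechet_derivative_at[OF v] frechet_derivative_at[OF x] by metis+
  show "((\<lambda>w. Fd c x w) has_derivative DvF c x v) (at v)" "((\<lambda>y. Fd c y v) has_derivative DxF c x v) (at x)"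
    unfolding eq by (fact v, fact x)
  have "?D (fst h, 0) + ?D (0, snd h) = ?D h" for h
    by (subst linear_add[OF has_derivative_linear[OF D], symmetric]) simp
  then have e: "(\<lambda>h. ?D (fst h, 0) + ?D (0, snd h)) = ?D" by (rule ext)
  show "(?f has_derivative (\<lambda>h. DxF c x v (fst h) + DvF c x v (snd h))) (at (x, v))"
    unfolding eq e by (rule D)
qed

lemma DvF_linear: "c \<in> A \<Longrightarrow> x \<in> cim c \<Longrightarrow> linear (DvF c x v)"
  by (rule has_derivative_linear[OF Fd_derivatives(1)])

lemma DxF_linear: "c \<in> A \<Longrightarrow> x \<in> cim c \<Longrightarrow> linear (DxF c x v)"
  by (rule has_derivative_linear[OF Fd_derivatives(2)])

text \<open>$\sum_{i,j} a^i b^j \nabla_i F_j$\<close>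

definition nabF :: "('m, 'n) chart \<Rightarrow> real^'n \<Rightarrow> real^'n \<Rightarrow> real^'n \<Rightarrow> real^'n \<Rightarrow> real" where
  "nabF c x v a b = (DxF c x v a - DvF c x v (Gam c x a v)) \<bullet> b - Gam c x a b \<bullet> Fd c x v"

definition alpha :: "('m, 'n) chart \<Rightarrow> real^'n \<Rightarrow> real^'n \<Rightarrow> real^'n \<Rightarrow> real^'n \<Rightarrow> real" where
  "alpha c x v a b = (Fd c x v \<bullet> a) * (DvF c x v v \<bullet> b) / ((gm c x *v v) \<bullet> v) - nabF c x v a b"

text \<open>Contracted with \<open>a\<close> and \<open>b\<close>, the bracket $\sum_m N^m F_i \tilde\nabla_m F_j / v - \nabla_i F_j$ of the
  first family of equations is \<open>alpha\<close>. The projectors restrict \<open>a\<close> and \<open>b\<close> to the orthogonal complement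
  of \<open>v\<close>, and the second family says that $\tilde\nabla F$ is there a multiple of the metric.\<close>

definition compat :: "('m, 'n) chart \<Rightarrow> real^'n \<Rightarrow> real^'n \<Rightarrow> bool" where
  "compat c x v \<longleftrightarrow>
    (\<forall>a b. (gm c x *v v) \<bullet> a = 0 \<longrightarrow> (gm c x *v v) \<bullet> b = 0 \<longrightarrow> alpha c x v a b = alpha c x v b a) \<and>
    (\<exists>l. \<forall>a b. (gm c x *v v) \<bullet> a = 0 \<longrightarrow> (gm c x *v v) \<bullet> b = 0 \<longrightarrow> DvF c x v a \<bullet> b = l * ((gm c x *v a) \<bullet> b))"

lemma nabF_linear:
  assumes c: "c \<in> A" "x \<in> cim c"
  shows "linear (\<lambda>a. nabF c x v a b)" "linear (nabF c x v a)"
proof -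
  note l = linear_add[OF DvF_linear[OF c]] linear_add[OF DxF_linear[OF c]]
      linear_scale[OF DvF_linear[OF c]] linear_scale[OF DxF_linear[OF c]]
      linear_add[OF Gam_linear(1)] linear_add[OF Gam_linear(2)]
      linear_scale[OF Gam_linear(1)] linear_scale[OF Gam_linear(2)]
      inner_add_left inner_diff_left inner_scaleR_left inner_add_right inner_scaleR_right
  show "linear (\<lambda>a. nabF c x v a b)"
  proof (rule linearI)
    show "nabF c x v (a + a') b = nabF c x v a b + nabF c x v a' b" for a a'
      unfolding nabF_def l by simp
    show "nabF c x v (r *\<^sub>R a) b = r *\<^sub>R nabF c x v a b" for r a
      unfolding nabF_def l real_scaleR_def right_diff_distrib ..
  qed
  show "linear (nabF c x v a)"
  proof (rule linearI)
    show "nabF c x v a (b + b') = nabF c x v a b + nabF c x v a b'" for b b'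
      unfolding nabF_def l by simp
    show "nabF c x v a (r *\<^sub>R b) = r *\<^sub>R nabF c x v a b" for r b
      unfolding nabF_def l real_scaleR_def right_diff_distrib ..
  qed
qed

lemma alpha_linear:
  assumes c: "c \<in> A" "x \<in> cim c"
  shows "linear (\<lambda>a. alpha c x v a b)" "linear (alpha c x v a)"
proof -
  note n = linear_add[OF nabF_linear(1)[OF c]] linear_add[OF nabF_linear(2)[OF c]]
    linear_scale[OF nabF_linear(1)[OF c]] linear_scale[OF nabF_linear(2)[OF c]]
  show "linear (\<lambda>a. alpha c x v a b)"
  proof (rule linearI)
    show "alpha c x v (a + a') b = alpha c x v a b + alpha c x v a' b" for a a'
      unfolding alpha_def n inner_add_right distrib_right add_divide_distrib by simp
    show "alpha c x v (r *\<^sub>R a) b = r *\<^sub>R alpha c x v a b" for r a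
      unfolding alpha_def n inner_scaleR_right real_scaleR_def right_diff_distrib by simp
  qed
  show "linear (alpha c x v a)"
  proof (rule linearI)
    show "alpha c x v a (b + b') = alpha c x v a b + alpha c x v a b'" for b b'
      unfolding alpha_def n inner_add_right distrib_left add_divide_distrib by simp
    show "alpha c x v a (r *\<^sub>R b) = r *\<^sub>R alpha c x v a b" for r b
      unfolding alpha_def n inner_scaleR_right real_scaleR_def right_diff_distrib by simp
  qed
qed

lemma gradients:
  assumes c: "c \<in> A" "x \<in> cim c"
  shows "vgrad_down A g F c i k x v = DvF c x v (axis i 1) $ k"
    and "sgrad_down A g F c i k x v = nabF c x v (axis i 1) (axis k 1)"
proof -
  show v: "vgrad_down A g F c i k x v = DvF c x v (axis i 1) $ k" for i k
    unfolding vgrad_down_def partial_def DvF_def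
    by (rule frechet_component) (use Fd_derivatives(1)[OF c] differentiable_def in blast)
  have p: "partial i (\<lambda>y. Fd c y v $ k) x = DxF c x v (axis i 1) $ k"
    unfolding partial_def DxF_def
    by (rule frechet_component) (use Fd_derivatives(2)[OF c] differentiable_def in blast)
  have "DvF c x v (Gam c x (axis i 1) v) = (\<Sum>b\<in>UNIV. Gam c x (axis i 1) v $ b *\<^sub>R DvF c x v (axis b 1))"
    by (rule linear_axis_sum[OF DvF_linear[OF c], symmetric])
  moreover have "Gam c x (axis i 1) v $ b = (\<Sum>a\<in>UNIV. v $ a * christoffel A g c b i a x)" for b
  proof -
    have "Gam c x (axis i 1) v = (\<Sum>a\<in>UNIV. v $ a *\<^sub>R Gam c x (axis i 1) (axis a 1))"
      by (rule linear_axis_sum[OF Gam_linear(1), symmetric])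
    then show ?thesis by (simp add: Gam_axis)
  qed
  ultimately have "DvF c x v (Gam c x (axis i 1) v) $ k
      = (\<Sum>b\<in>UNIV. \<Sum>a\<in>UNIV. v $ a * christoffel A g c b i a x * DvF c x v (axis b 1) $ k)"
    by (simp add: sum_distrib_right)
  also have "\<dots> = (\<Sum>a\<in>UNIV. \<Sum>b\<in>UNIV. v $ a * christoffel A g c b i a x * DvF c x v (axis b 1) $ k)"
    by (rule sum.swap)
  finally show "sgrad_down A g F c i k x v = nabF c x v (axis i 1) (axis k 1)"
    by (simp add: sgrad_down_def p v nabF_def inner_axis) (simp add: inner_vec_def Gam_axis)
qed

text \<open>The metric does not depend on the velocity, so lowering the index commutes with the
  velocity gradient.\<close>

lemma vgrad_up_eq:
  assumes c: "c \<in> A" "x \<in> cim c"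
  obtains D where "linear D" "\<And>i k. vgrad_up A F c i k x v = D (axis i 1) $ k" "\<And>a. DvF c x v a = gm c x *v D a"
proof -
  let ?D = "frechet_derivative (\<lambda>w. Fu c x w) (at v)"
  have 1: "((\<lambda>w. (x, w)) has_derivative (\<lambda>h. (0, h))) (at v)" by (auto intro!: derivative_eq_intros)
  have "(\<lambda>z. Fu c (fst z) (snd z)) differentiable (at (x, v))"
    using Ck_on_Suc_has_derivative[OF force_smooth[OF c(1)], of "(x, v)"] c(2) differentiable_def by fastforce
  then obtain E where "((\<lambda>z. Fu c (fst z) (snd z)) has_derivative E) (at (x, v))" by (auto simp: differentiable_def)
  from has_derivative_compose[OF 1 this] have df: "(\<lambda>w. Fu c x w) differentiable (at v)"
    by (auto simp: differentiable_def)
  then have D: "((\<lambda>w. Fu c x w) has_derivative ?D) (at v)" using frechet_derivative_works by blast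
  from bounded_linear.has_derivative[OF matrix_vector_mul_bounded_linear[of "gm c x"] D]
  have "((\<lambda>w. Fd c x w) has_derivative (\<lambda>a. gm c x *v ?D a)) (at v)" by (simp add: force_down_def)
  then have "DvF c x v = (\<lambda>a. gm c x *v ?D a)" using has_derivative_unique[OF Fd_derivatives(1)[OF c]] by blast
  moreover have "vgrad_up A F c i k x v = ?D (axis i 1) $ k" for i k
    unfolding vgrad_up_def partial_def by (rule frechet_component[OF df])
  ultimately show ?thesis using that[of ?D] has_derivative_linear[OF D] by simp
qed

text \<open>Contraction with the projectors is the orthogonal projection \<open>pr\<close> onto the
  complement of v. The indexed equations are thus identities of bilinear forms at projected basis
  vectors, and linearity extends them to the whole complement.\<close>

lemma normal_equations_iff:
  assumes c: "c \<in> A" "p \<in> cdom c" and v: "v \<in> tangent_space A p" "v \<noteq> (\<lambda>_. 0)" and n2: "2 \<le> CARD('n)"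
  shows "(let x = cmap c p;
           P = projector A g c p v;
           N = unit_up g c p v;
           F_dn = (\<lambda>i. force_down A g F c x (v c) $ i);
           vF_up = (\<lambda>i k. vgrad_up A F c i k x (v c));
           vF_dn = (\<lambda>i k. vgrad_down A g F c i k x (v c));
           sF_dn = (\<lambda>i k. sgrad_down A g F c i k x (v c))
       in \<forall>\<epsilon> \<sigma>.
         (\<Sum>i\<in>UNIV. \<Sum>j\<in>UNIV. P i \<epsilon> * P j \<sigma> *
            ((\<Sum>m\<in>UNIV. N m * (F_dn i * vF_dn m j / sqrt (g p v v))) - sF_dn i j))
         = (\<Sum>i\<in>UNIV. \<Sum>j\<in>UNIV. P i \<epsilon> * P j \<sigma> *
            ((\<Sum>m\<in>UNIV. N m * (F_dn j * vF_dn m i / sqrt (g p v v))) - sF_dn j i))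
         \<and>
         (\<Sum>i\<in>UNIV. \<Sum>j\<in>UNIV. P j \<sigma> * vF_up j i * P \<epsilon> i)
         = (\<Sum>i\<in>UNIV. \<Sum>j\<in>UNIV. \<Sum>m\<in>UNIV.
              P j m * vF_up j i * P m i / (real CARD('n) - 1) * P \<epsilon> \<sigma>))
    \<longleftrightarrow> compat c (cmap c p) (v c)"
proof -
  let ?x = "cmap c p" and ?w = "v c"
  have x: "?x \<in> cim c" using c by blast
  note lin = DvF_linear[OF c(1) x]
  have w0: "?w \<noteq> 0" using v tangent_spaceD[OF v(1) c] tvec_of_zero[OF c] by metis
  define G where "G = gm c ?x"
  define s where "s = sqrt (g p v v)"
  have gvv: "g p v v = (G *v ?w) \<bullet> ?w" unfolding G_def by (rule metric_chart[OF c v(1) v(1)])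
  have pos: "0 < (G *v ?w) \<bullet> ?w" unfolding G_def by (rule gm_pos[OF c(1) x w0])
  have s: "0 < s" "s * s = (G *v ?w) \<bullet> ?w" using pos by (simp_all add: s_def gvv)
  have Gs: "(G *v a) \<bullet> b = (G *v b) \<bullet> a" for a b unfolding G_def by (rule gm_sym[OF c(1) x])
  define N where "N = (1 / s) *\<^sub>R ?w"
  have N: "unit_up g c p v i = N $ i" for i by (simp add: unit_up_def N_def s_def)
  have Nd: "unit_down A g c p v i = (G *v N) $ i" for i
    by (simp add: unit_down_def N matrix_vector_mult_def G_def)
  have NN: "(G *v N) \<bullet> N = 1" using s by (simp add: N_def algebra_simps s(2)[symmetric])
  define pr where "pr a = a - ((G *v N) \<bullet> a) *\<^sub>R N" for a
  have prl: "linear pr" by (rule linearI) (auto simp: pr_def algebra_simps inner_add_right)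
  have P: "projector A g c p v i j = pr (axis j 1) $ i" for i j
  proof -
    have "(G *v N) \<bullet> axis j 1 = (G *v N) $ j" by (simp add: inner_axis)
    then show ?thesis unfolding projector_def N Nd pr_def by (simp add: axis_def mult.commute)
  qed
  have P': "(\<Sum>i\<in>UNIV. y $ i * projector A g c p v e i) = pr y $ e" for y e
  proof -
    have "(\<Sum>i\<in>UNIV. y $ i *\<^sub>R pr (axis i 1)) $ e = pr y $ e" using linear_axis_sum[OF prl] by metis
    then show ?thesis by (simp add: P)
  qed
  have perp: "(G *v ?w) \<bullet> a = 0 \<longleftrightarrow> (G *v N) \<bullet> a = 0" for a using s by (simp add: N_def algebra_simps)
  have prp: "(G *v ?w) \<bullet> pr a = 0" for a unfolding perp by (simp add: pr_def inner_diff_right NN)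
  have prid: "pr a = a" if "(G *v ?w) \<bullet> a = 0" for a using that unfolding perp by (simp add: pr_def)
  have prG: "(G *v pr a) \<bullet> b = (G *v a) \<bullet> b" if "(G *v ?w) \<bullet> b = 0" for a b
    using that unfolding perp by (simp add: pr_def algebra_simps)
  let ?F = "Fd c ?x ?w" and ?D = "DvF c ?x ?w"
  have \<alpha>: "alpha c ?x ?w a b = (?F \<bullet> a) * (?D N \<bullet> b) / s - nabF c ?x ?w a b" for a b
    using s(1) by (simp add: alpha_def G_def[symmetric] s(2)[symmetric] N_def linear_scale[OF lin] divide_simps)
  have mid: "(\<Sum>m\<in>UNIV. N $ m * (?F $ i * vgrad_down A g F c m j ?x ?w / s)) - sgrad_down A g F c i j ?x ?w
      = alpha c ?x ?w (axis i 1) (axis j 1)" for i j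
  proof -
    have "?D N $ j = (\<Sum>m\<in>UNIV. N $ m *\<^sub>R ?D (axis m 1)) $ j" using linear_axis_sum[OF lin] by metis
    then have "?D N $ j = (\<Sum>m\<in>UNIV. N $ m * ?D (axis m 1) $ j)" by simp
    then show ?thesis
      by (simp add: \<alpha> gradients[OF c(1) x] inner_axis sum_distrib_left sum_divide_distrib mult_ac)
  qed
  note al = alpha_linear[OF c(1) x]
  have eq1: "(\<Sum>i\<in>UNIV. \<Sum>j\<in>UNIV. projector A g c p v i \<epsilon> * projector A g c p v j \<sigma> *
     ((\<Sum>m\<in>UNIV. N $ m * (?F $ i * vgrad_down A g F c m j ?x ?w / s)) - sgrad_down A g F c i j ?x ?w))
     = alpha c ?x ?w (pr (axis \<epsilon> 1)) (pr (axis \<sigma> 1))" for \<epsilon> \<sigma>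
    unfolding mid P by (rule bilinear_axis_sum[OF al])
  have eq1': "(\<Sum>i\<in>UNIV. \<Sum>j\<in>UNIV. projector A g c p v i \<epsilon> * projector A g c p v j \<sigma> *
     ((\<Sum>m\<in>UNIV. N $ m * (?F $ j * vgrad_down A g F c m i ?x ?w / s)) - sgrad_down A g F c j i ?x ?w))
     = alpha c ?x ?w (pr (axis \<sigma> 1)) (pr (axis \<epsilon> 1))" for \<epsilon> \<sigma>
    unfolding mid P by (rule bilinear_axis_sum[OF al(2,1)])
  have E1: "(\<forall>\<epsilon> \<sigma>. alpha c ?x ?w (pr (axis \<epsilon> 1)) (pr (axis \<sigma> 1)) = alpha c ?x ?w (pr (axis \<sigma> 1)) (pr (axis \<epsilon> 1)))
    \<longleftrightarrow> (\<forall>a b. (G *v ?w) \<bullet> a = 0 \<longrightarrow> (G *v ?w) \<bullet> b = 0 \<longrightarrow> alpha c ?x ?w a b = alpha c ?x ?w b a)" (is "?L \<longleftrightarrow> ?R")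
  proof
    assume L: ?L
    have "alpha c ?x ?w (pr a) (pr b) = alpha c ?x ?w (pr b) (pr a)" for a b
      by (rule bilinear_axis_eq[of "\<lambda>a b. alpha c ?x ?w (pr a) (pr b)" "\<lambda>a b. alpha c ?x ?w (pr b) (pr a)"])
        (use linear_compose[OF prl al(1)] linear_compose[OF prl al(2)] L in \<open>auto simp: o_def\<close>)
    then show ?R using prid by metis
  qed (use prp in blast)
  obtain D where D: "linear D" "\<And>i k. vgrad_up A F c i k ?x ?w = D (axis i 1) $ k" "\<And>a. ?D a = G *v D a"
    using vgrad_up_eq[OF c(1) x] unfolding G_def by blast
  have Dax: "(\<Sum>j\<in>UNIV. a $ j * D (axis j 1) $ i) = D a $ i" for a i
  proof -
    have "(\<Sum>j\<in>UNIV. a $ j *\<^sub>R D (axis j 1)) $ i = D a $ i" using linear_axis_sum[OF D(1)] by metis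
    then show ?thesis by simp
  qed
  define Q where "Q a = pr (D (pr a))" for a
  have Ql: "linear Q" unfolding Q_def[abs_def] using linear_compose[OF linear_compose[OF prl D(1)] prl] by (simp add: o_def)
  have eq2: "(\<Sum>i\<in>UNIV. \<Sum>j\<in>UNIV. projector A g c p v j \<sigma> * vgrad_up A F c j i ?x ?w * projector A g c p v \<epsilon> i)
     = Q (axis \<sigma> 1) $ \<epsilon>" for \<epsilon> \<sigma>
    by (simp add: D(2) sum_distrib_right[symmetric] P[of _ \<sigma>] Dax P' Q_def)
  define tr where "tr = (\<Sum>m\<in>UNIV. Q (axis m 1) $ m)"
  have eq2': "(\<Sum>i\<in>UNIV. \<Sum>j\<in>UNIV. \<Sum>m\<in>UNIV. projector A g c p v j m * vgrad_up A F c j i ?x ?w * projector A g c p v m i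
      / (real CARD('n) - 1) * projector A g c p v \<epsilon> \<sigma>) = tr / (real CARD('n) - 1) * pr (axis \<sigma> 1) $ \<epsilon>" for \<epsilon> \<sigma>
  proof -
    have "tr = (\<Sum>m\<in>UNIV. \<Sum>i\<in>UNIV. \<Sum>j\<in>UNIV. projector A g c p v j m * vgrad_up A F c j i ?x ?w * projector A g c p v m i)"
      by (simp add: tr_def eq2)
    also have "\<dots> = (\<Sum>i\<in>UNIV. \<Sum>m\<in>UNIV. \<Sum>j\<in>UNIV. projector A g c p v j m * vgrad_up A F c j i ?x ?w * projector A g c p v m i)"
      by (rule sum.swap)
    also have "\<dots> = (\<Sum>i\<in>UNIV. \<Sum>j\<in>UNIV. \<Sum>m\<in>UNIV. projector A g c p v j m * vgrad_up A F c j i ?x ?w * projector A g c p v m i)"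
      by (intro sum.cong refl sum.swap)
    finally show ?thesis by (simp add: P[of \<epsilon> \<sigma>] sum_distrib_right sum_divide_distrib)
  qed
  have E2: "(\<forall>\<epsilon> \<sigma>. Q (axis \<sigma> 1) $ \<epsilon> = tr / (real CARD('n) - 1) * pr (axis \<sigma> 1) $ \<epsilon>)
    \<longleftrightarrow> (\<exists>l. \<forall>a b. (G *v ?w) \<bullet> a = 0 \<longrightarrow> (G *v ?w) \<bullet> b = 0 \<longrightarrow> ?D a \<bullet> b = l * ((G *v a) \<bullet> b))" (is "?L \<longleftrightarrow> ?R")
  proof
    assume ?L
    then have ax: "Q (axis \<sigma> 1) = (tr / (real CARD('n) - 1)) *\<^sub>R pr (axis \<sigma> 1)" for \<sigma> by (simp add: vec_eq_iff)
    have Q: "Q a = (tr / (real CARD('n) - 1)) *\<^sub>R pr a" for a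
      by (rule linear_axis_eq[OF Ql linear_compose_scale_right[OF prl] ax])
    show ?R
    proof (intro exI[of _ "tr / (real CARD('n) - 1)"] allI impI)
      fix a b assume a: "(G *v ?w) \<bullet> a = 0" and b: "(G *v ?w) \<bullet> b = 0"
      have "?D a \<bullet> b = (G *v Q a) \<bullet> b" using prG[OF b, of "D a"] prid[OF a] by (simp add: D(3) Q_def)
      then show "?D a \<bullet> b = tr / (real CARD('n) - 1) * ((G *v a) \<bullet> b)"
        using prid[OF a] by (simp add: Q algebra_simps)
    qed
  next
    assume ?R
    then obtain l where l: "\<And>a b. (G *v ?w) \<bullet> a = 0 \<Longrightarrow> (G *v ?w) \<bullet> b = 0 \<Longrightarrow> ?D a \<bullet> b = l * ((G *v a) \<bullet> b)" by blast
    \<comment> \<open>The difference lies in the complement of v and is orthogonal to everything in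
      it, in particular to itself.\<close>
    have Q: "Q a = l *\<^sub>R pr a" for a
    proof (rule ccontr)
      let ?d = "Q a - l *\<^sub>R pr a"
      assume "Q a \<noteq> l *\<^sub>R pr a"
      then have "0 < (G *v ?d) \<bullet> ?d" unfolding G_def by (intro gm_pos[OF c(1) x]) simp
      moreover have d: "(G *v ?w) \<bullet> ?d = 0" using prp by (simp add: Q_def inner_diff_right)
      have "(G *v ?d) \<bullet> ?d = (G *v Q a) \<bullet> ?d - l * ((G *v pr a) \<bullet> ?d)" by (simp only: matrix_vector_mult_diff_distrib matrix_vector_mult_scaleR inner_diff_left inner_scaleR_left)
      moreover have "(G *v Q a) \<bullet> ?d = ?D (pr a) \<bullet> ?d" using prG[OF d, of "D (pr a)"] by (simp add: D(3) Q_def)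
      moreover have "?D (pr a) \<bullet> ?d = l * ((G *v pr a) \<bullet> ?d)" by (rule l[OF prp d])
      ultimately show False by linarith
    qed
    \<comment> \<open>The projector has trace n - 1. Hence the factor l is forced to be the trace
      divided by n - 1, as the second family prescribes.\<close>
    have "(\<Sum>m\<in>UNIV. pr (axis m 1) $ m) = real CARD('n) - 1"
    proof -
      have "(\<Sum>m\<in>UNIV. pr (axis m 1) $ m) = (\<Sum>m\<in>(UNIV::'n set). 1 - (G *v N) $ m * N $ m)"
        by (simp add: pr_def inner_axis)
      also have "\<dots> = real CARD('n) - (G *v N) \<bullet> N" by (simp add: sum_subtractf inner_vec_def)
      finally show ?thesis by (simp add: NN)
    qed
    then have "tr = l * (real CARD('n) - 1)" by (simp add: tr_def Q sum_distrib_left[symmetric])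
    then show ?L using n2 by (simp add: Q)
  qed
  show ?thesis
    unfolding Let_def N s_def[symmetric] eq1 eq1' eq2 eq2' compat_def G_def[symmetric] using E1 E2 by blast
qed

text \<open>The covariant derivative \<open>\<eta>' + \<Gamma>(a, \<eta>)\<close> of a unit normal \<open>\<eta>\<close> is tangent (Weingarten).\<close>

lemma weingarten:
  assumes c: "c \<in> A" "\<xi> 0 \<in> cim c" and \<xi>: "(\<xi> has_vector_derivative a) (at 0)"
    and \<eta>: "(\<eta> has_vector_derivative \<eta>') (at 0)" and b: "(b has_vector_derivative q) (at 0)"
    and J: "open J" "(0::real) \<in> J"
    and unit: "\<And>s. s \<in> J \<Longrightarrow> (gm c (\<xi> s) *v \<eta> s) \<bullet> \<eta> s = 1" and perp: "\<And>s. s \<in> J \<Longrightarrow> (gm c (\<xi> s) *v \<eta> s) \<bullet> b s = 0"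
  shows "(gm c (\<xi> 0) *v \<eta> 0) \<bullet> (\<eta>' + Gam c (\<xi> 0) a (\<eta> 0)) = 0"
    and "(gm c (\<xi> 0) *v (\<eta>' + Gam c (\<xi> 0) a (\<eta> 0))) \<bullet> b 0 = - ((gm c (\<xi> 0) *v \<eta> 0) \<bullet> (Gam c (\<xi> 0) a (b 0) + q))"
proof -
  let ?G = "gm c (\<xi> 0)"
  have gD: "((\<lambda>s. gm c (\<xi> s)) has_vector_derivative Dg c (\<xi> 0) a) (at 0)"
    by (rule has_vector_derivative_chain[OF \<xi> gm_has_derivative[OF c]])
  \<comment> \<open>The two claims come from differentiating the constant length of \<eta> and its
    constant product with b; \<open>koszul\<close> then trades the metric derivatives for
    Christoffel terms.\<close>
  have "((\<lambda>s. 1) has_vector_derivative (?G *v \<eta> 0) \<bullet> \<eta>' + (?G *v \<eta>' + Dg c (\<xi> 0) a *v \<eta> 0) \<bullet> \<eta> 0) (at 0)"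
    by (rule has_vector_derivative_transform_within_open[OF has_vector_derivative_inner[OF has_vector_derivative_mv[OF gD \<eta>] \<eta>] J unit])
  then have 1: "(?G *v \<eta> 0) \<bullet> \<eta>' + (?G *v \<eta>' + Dg c (\<xi> 0) a *v \<eta> 0) \<bullet> \<eta> 0 = 0"
    using vector_derivative_unique_at has_vector_derivative_const by blast
  have "((\<lambda>s. 0) has_vector_derivative (?G *v \<eta> 0) \<bullet> q + (?G *v \<eta>' + Dg c (\<xi> 0) a *v \<eta> 0) \<bullet> b 0) (at 0)"
    by (rule has_vector_derivative_transform_within_open[OF has_vector_derivative_inner[OF has_vector_derivative_mv[OF gD \<eta>] b] J perp])
  then have 2: "(?G *v \<eta> 0) \<bullet> q + (?G *v \<eta>' + Dg c (\<xi> 0) a *v \<eta> 0) \<bullet> b 0 = 0"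
    using vector_derivative_unique_at has_vector_derivative_const by blast
  note k = koszul[OF c]
  show "(?G *v \<eta> 0) \<bullet> (\<eta>' + Gam c (\<xi> 0) a (\<eta> 0)) = 0"
    using 1 k[of a "\<eta> 0" "\<eta> 0"] gm_sym[OF c, of "\<eta> 0" \<eta>'] gm_sym[OF c, of "\<eta> 0" "Gam c (\<xi> 0) a (\<eta> 0)"]
      Dg_sym[OF c, of "\<eta> 0" a "\<eta> 0"]
    by (simp add: inner_add_right inner_add_left)
  show "(?G *v (\<eta>' + Gam c (\<xi> 0) a (\<eta> 0))) \<bullet> b 0 = - ((?G *v \<eta> 0) \<bullet> (Gam c (\<xi> 0) a (b 0) + q))"
    using 2 k[of a "\<eta> 0" "b 0"] k[of a "b 0" "\<eta> 0"] gm_sym[OF c, of "\<eta> 0" "Gam c (\<xi> 0) a (b 0)"]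
      Dg_sym[OF c, of a "\<eta> 0" "b 0"] Dg_sym[OF c, of "\<eta> 0" a "b 0"] Dg_sym[OF c, of "b 0" a "\<eta> 0"]
    by (simp add: inner_add_right inner_add_left matrix_vector_right_distrib)
qed

text \<open>The prescribed derivative of \<nu> turns the velocity derivative of the force in
  direction \<eta> into the first summand of \<open>alpha\<close>, and the Christoffel terms of
  \<open>nabF\<close> complete \<eta>' to a covariant derivative. The curvature of the hypersurface
  thus enters explicitly through the last summand, via the derivative of its normal.\<close>

lemma force_along_curve:
  assumes c: "c \<in> A" "\<xi> 0 \<in> cim c" and \<xi>: "(\<xi> has_vector_derivative a) (at 0)"
    and \<eta>: "(\<eta> has_vector_derivative \<eta>') (at 0)" and b: "(b has_vector_derivative q) (at 0)"
    and \<nu>: "(\<nu> has_real_derivative - (Fd c (\<xi> 0) (\<nu> 0 *\<^sub>R \<eta> 0) \<bullet> a) / \<nu> 0) (at (0::real))" and \<nu>0: "\<nu> 0 \<noteq> 0"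
    and unit: "(gm c (\<xi> 0) *v \<eta> 0) \<bullet> \<eta> 0 = 1"
  shows "((\<lambda>s. Fd c (\<xi> s) (\<nu> s *\<^sub>R \<eta> s) \<bullet> b s) has_real_derivative
     - alpha c (\<xi> 0) (\<nu> 0 *\<^sub>R \<eta> 0) a (b 0) + Fd c (\<xi> 0) (\<nu> 0 *\<^sub>R \<eta> 0) \<bullet> (Gam c (\<xi> 0) a (b 0) + q)
     + \<nu> 0 * (DvF c (\<xi> 0) (\<nu> 0 *\<^sub>R \<eta> 0) (\<eta>' + Gam c (\<xi> 0) a (\<eta> 0)) \<bullet> b 0)) (at 0)"
proof -
  let ?w = "\<nu> 0 *\<^sub>R \<eta> 0" and ?x = "\<xi> 0"
  define \<nu>' where "\<nu>' = - (Fd c ?x ?w \<bullet> a) / \<nu> 0"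
  have \<nu>D: "(\<nu> has_vector_derivative \<nu>') (at 0)" using \<nu> by (simp add: \<nu>'_def has_real_derivative_iff_has_vector_derivative)
  have wD: "((\<lambda>s. \<nu> s *\<^sub>R \<eta> s) has_vector_derivative \<nu> 0 *\<^sub>R \<eta>' + \<nu>' *\<^sub>R \<eta> 0) (at 0)"
    by (rule bounded_bilinear.has_vector_derivative[OF bounded_bilinear_scaleR \<nu>D \<eta>])
  from has_vector_derivative_chain[OF has_vector_derivative_Pair[OF \<xi> wD] Fd_derivatives(3)[OF c]]
  have "((\<lambda>s. Fd c (\<xi> s) (\<nu> s *\<^sub>R \<eta> s)) has_vector_derivative DxF c ?x ?w a + DvF c ?x ?w (\<nu> 0 *\<^sub>R \<eta>' + \<nu>' *\<^sub>R \<eta> 0)) (at 0)"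
    by simp
  from has_vector_derivative_inner[OF this b]
  have D: "((\<lambda>s. Fd c (\<xi> s) (\<nu> s *\<^sub>R \<eta> s) \<bullet> b s) has_real_derivative
      Fd c ?x ?w \<bullet> q + (DxF c ?x ?w a + DvF c ?x ?w (\<nu> 0 *\<^sub>R \<eta>' + \<nu>' *\<^sub>R \<eta> 0)) \<bullet> b 0) (at 0)"
    by (simp add: has_real_derivative_iff_has_vector_derivative)
  note l = linear_add[OF DvF_linear[OF c]] linear_scale[OF DvF_linear[OF c]]
  have "(gm c ?x *v ?w) \<bullet> ?w = \<nu> 0 * \<nu> 0" using unit by (simp add: algebra_simps)
  then have al: "alpha c ?x ?w a (b 0) = - \<nu>' * (DvF c ?x ?w (\<eta> 0) \<bullet> b 0) - nabF c ?x ?w a (b 0)"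
    using \<nu>0 by (simp add: alpha_def \<nu>'_def l)
  have gw: "Gam c ?x a ?w = \<nu> 0 *\<^sub>R Gam c ?x a (\<eta> 0)" by (rule linear_scale[OF Gam_linear(1)])
  have "Fd c ?x ?w \<bullet> q + (DxF c ?x ?w a + DvF c ?x ?w (\<nu> 0 *\<^sub>R \<eta>' + \<nu>' *\<^sub>R \<eta> 0)) \<bullet> b 0
     = - alpha c ?x ?w a (b 0) + Fd c ?x ?w \<bullet> (Gam c ?x a (b 0) + q)
     + \<nu> 0 * (DvF c ?x ?w (\<eta>' + Gam c ?x a (\<eta> 0)) \<bullet> b 0)"
    unfolding al nabF_def gw l by (simp add: inner_commute algebra_simps inner_add_left inner_add_right)
  with D show ?thesis by simp
qed

end

section \<open>Necessity of the equations\<close>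

context manifold begin

text \<open>A shear in the direction of one coordinate turns the graph of a function of the other
  coordinates into a coordinate hyperplane and has an explicit inverse.\<close>

lemma shear_chart:
  fixes base L :: "real^'n" and q :: "real^'n \<Rightarrow> real^'n \<Rightarrow> real"
  assumes c: "c \<in> A" and L: "L $ i = 0" and q: "bounded_bilinear q"
    and q0: "\<And>z. q (axis i 1) z = 0" "\<And>z. q z (axis i 1) = 0"
  defines "\<psi> \<equiv> \<lambda>y. base + y + (L \<bullet> y + q y y / 2) *\<^sub>R axis i 1"
  obtains c' where "c' \<in> A" "cdom c' = cdom c" "\<And>p. p \<in> cdom c \<Longrightarrow> \<psi> (cmap c' p) = cmap c p"
    "\<And>p. cmap c p = base \<Longrightarrow> cmap c' p = 0"
    "\<And>y. y \<in> cim c' \<Longrightarrow> cinv c' y = cinv c (\<psi> y) \<and> \<psi> y \<in> cim c"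
proof -
  define h where "h y = L \<bullet> y + q y y / 2" for y
  define \<phi> where "\<phi> x = (x - base) - h (x - base) *\<^sub>R axis i 1" for x
  note qlin = bounded_bilinear.add_left[OF q] bounded_bilinear.add_right[OF q]
    bounded_bilinear.scaleR_left[OF q] bounded_bilinear.scaleR_right[OF q]
    bounded_bilinear.zero_left[OF q] bounded_bilinear.diff_left[OF q] bounded_bilinear.diff_right[OF q]
  \<comment> \<open>h ignores the i-th coordinate, the only one that the shear changes; therefore
    adding and subtracting the value of h are inverse operations.\<close>
  have hi: "h (y + t *\<^sub>R axis i 1) = h y" for y t
    using L q0 by (simp add: h_def qlin inner_add_right inner_axis)
  have hi': "h (y - t *\<^sub>R axis i 1) = h y" for y t using hi[of y "- t"] by simp
  have \<psi>h: "\<psi> y = base + y + h y *\<^sub>R axis i 1" for y by (simp add: \<psi>_def h_def)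
  have inv: "\<psi> (\<phi> x) = x" "\<phi> (\<psi> y) = y" for x y
    by (simp_all add: \<psi>h \<phi>_def hi hi' add.commute[of base])
  have hs: "Ck_on k UNIV h" for k
    unfolding h_def[abs_def] divide_inverse
    by (intro Ck_on_add Ck_on_mult Ck_on_inner Ck_on_bilinear[OF q] Ck_on_const Ck_on_id open_UNIV)
  have \<psi>s: "Ck_on k UNIV \<psi>" for k
    unfolding \<psi>h[abs_def] by (intro Ck_on_add Ck_on_scaleR Ck_on_const Ck_on_id open_UNIV hs)
  have \<phi>s: "Ck_on k UNIV \<phi>" for k
    unfolding \<phi>_def[abs_def]
    by (intro Ck_on_diff Ck_on_scaleR Ck_on_const Ck_on_id open_UNIV Ck_on_compose[OF open_UNIV open_UNIV _ hs]) auto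
  define c' where "c' = \<lparr>cdom = cdom c \<inter> UNIV, cmap = \<phi> \<circ> cmap c\<rparr>"
  note m = chart_modify[OF c open_UNIV smooth_onI[OF \<phi>s] smooth_onI[OF \<psi>s] inv, folded c'_def]
  show ?thesis
  proof (rule that[OF m(1)])
    show "cdom c' = cdom c" by (simp add: c'_def)
    show "\<psi> (cmap c' p) = cmap c p" for p by (simp add: c'_def inv)
    show "cmap c' p = 0" if "cmap c p = base" for p
      using that by (simp add: c'_def \<phi>_def h_def qlin)
    show "cinv c' y = cinv c (\<psi> y) \<and> \<psi> y \<in> cim c" if "y \<in> cim c'" for y using m(2)[OF that] .
  qed
qed

end

context riemannian begin

text \<open>With \<sigma> equal to 1 or -1 this reverses a normal field, so that the normal can be
  oriented along a given velocity.\<close>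

lemma unit_normal_field_scale:
  assumes n: "unit_normal_field A g S n" and \<sigma>: "\<sigma> * \<sigma> = 1"
  shows "unit_normal_field A g S (\<lambda>p d. \<sigma> *\<^sub>R n p d)"
proof -
  have sc: "g p (\<lambda>d. \<sigma> *\<^sub>R u d) w = \<sigma> * g p u w" if "u \<in> tangent_space A p" "w \<in> tangent_space A p" for p u w
    using metric_comb[OF that(1) that(1) that(2), of \<sigma> 0] by simp
  show ?thesis
    unfolding unit_normal_field_def
  proof (intro conjI ballI allI impI)
    fix p assume p: "p \<in> S"
    have nT: "n p \<in> tangent_space A p" "g p (n p) (n p) = 1" "\<And>w. w \<in> tangent_to A S p \<Longrightarrow> g p (n p) w = 0"
      using n p unfolding unit_normal_field_def by blast+
    show T: "(\<lambda>d. \<sigma> *\<^sub>R n p d) \<in> tangent_space A p" by (rule tangent_space_scaleR[OF nT(1)])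
    show "g p (\<lambda>d. \<sigma> *\<^sub>R n p d) (\<lambda>d. \<sigma> *\<^sub>R n p d) = 1"
      by (simp add: sc[OF nT(1) T] metric_sym[OF nT(1) T] sc[OF nT(1) nT(1)] nT(2) \<sigma>)
    show "g p (\<lambda>d. \<sigma> *\<^sub>R n p d) w = 0" if "w \<in> tangent_to A S p" for w
      using sc[OF nT(1), of w] nT(3)[OF that] that by (simp add: tangent_to_def)
  next
    fix c i assume c: "slice_chart A S c i"
    have U: "open {x. zero_coord i x \<in> cim c}" by (intro open_zero_coord chartD slice_chartD[OF c])
    have "smooth_in_slice c i (\<lambda>p. n p c)" using n c unfolding unit_normal_field_def by blast
    then show "smooth_in_slice c i (\<lambda>p. \<sigma> *\<^sub>R n p c)"
      unfolding smooth_in_slice_def smooth_on_def by (auto intro!: Ck_on_scaleR Ck_on_const U)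
  qed
qed

end

context newtonian begin

lemma normality_pfaff:
  assumes c: "slice_chart A S c i" and k: "k \<noteq> i" and p: "p \<in> S" "p \<in> cdom c"
    and n: "unit_normal_field A g S n" and \<nu>: "smooth_function_on A S \<nu>" and f: "is_shift A g F S n \<nu> \<delta> f"
    and dev: "(deviation A g f c k p has_real_derivative 0) (at 0)"
  shows "\<nu> p * frechet_derivative (\<lambda>x. \<nu> (cinv c (zero_coord i x))) (at (cmap c p)) (axis k 1)
      = - g p (F p (\<lambda>d. \<nu> p *\<^sub>R n p d)) (tvec_of A c p (axis k 1))"
  using DERIV_unique[OF dev deviation_derivative[OF c k p n \<nu> f]] by simp

text \<open>The test hypersurface passes through p orthogonally to w and is curved so that the
  covariant derivative of its unit normal in direction y is (a0|y) a0. The integrability of the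
  Pfaff system at p then says that the displayed form is symmetric in a and b.\<close>

lemma normality_second_order:
  assumes AN: "additional_normality A g F" and c: "c \<in> A" "p \<in> cdom c"
    and v: "v \<in> tangent_space A p" "v c \<noteq> 0"
  defines "x0 \<equiv> cmap c p" and "w \<equiv> v c"
  assumes a0: "(gm c x0 *v w) \<bullet> a0 = 0" and a: "(gm c x0 *v w) \<bullet> a = 0" and b: "(gm c x0 *v w) \<bullet> b = 0"
  defines "s \<equiv> sqrt ((gm c x0 *v w) \<bullet> w)"
  shows "- alpha c x0 w a b + s * (((gm c x0 *v a0) \<bullet> a) * (DvF c x0 w a0 \<bullet> b))
       = - alpha c x0 w b a + s * (((gm c x0 *v a0) \<bullet> b) * (DvF c x0 w a0 \<bullet> a))"
proof -
  have x0c: "x0 \<in> cim c" using c by (simp add: x0_def)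
  define G where "G = gm c x0"
  define W where "W = G *v w"
  have pos: "0 < W \<bullet> w" unfolding W_def G_def w_def by (rule gm_pos[OF c(1) x0c v(2)])
  have s: "0 < s" "s * s = W \<bullet> w" using pos by (simp_all add: s_def W_def G_def)
  have Gs: "(G *v a) \<bullet> b = (G *v b) \<bullet> a" for a b unfolding G_def by (rule gm_sym[OF c(1) x0c])
  \<comment> \<open>A coordinate direction transverse to the complement of w, which is thereby a
    graph over the other coordinates.\<close>
  obtain i where i: "W $ i \<noteq> 0" using pos by (metis inner_zero_left less_irrefl vec_eq_iff zero_index)
  \<comment> \<open>The slopes of that graph; \<tau> lifts a vector with vanishing i-th coordinate
    to the complement of w, and \<open>?z\<close> is the inverse of the lift.\<close>
  define L where "L = (\<chi> k. if k = i then 0 else - W $ k / W $ i)"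
  define \<tau> where "\<tau> y = y + (L \<bullet> y) *\<^sub>R axis i 1" for y
  have \<tau>l: "linear \<tau>" by (rule linearI) (auto simp: \<tau>_def inner_add_right algebra_simps)
  have LW: "L \<bullet> y = y $ i - (W \<bullet> y) / W $ i" for y
  proof -
    have "L \<bullet> y = (\<Sum>k\<in>UNIV. (if k = i then y $ i else 0) - W $ k * y $ k / W $ i)"
      unfolding inner_vec_def L_def by (rule sum.cong) (use i in auto)
    then show ?thesis by (simp add: sum_subtractf sum_divide_distrib inner_vec_def)
  qed
  have W\<tau>: "W \<bullet> \<tau> (axis k 1) = 0" if "k \<noteq> i" for k
  proof -
    have "axis k (1::real) $ i = 0" using that by (simp add: axis_def)
    then show ?thesis
      using i unfolding \<tau>_def inner_add_right inner_scaleR_right LW by (simp add: inner_axis)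
  qed
  let ?z = "zero_coord i :: real^'n \<Rightarrow> real^'n"
  have \<tau>z: "\<tau> (?z y) = y" if "W \<bullet> y = 0" for y
  proof -
    have "L \<bullet> ?z y = L \<bullet> y" unfolding inner_vec_def by (rule sum.cong) (auto simp: zero_coord_nth L_def)
    then have "\<tau> (?z y) = ?z y + y $ i *\<^sub>R axis i 1" using that by (simp add: \<tau>_def LW)
    then show ?thesis by (simp add: vec_eq_iff zero_coord_nth axis_def)
  qed
  have zax: "?z (axis k 1) = (if k = i then 0 else axis k 1)" for k
    by (simp add: vec_eq_iff zero_coord_nth axis_def)
  \<comment> \<open>By \<open>weingarten\<close> the covariant derivative D of the normal satisfies
    (D|\<tau> z) = - (W . Gam + \<kappa> W_i) / s, where Gam is taken at \<tau> y and \<tau> z. The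
    value of \<kappa> solves this for the desired right-hand side (a0|\<tau> y) (a0|\<tau>
    z).\<close>
  define \<kappa> where "\<kappa> y z = - (s / W $ i) * (((G *v a0) \<bullet> \<tau> y) * ((G *v a0) \<bullet> \<tau> z) + (W \<bullet> Gam c x0 (\<tau> y) (\<tau> z)) / s)" for y z
  \<comment> \<open>Composition with \<open>?z\<close> makes the form independent of the i-th
    coordinate, as \<open>shear_chart\<close> requires.\<close>
  define q where "q y z = \<kappa> (?z y) (?z z)" for y z
  note ll = linear_add[OF \<tau>l] linear_scale[OF \<tau>l] linear_add[OF zero_coord_linear] linear_scale[OF zero_coord_linear]
    linear_add[OF Gam_linear(1)] linear_add[OF Gam_linear(2)] linear_scale[OF Gam_linear(1)] linear_scale[OF Gam_linear(2)]
  have qb: "bounded_bilinear q"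
    unfolding bilinear_conv_bounded_bilinear[symmetric] bilinear_def
    by (intro conjI allI linearI) (simp_all add: q_def \<kappa>_def ll inner_add_right add_divide_distrib algebra_simps)
  have qs: "q y z = q z y" for y z by (simp add: q_def \<kappa>_def Gam_sym[OF c(1) x0c, of "\<tau> (?z y)"] mult.commute)
  have q0: "q (axis i 1) z = 0" "q z (axis i 1) = 0" for z
    by (simp_all add: q_def \<kappa>_def zax linear_0[OF \<tau>l] linear_0[OF Gam_linear(1)] linear_0[OF Gam_linear(2)])
  note qlin = bounded_bilinear.add_left[OF qb] bounded_bilinear.add_right[OF qb]
    bounded_bilinear.scaleR_left[OF qb] bounded_bilinear.scaleR_right[OF qb] bounded_bilinear.zero_left[OF qb]
  define \<psi> where "\<psi> y = x0 + y + (L \<bullet> y + q y y / 2) *\<^sub>R axis i 1" for y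
  define D\<psi> where "D\<psi> y z = z + (L \<bullet> z + q y z) *\<^sub>R axis i 1" for y z
  have \<psi>D: "(\<psi> has_derivative D\<psi> y) (at y)" for y
  proof -
    have "((\<lambda>y. q y y) has_derivative (\<lambda>z. q y z + q z y)) (at y)"
      by (rule bounded_bilinear.FDERIV[OF qb]) (rule has_derivative_ident)+
    from bounded_linear.has_derivative[OF bounded_linear_divide this]
    have "(\<psi> has_derivative (\<lambda>z. 0 + z + (L \<bullet> z + (q y z + q z y) / 2) *\<^sub>R axis i 1)) (at y)"
      unfolding \<psi>_def[abs_def]
      by (intro has_derivative_add has_derivative_const has_derivative_ident has_derivative_scaleR_left
          bounded_linear.has_derivative[OF bounded_linear_inner_right])
    then show ?thesis by (simp add: D\<psi>_def[abs_def] qs[of _ y])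
  qed
  have Li: "L $ i = 0" by (simp add: L_def)
  obtain c' where c': "c' \<in> A" "cdom c' = cdom c" "\<And>r. r \<in> cdom c \<Longrightarrow> \<psi> (cmap c' r) = cmap c r"
    "\<And>r. cmap c r = x0 \<Longrightarrow> cmap c' r = 0"
    "\<And>y. y \<in> cim c' \<Longrightarrow> cinv c' y = cinv c (\<psi> y) \<and> \<psi> y \<in> cim c"
    using shear_chart[OF c(1) Li qb q0, where base = x0, folded \<psi>_def] by blast
  \<comment> \<open>The graph with slopes L and quadratic part q / 2, described in the sheared chart
    as a coordinate hyperplane.\<close>
  define S where "S = {r \<in> cdom c. cmap c' r $ i = 0}"
  have Ss: "slice_chart A S c' i" by (rule slice_chartI[OF c'(1)]) (simp add: S_def c'(2))
  have S: "hypersurface A S" unfolding hypersurface_def using Ss c'(2) by (auto simp: S_def)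
  have c'p: "cmap c' p = 0" using c'(4)[of p] by (simp add: x0_def)
  have pS: "p \<in> S" using c c'p by (simp add: S_def)
  obtain S' n0 where S': "S' \<subseteq> S" "p \<in> S'" "transformation_class A S'" "unit_normal_field A g S' n0"
    and all: "\<And>n. unit_normal_field A g S' n \<Longrightarrow>
           (\<exists>\<nu>. transformation_function A S' \<nu> \<and> \<nu> p = s \<and>
             (\<exists>\<delta> f. is_shift A g F S' n \<nu> \<delta> f \<and>
               (\<forall>c i k p. slice_chart A S' c i \<and> k \<noteq> i \<and> p \<in> S' \<inter> cdom c \<longrightarrow>
                 (deviation A g f c k p has_real_derivative 0) (at 0))))"
    using AN[unfolded additional_normality_def, rule_format, of S p s] S pS s(1) by auto
  have hS': "hypersurface A S'" using S'(3) unfolding transformation_class_def by blast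
  \<comment> \<open>Near p the piece S' is all of S, so the sheared chart restricted to X is a slice
    chart of S' as well.\<close>
  obtain X where X: "open X" "p \<in> X" "S' \<inter> X = S \<inter> X" using hypersurface_subset_open[OF hS' S S'(1,2)] by blast
  define e where "e = restrict_chart c' X"
  have es: "slice_chart A S' e i" unfolding e_def by (rule slice_restrict[OF Ss X(1,3)])
  note eA = slice_chartD[OF es]
  have edom: "cdom e = cdom c \<inter> X" and emap: "cmap e = cmap c'" by (simp_all add: e_def c'(2))
  have pe: "p \<in> cdom e" "cmap e p = 0" using X(2) c c'p by (simp_all add: edom emap)
  have einv: "cinv e y = cinv c (\<psi> y)" "\<psi> y \<in> cim c" if "y \<in> cim e" for y
    using restrict_chart(2)[OF c'(1) X(1), of y] c'(5)[of y] that by (auto simp: e_def)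
  have cinve: "(cmap c \<circ> cinv e) y = \<psi> y" if "y \<in> cim e" for y using einv[OF that] cmap_cinv[OF c(1)] by simp
  have TDe: "TD e c r = D\<psi> (cmap e r)" if "r \<in> cdom e" for r
  proof (rule TD_unique[OF eA c(1) that])
    show "r \<in> cdom c" using that by (simp add: edom)
    show "((cmap c \<circ> cinv e) has_derivative D\<psi> (cmap e r)) (at (cmap e r))"
      by (rule has_derivative_transform_within_open[OF \<psi>D chartD(2)[OF eA]]) (use that cinve in auto)
  qed
  have D\<psi>0: "D\<psi> 0 z = \<tau> z" for z by (simp add: D\<psi>_def \<tau>_def qlin)
  have \<psi>0: "\<psi> 0 = x0" by (simp add: \<psi>_def qlin)
  have nT0: "n0 p \<in> tangent_space A p" "g p (n0 p) (n0 p) = 1" "\<And>u. u \<in> tangent_to A S' p \<Longrightarrow> g p (n0 p) u = 0"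
    using S'(2,4) unfolding unit_normal_field_def by blast+
  have perpn: "(G *v n0 p c) \<bullet> y = 0" if y: "W \<bullet> y = 0" for y
  proof -
    have "tvec_of A e p (?z y) \<in> tangent_to A S' p"
      by (rule tangent_to_slice[OF es S'(2) pe(1)]) (simp add: zero_coord_nth)
    moreover have "tvec_of A e p (?z y) = tvec_of A c p y"
      using tvec_of_change[OF eA pe(1) c, of "?z y"] by (simp add: TDe pe D\<psi>0 \<tau>z[OF y])
    ultimately show ?thesis
      using nT0(3) metric_chart[OF c nT0(1) tvec_of_in[OF c, of y]] by (simp add: tvec_of_self c G_def x0_def)
  qed
  define \<theta> where "\<theta> = (W \<bullet> n0 p c) / (W \<bullet> w)"
  have n0w: "n0 p c = \<theta> *\<^sub>R w"
  proof (rule ccontr)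
    let ?d = "n0 p c - \<theta> *\<^sub>R w"
    assume "n0 p c \<noteq> \<theta> *\<^sub>R w"
    then have "0 < (G *v ?d) \<bullet> ?d" unfolding G_def by (intro gm_pos[OF c(1) x0c]) simp
    moreover have d: "W \<bullet> ?d = 0" using pos by (simp add: \<theta>_def inner_diff_right)
    have "(G *v ?d) \<bullet> ?d = (G *v n0 p c) \<bullet> ?d - \<theta> * (W \<bullet> ?d)"
      by (simp only: W_def matrix_vector_mult_diff_distrib matrix_vector_mult_scaleR inner_diff_left inner_scaleR_left)
    ultimately show False using perpn[OF d] d by simp
  qed
  have \<theta>s: "(\<theta> * s) * (\<theta> * s) = 1"
  proof -
    have "(G *v n0 p c) \<bullet> n0 p c = 1" using nT0(2) metric_chart[OF c nT0(1) nT0(1)] by (simp add: G_def x0_def)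
    then show ?thesis using s(2) by (simp add: n0w W_def algebra_simps)
  qed
  \<comment> \<open>The sign is chosen such that n p = w / s. Together with the initial value s of
    \<nu> this makes the initial velocity at p exactly w.\<close>
  define n where "n = (\<lambda>p d. (\<theta> * s) *\<^sub>R n0 p d)"
  have n: "unit_normal_field A g S' n" unfolding n_def by (rule unit_normal_field_scale[OF S'(4) \<theta>s])
  have npw: "n p c = (1 / s) *\<^sub>R w"
    using \<theta>s s(1) by (simp add: n_def n0w divide_simps)
  obtain \<nu> \<delta> f where \<nu>: "transformation_function A S' \<nu>" "\<nu> p = s" and f: "is_shift A g F S' n \<nu> \<delta> f"
    and dev: "\<And>c i k p. slice_chart A S' c i \<Longrightarrow> k \<noteq> i \<Longrightarrow> p \<in> S' \<Longrightarrow> p \<in> cdom c \<Longrightarrow> (deviation A g f c k p has_real_derivative 0) (at 0)"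
    using all[OF n] by blast
  have \<nu>s: "smooth_function_on A S' \<nu>" by (rule transformation_function_smooth[OF hS' \<nu>(1)])
  define \<nu>' where "\<nu>' y = \<nu> (cinv e (?z y))" for y
  define U where "U = {y. ?z y \<in> cim e}"
  have U: "open U" unfolding U_def by (intro open_zero_coord chartD eA)
  have \<nu>'s: "Ck_on k U \<nu>'" for k
    using \<nu>s es unfolding smooth_function_on_def smooth_in_slice_def U_def \<nu>'_def[abs_def] smooth_on_def by blast
  have eim: "0 \<in> cim e" using pe by (metis imageI)
  have nr: "n r \<in> tangent_space A r" "g r (n r) (n r) = 1" "\<And>u. u \<in> tangent_to A S' r \<Longrightarrow> g r (n r) u = 0" if "r \<in> S'" for r
    using n that unfolding unit_normal_field_def by blast+
  define \<eta> where "\<eta> y = n (cinv e y) c" for y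
  have slice: "cinv e y \<in> S'" "cinv e y \<in> cdom e" "cinv e y \<in> cdom c" "cmap e (cinv e y) = y" "cmap c (cinv e y) = \<psi> y"
    if "y \<in> cim e" "y $ i = 0" for y
    using slice_point[OF es that] cmap_cinv[OF eA that(1)] cinve[OF that(1)] by (auto simp: edom)
  have pf: "\<nu>' y * frechet_derivative \<nu>' (at y) (axis k 1) = - (Fd c (\<psi> y) (\<nu>' y *\<^sub>R \<eta> y) \<bullet> D\<psi> y (axis k 1))"
    if y: "y \<in> cim e" "y $ i = 0" and k: "k \<noteq> i" for y k
  proof -
    note sl = slice[OF y]
    let ?r = "cinv e y"
    have zy: "?z y = y" by (rule zero_coord_id[OF y(2)])
    have T: "(\<lambda>d. \<nu> ?r *\<^sub>R n ?r d) \<in> tangent_space A ?r" by (rule tangent_space_scaleR[OF nr(1)[OF sl(1)]])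
    have te: "tvec_of A e ?r (axis k 1) = tvec_of A c ?r (D\<psi> y (axis k 1))"
      using tvec_of_change[OF eA sl(2) c(1) sl(3), of "axis k 1"] by (simp add: TDe[OF sl(2)] sl(4))
    have "g ?r (F ?r (\<lambda>d. \<nu> ?r *\<^sub>R n ?r d)) (tvec_of A e ?r (axis k 1)) = Fd c (\<psi> y) (\<nu>' y *\<^sub>R \<eta> y) \<bullet> D\<psi> y (axis k 1)"
      unfolding te using metric_chart[OF c(1) sl(3) force_in[OF T] tvec_of_in[OF c(1) sl(3)], of "D\<psi> y (axis k 1)"]
        force_chart[OF c(1) sl(3) T]
      by (simp add: tvec_of_self c sl force_down_def \<nu>'_def \<eta>_def zy)
    then show ?thesis
      using normality_pfaff[OF es k sl(1,2) n \<nu>s f dev[OF es k sl(1,2)]] by (simp add: sl(4) \<nu>'_def[abs_def] zy)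
  qed
  have cinv0: "cinv e 0 = p" using cinv_cmap[OF eA pe(1)] pe(2) by simp
  have \<nu>'0: "\<nu>' 0 = s" using \<nu>(2) by (simp add: \<nu>'_def zero_coord_id cinv0)
  have \<eta>0: "\<eta> 0 = (1 / s) *\<^sub>R w" using npw by (simp add: \<eta>_def cinv0)
  have we: "\<nu>' 0 *\<^sub>R \<eta> 0 = w" using s by (simp add: \<nu>'0 \<eta>0)
  let ?D\<nu> = "\<lambda>y z. frechet_derivative \<nu>' (at y) z"
  text \<open>By the symmetry of second derivatives the right-hand side is symmetric in \<open>l\<close> and \<open>k\<close>.\<close>
  have key: "- alpha c x0 w (\<tau> (axis l 1)) (\<tau> (axis k 1)) + Fd c x0 w \<bullet> (Gam c x0 (\<tau> (axis l 1)) (\<tau> (axis k 1)) + q (axis l 1) (axis k 1) *\<^sub>R axis i 1)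
      + s * (((G *v a0) \<bullet> \<tau> (axis l 1)) * (DvF c x0 w a0 \<bullet> \<tau> (axis k 1)))
      = - (?D\<nu> 0 (axis l 1) * ?D\<nu> 0 (axis k 1) + s * D2f \<nu>' 0 (axis l 1) (axis k 1))"
    if l: "l \<noteq> i" and k: "k \<noteq> i" for l k
  proof -
    let ?l = "axis l 1 :: real^'n" and ?k = "axis k 1 :: real^'n"
    define \<xi> where "\<xi> t = \<psi> (t *\<^sub>R ?l)" for t
    obtain J where J: "open J" "(0::real) \<in> J" "\<And>t. t \<in> J \<Longrightarrow> t *\<^sub>R ?l \<in> cim e"
      using line_near[OF chartD(2)[OF eA] eim, of ?l] by auto
    have ti: "(t *\<^sub>R ?l) $ i = 0" for t using l by (simp add: axis_def)
    have atJ: "at 0 within J = at 0" using at_within_open[OF J(2,1)] .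
    have lineD: "((\<lambda>t. t *\<^sub>R ?l) has_vector_derivative ?l) (at t within T)" for t T
      by (auto intro!: derivative_eq_intros)
    have \<xi>0: "\<xi> 0 = x0" by (simp add: \<xi>_def \<psi>0)
    have \<xi>D: "(\<xi> has_vector_derivative \<tau> ?l) (at 0)"
      unfolding \<xi>_def[abs_def] using has_vector_derivative_chain[OF lineD \<psi>D] D\<psi>0 by (metis scaleR_zero_left)
    have bD: "((\<lambda>t. D\<psi> (t *\<^sub>R ?l) ?k) has_vector_derivative q ?l ?k *\<^sub>R axis i 1) (at 0)"
      unfolding D\<psi>_def qlin by (auto intro!: derivative_eq_intros)
    \<comment> \<open>The normal is known to be differentiable along the slice in its components in
      e; those in c follow by applying the Jacobian of the transition map, itself varying along the
      line.\<close>
    obtain \<eta>' where \<eta>D: "((\<lambda>t. \<eta> (t *\<^sub>R ?l)) has_vector_derivative \<eta>') (at 0)"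
    proof -
      let ?T = "cmap c \<circ> cinv e"
      have "smooth_in_slice e i (\<lambda>r. n r e)" using n es unfolding unit_normal_field_def by blast
      from slice_derivative[OF es this S'(2) pe(1), of ?l] l
      obtain m where m: "((\<lambda>t. n (cinv e (t *\<^sub>R ?l)) e) has_vector_derivative m) (at 0)"
        by (auto simp: pe axis_def)
      have Ue: "cmap e ` (cdom e \<inter> cdom c) = cim e" by (simp add: edom Int_ac)
      have "Ck_on 2 (cim e) ?T" using smooth_onD[OF smooth_transition[OF eA c(1)]] unfolding Ue .
      from has_vector_derivative_D2f[OF chartD(2)[OF eA] this, of "\<lambda>t. t *\<^sub>R ?l" 0 ?l J, OF _ lineD m[folded atJ] J(3,2)]
      obtain d where d: "((\<lambda>t. frechet_derivative ?T (at (t *\<^sub>R ?l)) (n (cinv e (t *\<^sub>R ?l)) e)) has_vector_derivative d) (at 0)"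
        using eim unfolding atJ by auto
      have "((\<lambda>t. \<eta> (t *\<^sub>R ?l)) has_vector_derivative d) (at 0)"
      proof (rule has_vector_derivative_transform_within_open[OF d J(1,2)])
        fix t assume "t \<in> J"
        note sl = slice[OF J(3)[OF this] ti]
        show "frechet_derivative ?T (at (t *\<^sub>R ?l)) (n (cinv e (t *\<^sub>R ?l)) e) = \<eta> (t *\<^sub>R ?l)"
          unfolding \<eta>_def using tangent_spaceD[OF nr(1)[OF sl(1)] eA sl(2)] tvec_of_apply[OF c(1) sl(3), of e]
          by (simp add: TD_def sl(4)) metis
      qed
      then show ?thesis by (rule that)
    qed
    have \<nu>D: "((\<lambda>t. \<nu>' (t *\<^sub>R ?l)) has_vector_derivative ?D\<nu> 0 ?l) (at 0)"
    proof (rule has_vector_derivative_chain[OF lineD])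
      show "(\<nu>' has_derivative frechet_derivative \<nu>' (at 0)) (at (0 *\<^sub>R ?l))"
        using Ck_on_Suc_has_derivative[OF \<nu>'s, of 0] eim by (simp add: U_def zero_coord_id)
    qed
    have unit: "(gm c (\<xi> t) *v \<eta> (t *\<^sub>R ?l)) \<bullet> \<eta> (t *\<^sub>R ?l) = 1" if "t \<in> J" for t
    proof -
      note sl = slice[OF J(3)[OF that] ti]
      show ?thesis using metric_chart[OF c(1) sl(3) nr(1)[OF sl(1)] nr(1)[OF sl(1)]] nr(2)[OF sl(1)]
        by (simp add: sl(5) \<xi>_def \<eta>_def)
    qed
    have perp: "(gm c (\<xi> t) *v \<eta> (t *\<^sub>R ?l)) \<bullet> D\<psi> (t *\<^sub>R ?l) (axis m 1) = 0" if "m \<noteq> i" "t \<in> J" for t m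
    proof -
      let ?m = "axis m 1 :: real^'n"
      note sl = slice[OF J(3)[OF that(2)] ti]
      have "tvec_of A e (cinv e (t *\<^sub>R ?l)) ?m \<in> tangent_to A S' (cinv e (t *\<^sub>R ?l))"
        by (rule tangent_to_slice[OF es sl(1,2)]) (use that in \<open>simp add: axis_def\<close>)
      moreover have "tvec_of A e (cinv e (t *\<^sub>R ?l)) ?m = tvec_of A c (cinv e (t *\<^sub>R ?l)) (D\<psi> (t *\<^sub>R ?l) ?m)"
        using tvec_of_change[OF eA sl(2) c(1) sl(3), of ?m] by (simp add: TDe[OF sl(2)] sl(4))
      ultimately show ?thesis
        using nr(3)[OF sl(1)] metric_chart[OF c(1) sl(3) nr(1)[OF sl(1)] tvec_of_in[OF c(1) sl(3)], of "D\<psi> (t *\<^sub>R ?l) ?m"]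
        by (simp add: tvec_of_self c sl \<xi>_def \<eta>_def)
    qed
    \<comment> \<open>The covariant derivative of the normal. By D1 it is tangent, and by D2 its
      products with the tangent vectors are those of (a0|\<tau> l) a0; the metric then identifies
      the two vectors in \<open>Dv\<close>.\<close>
    define D where "D = \<eta>' + Gam c x0 (\<tau> ?l) (\<eta> 0)"
    have "(G *v \<eta> 0) \<bullet> D = 0"
      using weingarten(1)[of c \<xi> "\<tau> ?l" "\<lambda>t. \<eta> (t *\<^sub>R ?l)" \<eta>' _ _ J, OF c(1) _ \<xi>D \<eta>D bD J(1,2) unit perp[OF k]] x0c
      by (simp add: \<xi>0 D_def G_def)
    then have D1: "W \<bullet> D = 0" using s(1) by (simp add: \<eta>0 W_def matrix_vector_mult_scaleR)
    have D2: "(G *v D) \<bullet> \<tau> (axis m 1) = ((G *v a0) \<bullet> \<tau> ?l) * ((G *v a0) \<bullet> \<tau> (axis m 1))" if m: "m \<noteq> i" for m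
    proof -
      let ?m = "axis m 1 :: real^'n"
      have mD: "((\<lambda>t. D\<psi> (t *\<^sub>R ?l) ?m) has_vector_derivative q ?l ?m *\<^sub>R axis i 1) (at 0)"
        unfolding D\<psi>_def qlin by (auto intro!: derivative_eq_intros)
      have "(G *v D) \<bullet> \<tau> ?m = - ((G *v \<eta> 0) \<bullet> (Gam c x0 (\<tau> ?l) (\<tau> ?m) + q ?l ?m *\<^sub>R axis i 1))"
        using weingarten(2)[of c \<xi> "\<tau> ?l" "\<lambda>t. \<eta> (t *\<^sub>R ?l)" \<eta>' _ _ J, OF c(1) _ \<xi>D \<eta>D mD J(1,2) unit perp[OF m]] x0c
        by (simp add: \<xi>0 D_def D\<psi>0 G_def)
      then have "(G *v D) \<bullet> \<tau> ?m = - ((1 / s) * (W \<bullet> (Gam c x0 (\<tau> ?l) (\<tau> ?m) + q ?l ?m *\<^sub>R axis i 1)))"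
        by (simp add: \<eta>0 W_def matrix_vector_mult_scaleR)
      also have "W \<bullet> (Gam c x0 (\<tau> ?l) (\<tau> ?m) + q ?l ?m *\<^sub>R axis i 1)
          = W \<bullet> Gam c x0 (\<tau> ?l) (\<tau> ?m) + q ?l ?m * W $ i"
        by (simp add: inner_add_right inner_axis)
      also have "q ?l ?m * W $ i = - s * (((G *v a0) \<bullet> \<tau> ?l) * ((G *v a0) \<bullet> \<tau> ?m)) - W \<bullet> Gam c x0 (\<tau> ?l) (\<tau> ?m)"
        using i s(1) l m by (simp add: q_def \<kappa>_def zax field_simps)
      finally show ?thesis using s(1) by simp
    qed
    have Dv: "D = ((G *v a0) \<bullet> \<tau> ?l) *\<^sub>R a0"
    proof (rule ccontr)
      let ?d = "D - ((G *v a0) \<bullet> \<tau> ?l) *\<^sub>R a0"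
      assume "D \<noteq> ((G *v a0) \<bullet> \<tau> ?l) *\<^sub>R a0"
      then have "0 < (G *v ?d) \<bullet> ?d" unfolding G_def by (intro gm_pos[OF c(1) x0c]) simp
      moreover have d: "W \<bullet> ?d = 0" using D1 a0 by (simp add: inner_diff_right W_def G_def)
      have "(G *v ?d) \<bullet> \<tau> (?z y) = 0" for y
      proof (rule linear_axis_eq[of "\<lambda>y. (G *v ?d) \<bullet> \<tau> (?z y)" "\<lambda>_. 0"])
        show "linear (\<lambda>y. (G *v ?d) \<bullet> \<tau> (?z y))" by (rule linearI) (simp_all add: ll inner_add_right)
        show "(G *v ?d) \<bullet> \<tau> (?z (axis m 1)) = 0" for m
          using D2[of m] by (simp add: zax linear_0[OF \<tau>l] matrix_vector_mult_diff_distrib matrix_vector_mult_scaleR inner_diff_left)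
      qed (rule linear_zero)
      from this[of ?d] have "(G *v ?d) \<bullet> ?d = 0" unfolding \<tau>z[OF d] .
      ultimately show False by simp
    qed
    have \<nu>D': "((\<lambda>t. \<nu>' (t *\<^sub>R ?l)) has_real_derivative - (Fd c (\<xi> 0) (\<nu>' (0 *\<^sub>R ?l) *\<^sub>R \<eta> (0 *\<^sub>R ?l)) \<bullet> \<tau> ?l) / \<nu>' (0 *\<^sub>R ?l)) (at 0)"
    proof -
      have "?D\<nu> 0 ?l = (s * ?D\<nu> 0 ?l) / s" using s(1) by simp
      also have "s * ?D\<nu> 0 ?l = - (Fd c x0 (s *\<^sub>R \<eta> 0) \<bullet> \<tau> ?l)" using pf[OF eim _ l] by (simp add: \<psi>0 D\<psi>0 \<nu>'0)
      finally have "?D\<nu> 0 ?l = - (Fd c x0 (s *\<^sub>R \<eta> 0) \<bullet> \<tau> ?l) / s" .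
      then show ?thesis using \<nu>D by (simp add: has_real_derivative_iff_has_vector_derivative \<xi>0 \<nu>'0)
    qed
    have "((\<lambda>t. Fd c (\<xi> t) (\<nu>' (t *\<^sub>R ?l) *\<^sub>R \<eta> (t *\<^sub>R ?l)) \<bullet> D\<psi> (t *\<^sub>R ?l) ?k) has_real_derivative
      - alpha c (\<xi> 0) (\<nu>' (0 *\<^sub>R ?l) *\<^sub>R \<eta> (0 *\<^sub>R ?l)) (\<tau> ?l) (D\<psi> (0 *\<^sub>R ?l) ?k)
      + Fd c (\<xi> 0) (\<nu>' (0 *\<^sub>R ?l) *\<^sub>R \<eta> (0 *\<^sub>R ?l)) \<bullet> (Gam c (\<xi> 0) (\<tau> ?l) (D\<psi> (0 *\<^sub>R ?l) ?k) + q ?l ?k *\<^sub>R axis i 1)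
      + \<nu>' (0 *\<^sub>R ?l) * (DvF c (\<xi> 0) (\<nu>' (0 *\<^sub>R ?l) *\<^sub>R \<eta> (0 *\<^sub>R ?l)) (\<eta>' + Gam c (\<xi> 0) (\<tau> ?l) (\<eta> (0 *\<^sub>R ?l))) \<bullet> D\<psi> (0 *\<^sub>R ?l) ?k)) (at 0)"
      by (rule force_along_curve[where \<eta> = "\<lambda>t. \<eta> (t *\<^sub>R ?l)" and \<nu> = "\<lambda>t. \<nu>' (t *\<^sub>R ?l)" and b = "\<lambda>t. D\<psi> (t *\<^sub>R ?l) ?k",
          OF c(1) _ \<xi>D \<eta>D bD \<nu>D']) (use x0c s(1) unit[OF J(2)] in \<open>simp_all add: \<xi>0 \<nu>'0\<close>)
    then have K: "((\<lambda>t. Fd c (\<xi> t) (\<nu>' (t *\<^sub>R ?l) *\<^sub>R \<eta> (t *\<^sub>R ?l)) \<bullet> D\<psi> (t *\<^sub>R ?l) ?k) has_real_derivative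
      - alpha c x0 w (\<tau> ?l) (\<tau> ?k) + Fd c x0 w \<bullet> (Gam c x0 (\<tau> ?l) (\<tau> ?k) + q ?l ?k *\<^sub>R axis i 1)
      + s * (DvF c x0 w D \<bullet> \<tau> ?k)) (at 0)"
      using we by (simp add: \<xi>0 D\<psi>0 D_def \<nu>'0)
    have "((\<lambda>t. ?D\<nu> (t *\<^sub>R ?l) ?k) has_vector_derivative D2f \<nu>' 0 ?l ?k) (at 0)"
    proof -
      have "Ck_on (Suc 0) U (\<lambda>y. ?D\<nu> y ?k)" using Ck_on_derivative[OF U \<nu>'s Ck_on_const[OF U]] by blast
      from Ck_on_Suc_has_derivative[OF this, of 0] eim
      have "((\<lambda>y. ?D\<nu> y ?k) has_derivative (\<lambda>z. D2f \<nu>' 0 z ?k)) (at (0 *\<^sub>R ?l))"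
        by (simp add: U_def zero_coord_id D2f_def)
      from has_vector_derivative_chain[OF lineD this] show ?thesis .
    qed
    then have "((\<lambda>t. \<nu>' (t *\<^sub>R ?l) * ?D\<nu> (t *\<^sub>R ?l) ?k) has_real_derivative ?D\<nu> 0 ?l * ?D\<nu> 0 ?k + s * D2f \<nu>' 0 ?l ?k) (at 0)"
      using \<nu>D unfolding has_real_derivative_iff_has_vector_derivative[symmetric]
      by (auto intro!: derivative_eq_intros simp: \<nu>'0)
    then have "((\<lambda>t. - (\<nu>' (t *\<^sub>R ?l) * ?D\<nu> (t *\<^sub>R ?l) ?k)) has_real_derivative - (?D\<nu> 0 ?l * ?D\<nu> 0 ?k + s * D2f \<nu>' 0 ?l ?k)) (at 0)"
      by (rule DERIV_minus)
    then have "((\<lambda>t. Fd c (\<xi> t) (\<nu>' (t *\<^sub>R ?l) *\<^sub>R \<eta> (t *\<^sub>R ?l)) \<bullet> D\<psi> (t *\<^sub>R ?l) ?k) has_real_derivative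
       - (?D\<nu> 0 ?l * ?D\<nu> 0 ?k + s * D2f \<nu>' 0 ?l ?k)) (at 0)"
      unfolding has_real_derivative_iff_has_vector_derivative
      by (rule has_vector_derivative_transform_within_open[OF _ J(1,2)]) (use pf[OF J(3) ti k] in \<open>simp add: \<xi>_def\<close>)
    from DERIV_unique[OF K this]
    show ?thesis by (simp add: Dv linear_scale[OF DvF_linear[OF c(1) x0c]])
  qed
  have D2s: "D2f \<nu>' 0 y z = D2f \<nu>' 0 z y" for y z
    unfolding D2f_def using second_derivative_symmetric[OF U \<nu>'s, of 0 z y] eim by (simp add: U_def zero_coord_id)
  note al = linear_add[OF alpha_linear(1)[OF c(1) x0c]] linear_add[OF alpha_linear(2)[OF c(1) x0c]]
    linear_scale[OF alpha_linear(1)[OF c(1) x0c]] linear_scale[OF alpha_linear(2)[OF c(1) x0c]]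
    linear_0[OF alpha_linear(1)[OF c(1) x0c]] linear_0[OF alpha_linear(2)[OF c(1) x0c]]
  \<comment> \<open>In \<open>key\<close> the terms with \<open>Gam\<close> and q, and the whole
    right-hand side, are symmetric in l and k. What remains is \<beta>.\<close>
  define \<beta> where "\<beta> a b = - alpha c x0 w (\<tau> (?z a)) (\<tau> (?z b))
      + s * (((G *v a0) \<bullet> \<tau> (?z a)) * (DvF c x0 w a0 \<bullet> \<tau> (?z b)))" for a b
  have \<beta>l: "linear (\<lambda>a. \<beta> a b)" "linear (\<beta> a)" for a b
    by (auto intro!: linearI simp: \<beta>_def ll al inner_add_right algebra_simps)
  have "\<beta> a b = \<beta> b a"
  proof (rule bilinear_axis_eq[of \<beta> "\<lambda>a b. \<beta> b a", OF \<beta>l \<beta>l(2,1)])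
    fix l k
    show "\<beta> (axis l 1) (axis k 1) = \<beta> (axis k 1) (axis l 1)"
    proof (cases "l = i \<or> k = i")
      case True
      then show ?thesis by (auto simp: \<beta>_def zax linear_0[OF \<tau>l] al)
    next
      case False
      then show ?thesis
        using key[of l k] key[of k l] D2s[of "axis l 1" "axis k 1"] qs[of "axis l 1" "axis k 1"]
          Gam_sym[OF c(1) x0c, of "\<tau> (axis l 1)" "\<tau> (axis k 1)"]
        by (simp add: \<beta>_def zax mult.commute)
    qed
  qed
  then show ?thesis using a b by (simp add: \<beta>_def \<tau>z W_def G_def)
qed

text \<open>By \<open>eig\<close> each x in V is an eigenvector of \<beta> relative to G.
  Independent eigenvectors whose sum is again one share their eigenvalue, so there is one eigenvalue
  for all of V.\<close>

lemma scalar_form: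
  fixes \<beta> G :: "'a::real_vector \<Rightarrow> 'a \<Rightarrow> real"
  assumes V: "subspace V" and \<beta>: "\<And>x y z. \<beta> (x + y) z = \<beta> x z + \<beta> y z" "\<And>r x z. \<beta> (r *\<^sub>R x) z = r * \<beta> x z"
    and G: "\<And>x y z. G (x + y) z = G x z + G y z" "\<And>r x z. G (r *\<^sub>R x) z = r * G x z"
    and pos: "\<And>x. x \<in> V \<Longrightarrow> x \<noteq> 0 \<Longrightarrow> 0 < G x x"
    and eig: "\<And>x b. x \<in> V \<Longrightarrow> b \<in> V \<Longrightarrow> G x x * \<beta> x b = G x b * \<beta> x x"
  shows "\<exists>l. \<forall>a\<in>V. \<forall>b\<in>V. \<beta> a b = l * G a b"
proof (cases "V \<subseteq> {0}")
  case True
  have "\<beta> 0 b = 0" "G 0 b = 0" for b using \<beta>(2)[of 0 0 b] G(2)[of 0 0 b] by auto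
  then have "\<beta> a b = 0 * G a b" if "a \<in> V" for a b using that True by auto
  then show ?thesis by blast
next
  case False
  then obtain x where x: "x \<in> V" "x \<noteq> 0" by blast
  have mu: "\<exists>m. \<forall>b\<in>V. \<beta> y b = m * G y b" if "y \<in> V" "y \<noteq> 0" for y
    using eig[OF that(1)] pos[OF that] by (intro exI[of _ "\<beta> y y / G y y"]) (simp add: field_simps)
  obtain m where m: "\<And>b. b \<in> V \<Longrightarrow> \<beta> x b = m * G x b" using mu[OF x] by blast
  have "\<beta> y b = m * G y b" if y: "y \<in> V" and b: "b \<in> V" for y b
  proof (cases "\<exists>r. y = r *\<^sub>R x")
    case True
    then show ?thesis using m[OF b] by (auto simp: \<beta> G)
  next
    case False
    then have "y \<noteq> 0" by (metis scaleR_zero_left)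
    then obtain m' where m': "\<And>b. b \<in> V \<Longrightarrow> \<beta> y b = m' * G y b" using mu[OF y] by blast
    have "x + y \<noteq> 0" using False by (metis add.inverse_unique scaleR_minus1_left)
    moreover have xy: "x + y \<in> V" using V x y subspace_add by blast
    ultimately obtain k where k: "\<And>b. b \<in> V \<Longrightarrow> \<beta> (x + y) b = k * G (x + y) b" using mu by blast
    \<comment> \<open>Subtracting the eigenvalue relations of x and y from that of x + y shows
      \<open>?u\<close> to be G-orthogonal to V. As \<open>?u\<close> itself lies in V it vanishes,
      and independence equates the eigenvalues.\<close>
    let ?u = "(k - m) *\<^sub>R x + (k - m') *\<^sub>R y"
    have uV: "?u \<in> V" using V x y by (intro subspace_add subspace_mul)
    have "G ?u b = (k - m) * G x b + (k - m') * G y b" for b by (simp only: G)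
    then have "G ?u ?u = k * (G x ?u + G y ?u) - (m * G x ?u + m' * G y ?u)" by (simp only: left_diff_distrib distrib_left)
    also have "k * (G x ?u + G y ?u) = m * G x ?u + m' * G y ?u"
      using k[OF uV] unfolding \<beta>(1) G(1) m[OF uV] m'[OF uV] by (rule sym)
    finally have "G ?u ?u = 0" by simp
    then have u: "?u = 0" using pos[OF uV] by fastforce
    have "k = m'"
    proof (rule ccontr)
      assume "k \<noteq> m'"
      then have "y = (1 / (k - m')) *\<^sub>R ((k - m') *\<^sub>R y)" by simp
      also have "(k - m') *\<^sub>R y = (m - k) *\<^sub>R x" using u by (simp add: algebra_simps add_eq_0_iff)
      finally have "y = ((m - k) / (k - m')) *\<^sub>R x" by simp
      then show False using False by blast
    qed
    then have "k = m" using u x by simp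
    then show ?thesis using m'[OF b] \<open>k = m'\<close> by simp
  qed
  then show ?thesis by blast
qed

lemma normality_imp_compat:
  assumes AN: "additional_normality A g F" and c: "c \<in> A" "p \<in> cdom c"
    and v: "v \<in> tangent_space A p" "v c \<noteq> 0"
  shows "compat c (cmap c p) (v c)"
proof -
  let ?x = "cmap c p" and ?w = "v c"
  have x: "?x \<in> cim c" using c by blast
  let ?W = "gm c ?x *v ?w"
  have s: "0 < sqrt (?W \<bullet> ?w)" using gm_pos[OF c(1) x v(2)] by simp
  note so = normality_second_order[OF AN c v]
  \<comment> \<open>a0 = 0 isolates the first family. Once it is known, a0 = a = y leaves a relation
    for the velocity gradient alone, the eigenvector condition of
    \<open>scalar_form\<close>.\<close>
  have sym: "alpha c ?x ?w a b = alpha c ?x ?w b a" if "?W \<bullet> a = 0" "?W \<bullet> b = 0" for a b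
    using so[of 0 a b] that by simp
  have "\<exists>l. \<forall>a\<in>{a. ?W \<bullet> a = 0}. \<forall>b\<in>{a. ?W \<bullet> a = 0}. DvF c ?x ?w a \<bullet> b = l * ((gm c ?x *v a) \<bullet> b)"
  proof (rule scalar_form)
    show "subspace {a. ?W \<bullet> a = 0}" by (rule subspace_hyperplane)
    show "0 < (gm c ?x *v y) \<bullet> y" if "y \<noteq> 0" for y by (rule gm_pos[OF c(1) x that])
    fix y b assume "y \<in> {a. ?W \<bullet> a = 0}" "b \<in> {a. ?W \<bullet> a = 0}"
    then have yb: "?W \<bullet> y = 0" "?W \<bullet> b = 0" by auto
    show "((gm c ?x *v y) \<bullet> y) * (DvF c ?x ?w y \<bullet> b) = ((gm c ?x *v y) \<bullet> b) * (DvF c ?x ?w y \<bullet> y)"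
      using so[OF yb(1) yb(1) yb(2)] sym[OF yb] s by simp
  qed (simp_all add: linear_add[OF DvF_linear[OF c(1) x]] linear_scale[OF DvF_linear[OF c(1) x]] inner_add_left algebra_simps)
  then show ?thesis unfolding compat_def using sym by simp
qed

end

section \<open>Sufficiency of the equations\<close>

context manifold begin

lemma TD_restrict:
  assumes "c \<in> A" "open X" "p \<in> cdom c" "p \<in> X"
  shows "TD (restrict_chart c X) c p a = a"
proof -
  let ?e = "restrict_chart c X"
  have e: "?e \<in> A" "\<And>x. x \<in> cim ?e \<Longrightarrow> cinv ?e x = cinv c x" using restrict_chart[OF assms(1,2)] by auto
  have "((\<lambda>x. x) has_derivative (\<lambda>x. x)) (at (cmap ?e p))" by (rule has_derivative_ident)
  then have "((cmap c \<circ> cinv ?e) has_derivative (\<lambda>x. x)) (at (cmap ?e p))"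
    by (rule has_derivative_transform_within_open[OF _ chartD(2)[OF e(1)]])
      (use assms e(2) cmap_cinv[OF assms(1)] in auto)
  then show ?thesis using TD_unique[OF e(1) assms(1) _ assms(3)] assms(3,4) by (metis IntI restrict_chart_simps(1))
qed

end

context riemannian begin

text \<open>The unit normal of the coordinate hyperplanes \<open>x $ i = const\<close>, obtained by raising the index
  of the covector \<open>axis i 1\<close>.\<close>

definition coord_normal :: "('m, 'n) chart \<Rightarrow> 'n \<Rightarrow> real^'n \<Rightarrow> real^'n" where
  "coord_normal c i x = inverse (sqrt ((matrix_inv (gm c x) *v axis i 1) $ i)) *\<^sub>R (matrix_inv (gm c x) *v axis i 1)"

lemma coord_normal_aux:
  fixes i :: 'n
  assumes c: "c \<in> A" "x \<in> cim c"
  defines "m \<equiv> matrix_inv (gm c x) *v axis i 1"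
  shows "gm c x *v m = axis i 1" "0 < m $ i"
proof -
  show 1: "gm c x *v m = axis i 1"
    by (simp add: m_def matrix_vector_mul_assoc matrix_inv_right gm_det c)
  then have "m \<noteq> 0" by auto
  from gm_pos[OF c this] show "0 < m $ i" by (simp add: 1 inner_axis')
qed

lemma coord_normal_orth:
  assumes c: "c \<in> A" "x \<in> cim c"
  obtains \<kappa> where "0 < \<kappa>" "\<And>a. (gm c x *v coord_normal c i x) \<bullet> a = \<kappa> * a $ i"
proof -
  note m = coord_normal_aux[OF c, of i]
  show ?thesis
    by (rule that[of "inverse (sqrt ((matrix_inv (gm c x) *v axis i 1) $ i))"])
      (use m in \<open>simp_all add: coord_normal_def matrix_vector_mult_scaleR inner_axis'\<close>)
qed

lemma coord_normal_unit:
  assumes c: "c \<in> A" "x \<in> cim c"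
  shows "(gm c x *v coord_normal c i x) \<bullet> coord_normal c i x = 1"
proof -
  note m = coord_normal_aux[OF c, of i]
  let ?m = "(matrix_inv (gm c x) *v axis i 1) $ i"
  have "(gm c x *v coord_normal c i x) \<bullet> coord_normal c i x = inverse (sqrt ?m) * (inverse (sqrt ?m) * ?m)"
    by (simp add: coord_normal_def matrix_vector_mult_scaleR m(1) inner_axis')
  also have "\<dots> = 1" using m(2) real_sqrt_mult_self[of ?m] by (simp add: field_simps)
  finally show ?thesis .
qed

lemma coord_normal_smooth: assumes c: "c \<in> A" shows "Ck_on k (cim c) (coord_normal c i)"
proof -
  note U = chartD(2)[OF c]
  have m: "Ck_on k (cim c) (\<lambda>x. matrix_inv (gm c x) *v axis i 1)"
    by (intro Ck_on_matrix_vector Ck_on_matrix_inv metric_smooth c U gm_det Ck_on_const)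
  have "sqrt ((matrix_inv (gm c x) *v axis i 1) $ i) \<noteq> 0" if "x \<in> cim c" for x
    using coord_normal_aux(2)[OF c that, of i] by simp
  then show ?thesis
    unfolding coord_normal_def[abs_def]
    by (intro Ck_on_scaleR Ck_on_inverse Ck_on_sqrt Ck_on_nth m U coord_normal_aux(2)[OF c]) auto
qed

text \<open>The part of n orthogonal to the coordinate normal has vanishing i-th coordinate, so n is
  orthogonal to it; it is then orthogonal to itself and vanishes. Only a sign remains free.\<close>

lemma unit_normal_coord:
  assumes c: "c \<in> A" "x \<in> cim c" and n: "(gm c x *v n) \<bullet> n = 1" "\<And>a. a $ i = 0 \<Longrightarrow> (gm c x *v n) \<bullet> a = 0"
  defines "\<theta> \<equiv> (gm c x *v coord_normal c i x) \<bullet> n"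
  shows "n = \<theta> *\<^sub>R coord_normal c i x" "\<theta> * \<theta> = 1"
proof -
  let ?\<eta> = "coord_normal c i x" and ?G = "gm c x"
  obtain \<kappa> where \<kappa>: "0 < \<kappa>" "\<And>a. (?G *v ?\<eta>) \<bullet> a = \<kappa> * a $ i" using coord_normal_orth[OF c] by blast
  show eq: "n = \<theta> *\<^sub>R ?\<eta>"
  proof (rule ccontr)
    let ?d = "n - \<theta> *\<^sub>R ?\<eta>"
    assume "n \<noteq> \<theta> *\<^sub>R ?\<eta>"
    then have "0 < (?G *v ?d) \<bullet> ?d" by (intro gm_pos[OF c]) simp
    moreover have d: "(?G *v ?\<eta>) \<bullet> ?d = 0"
      using coord_normal_unit[OF c, of i] by (simp add: inner_diff_right \<theta>_def)
    then have "?d $ i = 0" using \<kappa> by (metis mult_eq_0_iff less_irrefl)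
    from n(2)[OF this] have "(?G *v n) \<bullet> ?d = 0" .
    moreover have "(?G *v ?d) \<bullet> ?d = (?G *v n) \<bullet> ?d - \<theta> * ((?G *v ?\<eta>) \<bullet> ?d)"
      by (simp only: matrix_vector_mult_diff_distrib matrix_vector_mult_scaleR inner_diff_left inner_scaleR_left)
    ultimately show False using d by simp
  qed
  have "(?G *v n) \<bullet> n = \<theta> * \<theta> * ((?G *v ?\<eta>) \<bullet> ?\<eta>)"
    by (subst (1 2) eq) (simp add: matrix_vector_mult_scaleR mult.assoc)
  then show "\<theta> * \<theta> = 1" using n(1) coord_normal_unit[OF c, of i] by simp
qed

end

context newtonian begin

text \<open>The system \<open>\<partial>\<^sub>k \<nu> = - F\<^sub>k(x, \<nu> n) / \<nu>\<close> on the slice \<open>x $ i = 0\<close>, extended to a neighbourhood so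
  that nothing depends on \<open>x $ i\<close>.\<close>

lemma compat_pfaff_solution:
  assumes E: "\<And>x v. x \<in> cim c \<Longrightarrow> v \<noteq> 0 \<Longrightarrow> compat c x v"
    and c: "c \<in> A" and x0: "x0 \<in> cim c" "x0 $ i = 0" and w0: "w0 \<noteq> 0"
  obtains \<rho> \<nu> where "0 < \<rho>" "\<nu> x0 = w0" "\<And>y. y \<in> ball x0 \<rho> \<Longrightarrow> \<nu> y \<noteq> 0"
    "\<And>k. Ck_on k (ball x0 \<rho>) \<nu>"
    "\<And>y a. y \<in> ball x0 \<rho> \<Longrightarrow> y $ i = 0 \<Longrightarrow> a $ i = 0 \<Longrightarrow>
      \<nu> y * frechet_derivative \<nu> (at y) a = - (Fd c y (\<nu> y *\<^sub>R coord_normal c i y) \<bullet> a)"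
proof -
  let ?z = "zero_coord i :: real^'n \<Rightarrow> real^'n"
  let ?\<eta> = "coord_normal c i"
  define Y where "Y = {y. ?z y \<in> cim c}"
  have Yo: "open Y" unfolding Y_def by (intro open_zero_coord chartD c)
  define U where "U = Y \<times> (- {0::real})"
  have U: "open U" unfolding U_def by (intro open_Times Yo) auto
  define H where "H p = - inverse (snd p) *\<^sub>R ?z (Fd c (?z (fst p)) (snd p *\<^sub>R ?\<eta> (?z (fst p))))" for p
  have zb: "bounded_linear ?z" using zero_coord_linear linear_conv_bounded_linear by blast
  have Hs: "Ck_on k U H" for k
  proof -
    have z: "Ck_on k U (\<lambda>p. ?z (fst p))" by (intro Ck_on_bounded_linear[OF zb] Ck_on_fst Ck_on_id U)
    have \<eta>: "Ck_on k U (\<lambda>p. ?\<eta> (?z (fst p)))"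
      by (rule Ck_on_compose[OF U chartD(2)[OF c] z coord_normal_smooth[OF c]]) (auto simp: U_def Y_def)
    have s: "Ck_on k U snd" using Ck_on_snd[OF U Ck_on_id[OF U]] .
    have "Ck_on k U (\<lambda>p. Fd c (fst (?z (fst p), snd p *\<^sub>R ?\<eta> (?z (fst p)))) (snd (?z (fst p), snd p *\<^sub>R ?\<eta> (?z (fst p)))))"
      by (rule Ck_on_compose[OF U open_phase[OF c] _ Fd_smooth[OF c]])
        (auto simp: U_def[symmetric] intro!: Ck_on_Pair Ck_on_scaleR z \<eta> s U, auto simp: U_def Y_def)
    then show ?thesis
      unfolding H_def[abs_def]
      by (intro Ck_on_scaleR Ck_on_minus Ck_on_inverse Ck_on_bounded_linear[OF zb] s U) (auto simp: U_def)
  qed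
  have zz: "?z x \<bullet> y = x \<bullet> ?z y" for x y
    unfolding inner_vec_def by (rule sum.cong) (auto simp: zero_coord_nth)
  have Hin: "H (y, w) \<bullet> a = - (Fd c (?z y) (w *\<^sub>R ?\<eta> (?z y)) \<bullet> ?z a) / w" for y w a
    by (simp add: H_def zz divide_inverse)
  have Hsym: "\<exists>S. \<forall>a b. frechet_derivative H (at p) (a, H p \<bullet> a) \<bullet> b = S a b \<and> S a b = S b a" if p: "p \<in> U" for p
  proof -
    obtain y w where yw: "p = (y, w)" by (cases p)
    have y: "?z y \<in> cim c" and w: "w \<noteq> 0" using p by (auto simp: yw U_def Y_def)
    let ?x = "?z y"
    let ?v = "w *\<^sub>R ?\<eta> ?x"
    obtain \<kappa> where \<kappa>: "0 < \<kappa>" "\<And>a. (gm c ?x *v ?\<eta> ?x) \<bullet> a = \<kappa> * a $ i" using coord_normal_orth[OF c y] by blast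
    have unit: "(gm c ?x *v ?\<eta> ?x) \<bullet> ?\<eta> ?x = 1" by (rule coord_normal_unit[OF c y])
    have "?\<eta> ?x \<noteq> 0" using unit by auto
    then have cp: "compat c ?x ?v" using E[OF y] w by simp
    have perp: "(gm c ?x *v ?v) \<bullet> a = 0 \<longleftrightarrow> a $ i = 0" for a using \<kappa> w by (simp add: matrix_vector_mult_scaleR)
    obtain l where l: "\<And>a b. a $ i = 0 \<Longrightarrow> b $ i = 0 \<Longrightarrow> DvF c ?x ?v a \<bullet> b = l * ((gm c ?x *v a) \<bullet> b)"
      and al: "\<And>a b. a $ i = 0 \<Longrightarrow> b $ i = 0 \<Longrightarrow> alpha c ?x ?v a b = alpha c ?x ?v b a"
      using cp unfolding compat_def perp by blast
    \<comment> \<open>An explicit value of the derivative of H, symmetric term by term: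
      \<open>alpha\<close> by the first family, \<open>Gam\<close> because the connection is torsion
      free. The second family replaces the velocity gradient by l times the metric, whereupon
      \<open>weingarten\<close> reduces the derivative of the normal to \<open>Gam\<close>. The last
      product stems from the division by \<nu>.\<close>
    define S where "S a b = - (- alpha c ?x ?v (?z a) (?z b) + Fd c ?x ?v \<bullet> Gam c ?x (?z a) (?z b)
        + w * (l * - ((gm c ?x *v ?\<eta> ?x) \<bullet> Gam c ?x (?z a) (?z b)))) / w - (H p \<bullet> a) * (H p \<bullet> b) / w" for a b
    have "frechet_derivative H (at p) (a, H p \<bullet> a) \<bullet> b = S a b" for a b
    proof -
      let ?a = "?z a" and ?b = "?z b"
      \<comment> \<open>The direction (a, H p . a) is followed along a line in (y, w); \<xi> is the
        projection of this line to the slice, where \<open>force_along_curve\<close>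
        applies.\<close>
      define h where "h = H p \<bullet> a"
      define \<xi> where "\<xi> t = ?x + t *\<^sub>R ?a" for t
      define \<omega> where "\<omega> t = w + t * h" for t
      have \<xi>0: "\<xi> 0 = ?x" and \<omega>0: "\<omega> 0 = w" by (simp_all add: \<xi>_def \<omega>_def)
      have \<xi>D: "(\<xi> has_vector_derivative ?a) (at 0)" unfolding \<xi>_def[abs_def] by (rule line_deriv)
      have \<eta>d: "(?\<eta> has_derivative frechet_derivative ?\<eta> (at (\<xi> 0))) (at (\<xi> 0))"
        using Ck_on_Suc_has_derivative[OF coord_normal_smooth[OF c] y] by (simp add: \<xi>0)
      from has_vector_derivative_chain[OF \<xi>D \<eta>d]
      obtain \<eta>' where \<eta>D: "((\<lambda>t. ?\<eta> (\<xi> t)) has_vector_derivative \<eta>') (at 0)" by blast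
      have bD: "((\<lambda>t::real. ?b) has_vector_derivative 0) (at 0)" by (rule has_vector_derivative_const)
      obtain J where J: "open J" "(0::real) \<in> J" "\<And>t. t \<in> J \<Longrightarrow> \<xi> t \<in> cim c"
        using line_near[OF chartD(2)[OF c] y, of ?a] unfolding \<xi>_def by blast
      have u: "(gm c (\<xi> t) *v ?\<eta> (\<xi> t)) \<bullet> ?\<eta> (\<xi> t) = 1" if "t \<in> J" for t by (rule coord_normal_unit[OF c J(3)[OF that]])
      have zi: "?z a $ i = 0" for a by (simp add: zero_coord_nth)
      have pb: "(gm c (\<xi> t) *v ?\<eta> (\<xi> t)) \<bullet> ?z b = 0" if "t \<in> J" for t b
        using coord_normal_orth[OF c J(3)[OF that], of i] by (metis zi mult_zero_right)
      define D where "D = \<eta>' + Gam c ?x ?a (?\<eta> ?x)"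
      note wg = weingarten[of c \<xi> ?a "\<lambda>t. ?\<eta> (\<xi> t)" \<eta>' "\<lambda>t. ?b" 0 J, OF c _ \<xi>D \<eta>D bD J(1,2) u pb, unfolded \<xi>0, folded D_def]
      have D1: "D $ i = 0" using wg(1) y \<kappa> by simp
      have D2: "(gm c ?x *v D) \<bullet> ?b = - ((gm c ?x *v ?\<eta> ?x) \<bullet> Gam c ?x ?a ?b)" using wg(2) y by simp
      have h: "h = - (Fd c ?x ?v \<bullet> ?a) / w" by (simp add: h_def yw Hin)
      have \<omega>D: "(\<omega> has_real_derivative h) (at 0)" unfolding \<omega>_def[abs_def] by (auto intro!: derivative_eq_intros)
      have "((\<lambda>t. Fd c (\<xi> t) (\<omega> t *\<^sub>R ?\<eta> (\<xi> t)) \<bullet> ?b) has_real_derivative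
         - alpha c ?x ?v ?a ?b + Fd c ?x ?v \<bullet> (Gam c ?x ?a ?b + 0) + w * (DvF c ?x ?v D \<bullet> ?b)) (at 0)"
        using force_along_curve[of c \<xi> ?a "\<lambda>t. ?\<eta> (\<xi> t)" \<eta>' "\<lambda>t. ?b" 0 \<omega>, OF c _ \<xi>D \<eta>D bD] y w u[OF J(2)] \<omega>D h
        by (simp only: \<xi>0 \<omega>0 D_def simp_thms)
      then have K: "((\<lambda>t. Fd c (\<xi> t) (\<omega> t *\<^sub>R ?\<eta> (\<xi> t)) \<bullet> ?b) has_real_derivative
         - alpha c ?x ?v ?a ?b + Fd c ?x ?v \<bullet> Gam c ?x ?a ?b + w * (l * - ((gm c ?x *v ?\<eta> ?x) \<bullet> Gam c ?x ?a ?b))) (at 0)"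
        using l[OF D1 zi, of b] D2 by simp
      have Hc: "H (y + t *\<^sub>R a, \<omega> t) \<bullet> b = - (Fd c (\<xi> t) (\<omega> t *\<^sub>R ?\<eta> (\<xi> t)) \<bullet> ?b) / \<omega> t" for t
        by (simp add: Hin \<xi>_def linear_add[OF zero_coord_linear] linear_scale[OF zero_coord_linear])
      have Hb: "Fd c ?x ?v \<bullet> ?b = - (w * (H p \<bullet> b))" using w by (simp add: yw Hin)
      have "((\<lambda>t. - (Fd c (\<xi> t) (\<omega> t *\<^sub>R ?\<eta> (\<xi> t)) \<bullet> ?b) / \<omega> t) has_real_derivative S a b) (at 0)"
      proof -
        have "((\<lambda>t. - (Fd c (\<xi> t) (\<omega> t *\<^sub>R ?\<eta> (\<xi> t)) \<bullet> ?b) / \<omega> t) has_real_derivative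
          ((- (- alpha c ?x ?v ?a ?b + Fd c ?x ?v \<bullet> Gam c ?x ?a ?b + w * (l * - ((gm c ?x *v ?\<eta> ?x) \<bullet> Gam c ?x ?a ?b)))) * \<omega> 0
            - (- (Fd c (\<xi> 0) (\<omega> 0 *\<^sub>R ?\<eta> (\<xi> 0)) \<bullet> ?b)) * h) / (\<omega> 0 * \<omega> 0)) (at 0)"
          by (rule DERIV_divide[OF DERIV_minus[OF K] \<omega>D]) (use w in \<open>simp add: \<omega>0\<close>)
        then show ?thesis
          unfolding S_def \<xi>0 \<omega>0 Hb h_def[symmetric] using w by (simp add: diff_divide_distrib mult.commute[of h])
      qed
      then have 1: "((\<lambda>t. H (y + t *\<^sub>R a, \<omega> t) \<bullet> b) has_vector_derivative S a b) (at 0)"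
        unfolding Hc has_real_derivative_iff_has_vector_derivative .
      have "((\<lambda>t. (y + t *\<^sub>R a, \<omega> t)) has_vector_derivative (a, h)) (at 0)"
        using \<omega>D unfolding has_real_derivative_iff_has_vector_derivative by (intro has_vector_derivative_Pair line_deriv)
      moreover have "(H has_derivative frechet_derivative H (at p)) (at (y + 0 *\<^sub>R a, \<omega> 0))"
        using Ck_on_Suc_has_derivative[OF Hs p] by (simp add: yw \<omega>0)
      ultimately have "((\<lambda>t. H (y + t *\<^sub>R a, \<omega> t)) has_vector_derivative frechet_derivative H (at p) (a, h)) (at 0)"
        by (rule has_vector_derivative_chain)
      then have "((\<lambda>t. H (y + t *\<^sub>R a, \<omega> t) \<bullet> b) has_vector_derivative frechet_derivative H (at p) (a, h) \<bullet> b) (at 0)"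
        by (rule bounded_linear.has_vector_derivative[OF bounded_linear_inner_left])
      from vector_derivative_unique_at[OF this 1] show ?thesis by (simp add: h_def)
    qed
    moreover have "S a b = S b a" for a b
      unfolding S_def using al[of "?z a" "?z b"] Gam_sym[OF c y, of "?z a" "?z b"] by (simp add: zero_coord_nth mult.commute)
    ultimately show ?thesis by blast
  qed
  have Hs': "frechet_derivative H (at p) (a, H p \<bullet> a) \<bullet> b = frechet_derivative H (at p) (b, H p \<bullet> b) \<bullet> a" if "p \<in> U" for p a b
    using Hsym[OF that] by metis
  have "(x0, w0) \<in> U" using x0 w0 by (simp add: U_def Y_def zero_coord_id)
  from pfaff_system[OF U Hs this Hs'] obtain \<rho> \<nu> where \<rho>: "0 < \<rho>" "\<nu> x0 = w0"
    and \<nu>: "\<And>y. y \<in> ball x0 \<rho> \<Longrightarrow> (y, \<nu> y) \<in> U \<and> (\<nu> has_derivative (\<lambda>h. H (y, \<nu> y) \<bullet> h)) (at y)" by blast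
  let ?B = "ball x0 \<rho>"
  have B: "open ?B" by simp
  \<comment> \<open>Bootstrapping: the derivative of \<nu> is a smooth function of y and \<nu> y, so
    each order of differentiability gives the next.\<close>
  have sm: "Ck_on k ?B \<nu>" for k
  proof (induction k)
    case 0
    have "isCont \<nu> y" if "y \<in> ?B" for y using \<nu>[OF that] has_derivative_continuous by blast
    then show ?case by (simp add: continuous_at_imp_continuous_on)
  next
    case (Suc k)
    show ?case
    proof (rule Ck_on_SucI[OF B])
      show "(\<nu> has_derivative (\<lambda>h. H (y, \<nu> y) \<bullet> h)) (at y)" if "y \<in> ?B" for y using \<nu>[OF that] by blast
      show "Ck_on k ?B (\<lambda>y. H (y, \<nu> y) \<bullet> b)" for b
        by (intro Ck_on_inner[OF B] Ck_on_const[OF B] Ck_on_compose[OF B U _ Hs] Ck_on_Pair[OF B Ck_on_id[OF B] Suc])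
          (use \<nu> in blast)
    qed
  qed
  show ?thesis
  proof (rule that[OF \<rho> _ sm])
    fix y assume y: "y \<in> ?B"
    show nz: "\<nu> y \<noteq> 0" using \<nu>[OF y] by (simp add: U_def)
    fix a :: "real^'n" assume yi: "y $ i = 0" "a $ i = 0"
    have "frechet_derivative \<nu> (at y) a = H (y, \<nu> y) \<bullet> a" using \<nu>[OF y] frechet_derivative_at by metis
    then show "\<nu> y * frechet_derivative \<nu> (at y) a = - (Fd c y (\<nu> y *\<^sub>R ?\<eta> y) \<bullet> a)"
      using nz yi by (simp add: Hin zero_coord_id)
  qed
qed

text \<open>The existence time is common to all initial data in a ball, as a shift has one \<delta>
  for the entire piece of hypersurface.\<close>

lemma local_flow:
  assumes c: "c \<in> A" and Z: "Z \<in> cim c \<times> UNIV"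
  obtains \<delta> R where "0 < \<delta>" "0 < R" "\<And>z1. z1 \<in> ball Z R \<Longrightarrow>
    \<exists>z. z 0 = z1 \<and> (\<forall>t\<in>{-\<delta><..<\<delta>}. fst (z t) \<in> cim c \<and> (z has_vector_derivative GG c (z t)) (at t))"
proof -
  let ?U = "cim c \<times> (UNIV :: (real^'n) set)"
  obtain R where R: "0 < R" "cball Z R \<subseteq> ?U" using open_phase[OF c] Z open_contains_cball by blast
  obtain L where L: "0 \<le> L" and "\<And>x h. x \<in> cball Z R \<Longrightarrow> norm (frechet_derivative (GG c) (at x) h) \<le> L * norm h"
    and Lip: "\<And>x y. x \<in> cball Z R \<Longrightarrow> y \<in> cball Z R \<Longrightarrow> norm (GG c x - GG c y) \<le> L * norm (x - y)"
    using Ck_on_lipschitz[OF GG_smooth[OF c] compact_cball convex_cball R(2)] by blast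
  have cG: "continuous_on (cball Z R) (GG c)"
    using continuous_on_subset[OF Ck_on_imp_continuous_on[OF GG_smooth[OF c]] R(2)] .
  have "compact (GG c ` cball Z R)" by (rule compact_continuous_image[OF cG compact_cball])
  then obtain M where M: "0 < M" "\<And>x. x \<in> cball Z R \<Longrightarrow> norm (GG c x) \<le> M"
    using compact_imp_bounded bounded_pos by (metis imageI)
  \<comment> \<open>The first bound keeps solutions that start within R/2 of Z in the ball of radius
    R, where M and L are valid; the second provides the contraction in
    \<open>picard\<close>.\<close>
  define \<delta> where "\<delta> = min (R / (4 * M)) (1 / (4 * (L + 1)))"
  have \<delta>: "0 < \<delta>" using R M L by (simp add: \<delta>_def)
  have M\<delta>: "M * (\<delta> - - \<delta>) \<le> R / 2"
  proof -
    have "M * (2 * \<delta>) \<le> M * (2 * (R / (4 * M)))" using M by (intro mult_left_mono) (auto simp: \<delta>_def)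
    also have "\<dots> = R / 2" using M by simp
    finally show ?thesis by simp
  qed
  have L\<delta>: "L * (\<delta> - - \<delta>) \<le> 1 / 2"
  proof -
    have "L * (2 * \<delta>) \<le> L * (2 * (1 / (4 * (L + 1))))" using L by (intro mult_left_mono) (auto simp: \<delta>_def)
    also have "\<dots> \<le> 1 / 2" using L by (simp add: field_simps)
    finally show ?thesis by simp
  qed
  show ?thesis
  proof (rule that[OF \<delta>, of "R / 2"])
    show "0 < R / 2" using R by simp
    fix z1 assume z1: "z1 \<in> ball Z (R / 2)"
    have sub: "cball z1 (R / 2) \<subseteq> cball Z R"
    proof
      fix y assume "y \<in> cball z1 (R / 2)"
      then show "y \<in> cball Z R" using z1 dist_triangle[of Z y z1] by simp
    qed
    have I0: "0 \<in> {-\<delta>..\<delta>}" using \<delta> by simp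
    obtain z where z: "z 0 = z1" "\<And>t. t \<in> {-\<delta>..\<delta>} \<Longrightarrow> z t \<in> cball z1 (R / 2) \<and> (z has_vector_derivative GG c (z t)) (at t within {-\<delta>..\<delta>})"
    proof (rule picard[OF I0, of "R / 2" z1 "\<lambda>_. GG c" L M])
      show "continuous_on ({-\<delta>..\<delta>} \<times> cball z1 (R / 2)) (\<lambda>(t, x). GG c x)"
        unfolding case_prod_unfold by (rule continuous_on_compose2[OF cG continuous_on_snd[OF continuous_on_id]]) (use sub in auto)
      fix t :: real and x assume x: "x \<in> cball z1 (R / 2)"
      show "norm (GG c x) \<le> M" by (rule M(2)[OF subsetD[OF sub x]])
      fix y assume y: "y \<in> cball z1 (R / 2)"
      show "norm (GG c x - GG c y) \<le> L * norm (x - y)" by (rule Lip[OF subsetD[OF sub x] subsetD[OF sub y]])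
    qed (use R L M\<delta> L\<delta> in auto)
    have "fst (z t) \<in> cim c \<and> (z has_vector_derivative GG c (z t)) (at t)" if "t \<in> {-\<delta><..<\<delta>}" for t
    proof -
      have t: "t \<in> {-\<delta>..\<delta>}" "- \<delta> < t" "t < \<delta>" using that by auto
      have "z t \<in> ?U" using z(2)[OF t(1)] sub R(2) by blast
      then show ?thesis using z(2)[OF t(1)] at_within_Icc_at[OF t(2,3)] by auto
    qed
    with z(1) show "\<exists>z. z 0 = z1 \<and> (\<forall>t\<in>{-\<delta><..<\<delta>}. fst (z t) \<in> cim c \<and> (z has_vector_derivative GG c (z t)) (at t))" by blast
  qed
qed

end

context newtonian begin

text \<open>S' is cut out of S by a small coordinate ball in a slice chart. In coordinates it is
  convex, hence connected and simply connected, and on it a unit normal field is the coordinate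
  normal up to one constant sign, which reduces the claim to the system solved in
  \<open>compat_pfaff_solution\<close>.\<close>

lemma compat_imp_normality:
  assumes E: "\<And>c p v. c \<in> A \<Longrightarrow> p \<in> cdom c \<Longrightarrow> v \<in> tangent_space A p \<Longrightarrow> v c \<noteq> 0 \<Longrightarrow> compat c (cmap c p) (v c)"
    and n2: "2 \<le> CARD('n)"
  shows "additional_normality A g F"
  unfolding additional_normality_def
proof (intro allI impI, elim conjE)
  fix S p0 and \<nu>0 :: real
  assume S: "hypersurface A S" and p0: "p0 \<in> S" and \<nu>0: "\<nu>0 \<noteq> 0"
  obtain c i where cs: "slice_chart A S c i" and p0c: "p0 \<in> cdom c" using S p0 unfolding hypersurface_def by blast
  note c = slice_chartD[OF cs]
  define x0 where "x0 = cmap c p0"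
  have x0: "x0 \<in> cim c" "x0 $ i = 0" using p0c slice_mem[OF cs p0c] p0 by (simp_all add: x0_def)
  let ?\<eta> = "coord_normal c i"
  have E': "compat c x w" if "x \<in> cim c" "w \<noteq> 0" for x w
    using E[OF c cinv_in[OF c that(1)] tvec_of_in[OF c cinv_in[OF c that(1)]], of w] that(2)
    by (simp add: tvec_of_self[OF c cinv_in[OF c that(1)]] cmap_cinv[OF c that(1)])
  \<comment> \<open>S' has to be chosen before the normal field, hence before its sign \<sigma>
    relative to the coordinate normal, is known. Solutions and radii are therefore prepared for both
    signs, with the initial value \<sigma> \<nu>0.\<close>
  define PP where "PP \<sigma> \<rho> N \<longleftrightarrow> 0 < \<rho> \<and> N x0 = \<sigma> * \<nu>0 \<and> (\<forall>y\<in>ball x0 \<rho>. N y \<noteq> 0) \<and> (\<forall>k. Ck_on k (ball x0 \<rho>) N) \<and>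
      (\<forall>y\<in>ball x0 \<rho>. \<forall>a. y $ i = 0 \<longrightarrow> a $ i = 0 \<longrightarrow>
        N y * frechet_derivative N (at y) a = - (Fd c y (N y *\<^sub>R ?\<eta> y) \<bullet> a))" for \<sigma> \<rho> N
  have "\<exists>\<rho>N. \<sigma> * \<sigma> = 1 \<longrightarrow> PP \<sigma> (fst \<rho>N) (snd \<rho>N)" for \<sigma> :: real
  proof (cases "\<sigma> * \<sigma> = 1")
    case True
    then have "\<sigma> * \<nu>0 \<noteq> 0" using \<nu>0 by auto
    obtain \<rho> N where "0 < \<rho>" "N x0 = \<sigma> * \<nu>0" "\<And>y. y \<in> ball x0 \<rho> \<Longrightarrow> N y \<noteq> 0"
      "\<And>k. Ck_on k (ball x0 \<rho>) N"
      "\<And>y a. y \<in> ball x0 \<rho> \<Longrightarrow> y $ i = 0 \<Longrightarrow> a $ i = 0 \<Longrightarrow>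
        N y * frechet_derivative N (at y) a = - (Fd c y (N y *\<^sub>R ?\<eta> y) \<bullet> a)"
    proof (rule compat_pfaff_solution[OF E' c x0 \<open>\<sigma> * \<nu>0 \<noteq> 0\<close>])
      fix \<rho> N
      assume "0 < \<rho>" "N x0 = \<sigma> * \<nu>0" "\<And>y. y \<in> ball x0 \<rho> \<Longrightarrow> N y \<noteq> 0" "\<And>k. Ck_on k (ball x0 \<rho>) N"
      "\<And>y a. y \<in> ball x0 \<rho> \<Longrightarrow> y $ i = 0 \<Longrightarrow> a $ i = 0 \<Longrightarrow>
        N y * frechet_derivative N (at y) a = - (Fd c y (N y *\<^sub>R ?\<eta> y) \<bullet> a)"
      then show thesis by (rule that)
    qed
    then have "PP \<sigma> \<rho> N" unfolding PP_def by simp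
    then show ?thesis by (intro exI[of _ "(\<rho>, N)"]) simp
  qed simp
  then obtain \<rho>N where \<rho>N: "\<And>\<sigma>. \<sigma> * \<sigma> = 1 \<Longrightarrow> PP \<sigma> (fst (\<rho>N \<sigma>)) (snd (\<rho>N \<sigma>))" by metis
  define \<rho> where "\<rho> \<sigma> = fst (\<rho>N \<sigma>)" for \<sigma>
  define N where "N \<sigma> = snd (\<rho>N \<sigma>)" for \<sigma>
  have PP: "PP \<sigma> (\<rho> \<sigma>) (N \<sigma>)" if "\<sigma> * \<sigma> = 1" for \<sigma> using \<rho>N[OF that] by (simp add: \<rho>_def N_def)
  have \<rho>: "0 < \<rho> \<sigma>" and N0: "N \<sigma> x0 = \<sigma> * \<nu>0" and Nz: "y \<in> ball x0 (\<rho> \<sigma>) \<Longrightarrow> N \<sigma> y \<noteq> 0"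
    and Ns: "Ck_on k (ball x0 (\<rho> \<sigma>)) (N \<sigma>)"
    and Neq: "y \<in> ball x0 (\<rho> \<sigma>) \<Longrightarrow> y $ i = 0 \<Longrightarrow> a $ i = 0 \<Longrightarrow>
        N \<sigma> y * frechet_derivative (N \<sigma>) (at y) a = - (Fd c y (N \<sigma> y *\<^sub>R ?\<eta> y) \<bullet> a)"
    if "\<sigma> * \<sigma> = 1" for \<sigma> y a k
    using PP[OF that] unfolding PP_def by simp_all
  define V where "V \<sigma> y = N \<sigma> y *\<^sub>R ?\<eta> y" for \<sigma> y
  define QQ where "QQ \<sigma> \<delta> R \<longleftrightarrow> 0 < \<delta> \<and> 0 < R \<and> (\<forall>z1\<in>ball (x0, V \<sigma> x0) R.
      \<exists>z. z 0 = z1 \<and> (\<forall>t\<in>{-\<delta><..<\<delta>}. fst (z t) \<in> cim c \<and> (z has_vector_derivative GG c (z t)) (at t)))" for \<sigma> \<delta> R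
  have "\<exists>\<delta> R. QQ \<sigma> \<delta> R" for \<sigma>
  proof -
    have "(x0, V \<sigma> x0) \<in> cim c \<times> UNIV" using x0 by simp
    obtain \<delta> R where "0 < \<delta>" "0 < R" "\<And>z1. z1 \<in> ball (x0, V \<sigma> x0) R \<Longrightarrow>
      \<exists>z. z 0 = z1 \<and> (\<forall>t\<in>{-\<delta><..<\<delta>}. fst (z t) \<in> cim c \<and> (z has_vector_derivative GG c (z t)) (at t))"
    proof (rule local_flow[OF c \<open>(x0, V \<sigma> x0) \<in> cim c \<times> UNIV\<close>])
      fix \<delta> R assume "0 < \<delta>" "0 < R" "\<And>z1. z1 \<in> ball (x0, V \<sigma> x0) R \<Longrightarrow>
      \<exists>z. z 0 = z1 \<and> (\<forall>t\<in>{-\<delta><..<\<delta>}. fst (z t) \<in> cim c \<and> (z has_vector_derivative GG c (z t)) (at t))"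
      then show thesis by (rule that)
    qed
    then have "QQ \<sigma> \<delta> R" unfolding QQ_def by (intro conjI ballI)
    then show ?thesis by blast
  qed
  then obtain \<delta> R where QQ: "\<And>\<sigma>. QQ \<sigma> (\<delta> \<sigma>) (R \<sigma>)" by metis
  have \<delta>: "0 < \<delta> \<sigma>" and R: "0 < R \<sigma>"
    and flow: "z1 \<in> ball (x0, V \<sigma> x0) (R \<sigma>) \<Longrightarrow>
      \<exists>z. z 0 = z1 \<and> (\<forall>t\<in>{-\<delta> \<sigma><..<\<delta> \<sigma>}. fst (z t) \<in> cim c \<and> (z has_vector_derivative GG c (z t)) (at t))"
    for \<sigma> z1
    using QQ[of \<sigma>] unfolding QQ_def by blast+
  have "\<exists>d>0. \<sigma> * \<sigma> = 1 \<longrightarrow> (\<forall>y\<in>ball x0 d. (y, V \<sigma> y) \<in> ball (x0, V \<sigma> x0) (R \<sigma>))" for \<sigma> :: real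
  proof (cases "\<sigma> * \<sigma> = 1")
    case True
    have "isCont (N \<sigma>) x0"
      using Ck_on_imp_continuous_on[OF Ns[OF True]] \<rho>[OF True] by (simp add: continuous_on_eq_continuous_at)
    moreover have "isCont ?\<eta> x0"
      using Ck_on_imp_continuous_on[OF coord_normal_smooth[OF c]] x0(1)
      unfolding continuous_on_eq_continuous_at[OF chartD(2)[OF c]] by blast
    ultimately have "isCont (\<lambda>y. (y, V \<sigma> y)) x0" unfolding V_def by (intro continuous_intros)
    then obtain d where "d > 0" "\<forall>y. dist y x0 < d \<longrightarrow> dist (y, V \<sigma> y) (x0, V \<sigma> x0) < R \<sigma>"
      unfolding continuous_at_eps_delta using R by blast
    then show ?thesis by (intro exI[of _ d]) (auto simp: dist_commute)
  qed (auto intro: exI[of _ 1])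
  then obtain d where d: "\<And>\<sigma>::real. 0 < d \<sigma>"
    and dV: "\<And>(\<sigma>::real) y. \<sigma> * \<sigma> = 1 \<Longrightarrow> y \<in> ball x0 (d \<sigma>) \<Longrightarrow> (y, V \<sigma> y) \<in> ball (x0, V \<sigma> x0) (R \<sigma>)"
    by metis
  obtain r1 where r1: "0 < r1" "cball x0 r1 \<subseteq> cim c" using chartD(2)[OF c] x0(1) open_contains_cball by blast
  \<comment> \<open>r0 serves the chart and both signs; the smaller r also serves the flow, and the
    gap between them leaves room for the closure of S' inside S''.\<close>
  define r0 where "r0 = min r1 (min (\<rho> 1) (\<rho> (-1)))"
  define r where "r = min (r0 / 2) (min (d 1) (d (-1)))"
  have r0: "0 < r0" using r1 \<rho>[of 1] \<rho>[of "-1"] by (simp add: r0_def)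
  have r: "0 < r" "r < r0" using r0 d[of 1] d[of "-1"] by (auto simp: r_def)
  have pm: "\<sigma> = 1 \<or> \<sigma> = -1" if "\<sigma> * \<sigma> = 1" for \<sigma> :: real using that by (simp add: square_eq_1_iff)
  have ball_\<rho>: "ball x0 r0 \<subseteq> ball x0 (\<rho> \<sigma>)" and ball_d: "ball x0 r \<subseteq> ball x0 (d \<sigma>)" if "\<sigma> * \<sigma> = 1" for \<sigma>
    using pm[OF that] by (auto simp: r0_def r_def)
  have ball_c: "ball x0 r0 \<subseteq> cim c" "cball x0 r \<subseteq> cim c" using r1 r by (auto simp: r0_def)
  define X where "X = {q \<in> cdom c. cmap c q \<in> ball x0 r}"
  define X' where "X' = {q \<in> cdom c. cmap c q \<in> ball x0 r0}"
  have Xo: "open X" "open X'" unfolding X_def X'_def by (intro open_chart_preimage[OF c] open_ball)+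
  have XX': "X \<subseteq> X'" using r by (auto simp: X_def X'_def)
  have p0X: "p0 \<in> X" using p0c r by (simp add: X_def x0_def)
  define S' where "S' = S \<inter> X"
  define S'' where "S'' = S \<inter> X'"
  define B where "B = ball x0 r \<inter> {y. y $ i = 0}"
  have hyper: "hypersurface A (S \<inter> Y)" if "open Y" "Y \<subseteq> cdom c" for Y
    unfolding hypersurface_def
  proof
    fix p assume "p \<in> S \<inter> Y"
    then have "p \<in> cdom (restrict_chart c Y)" using that by auto
    moreover have "slice_chart A (S \<inter> Y) (restrict_chart c Y) i" by (rule slice_restrict[OF cs that(1)]) auto
    ultimately show "\<exists>c i. slice_chart A (S \<inter> Y) c i \<and> p \<in> cdom c" by blast
  qed
  have hS': "hypersurface A S'" and hS'': "hypersurface A S''"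
    unfolding S'_def S''_def by (intro hyper Xo; auto simp: X_def X'_def)+
  define e where "e = restrict_chart c X"
  have es: "slice_chart A S' e i" unfolding e_def S'_def by (rule slice_restrict[OF cs Xo(1)]) auto
  note eA = slice_chartD[OF es]
  have edom: "cdom e = X" "cmap e = cmap c" by (auto simp: e_def X_def)
  have S'e: "q \<in> S' \<Longrightarrow> q \<in> cdom e" for q by (simp add: edom S'_def)
  have S'c: "q \<in> cdom c" "cmap c q \<in> ball x0 r" "cmap c q $ i = 0" if "q \<in> S'" for q
    using that slice_mem[OF cs, of q] by (auto simp: S'_def X_def)
  have S''c: "q \<in> cdom c" "cmap c q \<in> ball x0 r0" "cmap c q $ i = 0" if "q \<in> S''" for q
    using that slice_mem[OF cs, of q] by (auto simp: S''_def X'_def)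
  have cimS: "cinv c y \<in> S \<and> cinv c y \<in> cdom c \<and> cmap c (cinv c y) = y" if "y \<in> cim c" "y $ i = 0" for y
    using slice_point[OF cs that] cmap_cinv[OF c that(1)] by simp
  have BS: "cinv c ` B = S'"
  proof
    show "cinv c ` B \<subseteq> S'"
    proof
      fix q assume "q \<in> cinv c ` B"
      then obtain y where y: "q = cinv c y" "y \<in> ball x0 r" "y $ i = 0" by (auto simp: B_def)
      then have "y \<in> cim c" using ball_c(2) by auto
      from cimS[OF this y(3)] y show "q \<in> S'" by (auto simp: S'_def X_def)
    qed
    show "S' \<subseteq> cinv c ` B"
    proof
      fix q assume "q \<in> S'"
      note S'c[OF this]
      then show "q \<in> cinv c ` B" using cinv_cmap[OF c] by (auto simp: B_def intro!: image_eqI[of _ _ "cmap c q"])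
    qed
  qed
  have Bc: "B \<subseteq> cim c" using ball_c(2) by (auto simp: B_def)
  have conv: "convex B"
    unfolding B_def
    by (intro convex_Int convex_ball) (simp add: convex_def)
  have contB: "continuous_on B (cinv c)" using continuous_on_subset[OF continuous_on_cinv[OF c] Bc] .
  have conn: "connected S'" unfolding BS[symmetric] using connected_continuous_image[OF contB convex_connected[OF conv]] .
  have simp_conn: "simply_connected S'"
  proof (rule simply_connected_retraction_gen[OF convex_imp_simply_connected[OF conv] contB BS])
    show "continuous_on S' (cmap c)" using continuous_on_subset[OF continuous_on_cmap[OF c]] S'c by blast
    show "cmap c \<in> S' \<rightarrow> B" using S'c by (auto simp: B_def)
    show "cinv c (cmap c y) = y" if "y \<in> S'" for y using cinv_cmap[OF c S'c(1)[OF that]] .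
  qed
  \<comment> \<open>The closed counterpart of B: its image in M is compact, hence closed, and so
    contains the closure of S'.\<close>
  define C where "C = cball x0 r \<inter> {y. y $ i = 0}"
  have Ccomp: "compact C" unfolding C_def
    by (intro compact_Int_closed compact_cball closed_Collect_eq continuous_intros)
  have Cc: "C \<subseteq> cim c" using ball_c(2) by (auto simp: C_def)
  have compC: "compact (cinv c ` C)" by (rule compact_continuous_image[OF continuous_on_subset[OF continuous_on_cinv[OF c] Cc] Ccomp])
  have "S' \<subseteq> cinv c ` C" unfolding BS[symmetric] by (auto simp: B_def C_def)
  then have clos: "closure S' \<subseteq> cinv c ` C" using compact_imp_closed[OF compC] closure_minimal by blast
  have ccl: "compact (closure S')"
    using compC clos compact_Int_closed[OF compC closed_closure[of S']] by (simp add: Int_absorb1)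
  have CS'': "cinv c ` C \<subseteq> S''"
  proof
    fix q assume "q \<in> cinv c ` C"
    then obtain y where y: "q = cinv c y" "y \<in> cball x0 r" "y $ i = 0" by (auto simp: C_def)
    then have "y \<in> cim c" using ball_c(2) by auto
    from cimS[OF this y(3)] y r show "q \<in> S''" by (auto simp: S''_def X'_def)
  qed
  \<comment> \<open>A point at coordinate distance exactly r from x0, in a direction k other than i,
    belongs to S'' but not to S'.\<close>
  have neS: "S'' \<noteq> S'"
  proof
    assume eq: "S'' = S'"
    have "\<not> (UNIV :: 'n set) \<subseteq> {i}" using n2 card_mono[of "{i}" "UNIV :: 'n set"] by auto
    then obtain k where k: "k \<noteq> i" by blast
    let ?y = "x0 + r *\<^sub>R axis k 1"
    have "norm (axis k 1 :: real^'n) = 1" by (rule norm_axis_1)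
    then have dy: "dist x0 ?y = r" using r by (simp add: dist_norm)
    have "(axis k 1 :: real^'n) $ i = 0" using k by (simp add: axis_def)
    then have y: "?y \<in> cball x0 r" "?y $ i = 0" "dist x0 ?y = r" using x0 dy by simp_all
    then have "?y \<in> cim c" using ball_c(2) by auto
    note cy = cimS[OF this y(2)]
    have "cinv c ?y \<in> S''" using CS'' y by (auto simp: C_def)
    then have "cmap c (cinv c ?y) \<in> ball x0 r" using eq S'c(2) by blast
    then show False using cy y(3) by simp
  qed
  have rc: "relatively_compact_in A S' S''"
    unfolding relatively_compact_in_def using hS'' neS ccl clos CS'' by blast
  have tc: "transformation_class A S'"
    unfolding transformation_class_def using hS' conn simp_conn ccl rc by blast
  \<comment> \<open>\<open>tangent_to\<close> constrains components in slice charts of S', while c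
    is a slice chart of S. The restriction e of c is one for S', and its components are those of
    c.\<close>
  have tang: "w \<in> tangent_space A q" "w c $ i = 0" if q: "q \<in> S'" and w: "w \<in> tangent_to A S' q" for q w
  proof -
    show wT: "w \<in> tangent_space A q" using w by (simp add: tangent_to_def)
    have "w e $ i = 0" using w es S'e[OF q] by (auto simp: tangent_to_def)
    moreover have "w c = w e"
    proof -
      have "w c = TD e c q (w e)"
        using tangent_spaceD[OF wT eA S'e[OF q]] tvec_of_apply[OF c S'c(1)[OF q], of e "w e"] by simp
      then show ?thesis using TD_restrict[OF c Xo(1) S'c(1)[OF q]] q by (simp add: e_def S'_def)
    qed
    ultimately show "w c $ i = 0" by simp
  qed
  define ne where "ne q = tvec_of A c q (?\<eta> (cmap c q))" for q
  have ne_field: "unit_normal_field A g S' ne"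
    unfolding unit_normal_field_def
  proof (intro conjI ballI allI impI)
    fix q assume q: "q \<in> S'"
    note qc = S'c(1)[OF q]
    have xq: "cmap c q \<in> cim c" using qc by blast
    show "ne q \<in> tangent_space A q" unfolding ne_def by (rule tvec_of_in[OF c qc])
    show "g q (ne q) (ne q) = 1" unfolding ne_def metric_tvec_of[OF c qc] by (rule coord_normal_unit[OF c xq])
    show "g q (ne q) w = 0" if w: "w \<in> tangent_to A S' q" for w
    proof -
      obtain \<kappa> where "\<And>a. (gm c (cmap c q) *v ?\<eta> (cmap c q)) \<bullet> a = \<kappa> * a $ i" using coord_normal_orth[OF c xq] by blast
      then show ?thesis
        unfolding ne_def metric_chart[OF c qc tvec_of_in[OF c qc] tang(1)[OF q w]] tvec_of_self[OF c qc]
        by (simp add: tang(2)[OF q w])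
    qed
  next
    fix dd j assume dj: "slice_chart A S' dd j"
    note dA = slice_chartD[OF dj]
    show "smooth_in_slice dd j (\<lambda>p. ne p dd)"
    proof (rule smooth_in_slice_local[OF dj])
      fix p assume p: "p \<in> S'" "p \<in> cdom dd"
      let ?W = "cmap c ` (cdom c \<inter> cdom dd)" and ?T = "cmap dd \<circ> cinv c"
      let ?h = "\<lambda>x. frechet_derivative ?T (at x) (?\<eta> x)"
      have W: "open ?W" using open_chart_image[OF c chartD(1)[OF dA]] .
      have "smooth_on ?W ?h"
        by (intro smooth_onI Ck_on_derivative[OF W smooth_onD[OF smooth_transition[OF c dA]]]
            Ck_on_subset[OF coord_normal_smooth[OF c]]) blast
      moreover have "ne q dd = ?h (cmap c q)" if qW: "q \<in> S'" "q \<in> cdom c" "cmap c q \<in> ?W" for q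
      proof -
        obtain q' where "cmap c q = cmap c q'" "q' \<in> cdom c" "q' \<in> cdom dd" using qW(3) by blast
        then have "q \<in> cdom dd" using cinv_cmap[OF c] qW(2) by metis
        then show ?thesis by (simp add: ne_def tvec_of_apply[OF dA] TD_def)
      qed
      moreover have "cmap c p \<in> ?W" using p S'c(1) by blast
      ultimately show "\<exists>c\<in>A. p \<in> cdom c \<and> (\<exists>W h'. open W \<and> cmap c p \<in> W \<and> smooth_on W h' \<and>
         (\<forall>q\<in>S'. q \<in> cdom c \<longrightarrow> cmap c q \<in> W \<longrightarrow> ne q dd = h' (cmap c q)))"
        using c S'c(1)[OF p(1)] W by blast
    qed
  qed
  have main: "\<exists>\<nu>. transformation_function A S' \<nu> \<and> \<nu> p0 = \<nu>0 \<and> (\<exists>\<delta> f. is_shift A g F S' n \<nu> \<delta> f \<and>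
        (\<forall>c i k p. slice_chart A S' c i \<and> k \<noteq> i \<and> p \<in> S' \<inter> cdom c \<longrightarrow>
          (deviation A g f c k p has_real_derivative 0) (at 0)))"
    if n: "unit_normal_field A g S' n" for n
  proof -
    have nT: "n q \<in> tangent_space A q" "g q (n q) (n q) = 1" "\<And>u. u \<in> tangent_to A S' q \<Longrightarrow> g q (n q) u = 0" if "q \<in> S'" for q
      using n that unfolding unit_normal_field_def by blast+
    \<comment> \<open>The factor between the given normal and the coordinate normal. It is
      continuous with values 1 and -1 on the connected set B, hence constant.\<close>
    define \<theta> where "\<theta> y = (gm c y *v ?\<eta> y) \<bullet> n (cinv c y) c" for y
    have nq: "n q c = \<theta> (cmap c q) *\<^sub>R ?\<eta> (cmap c q)" "\<theta> (cmap c q) * \<theta> (cmap c q) = 1" if q: "q \<in> S'" for q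
    proof -
      note qc = S'c(1)[OF q]
      have xq: "cmap c q \<in> cim c" using qc by blast
      have u: "(gm c (cmap c q) *v n q c) \<bullet> n q c = 1"
        using metric_chart[OF c qc nT(1)[OF q] nT(1)[OF q]] nT(2)[OF q] by simp
      have "(gm c (cmap c q) *v n q c) \<bullet> a = 0" if a: "a $ i = 0" for a
      proof -
        have "tvec_of A e q a = tvec_of A c q a"
          using tvec_of_change[OF eA S'e[OF q] c qc, of a] TD_restrict[OF c Xo(1) qc] q by (simp add: e_def S'_def)
        then have "tvec_of A c q a \<in> tangent_to A S' q" using tangent_to_slice[OF es q S'e[OF q] a] by simp
        from nT(3)[OF q this] show ?thesis
          using metric_chart[OF c qc nT(1)[OF q] tvec_of_in[OF c qc], of a] by (simp add: tvec_of_self[OF c qc])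
      qed
      from unit_normal_coord[OF c xq u this]
      show "n q c = \<theta> (cmap c q) *\<^sub>R ?\<eta> (cmap c q)" "\<theta> (cmap c q) * \<theta> (cmap c q) = 1"
        by (simp_all add: \<theta>_def cinv_cmap[OF c qc])
    qed
    have sq: "\<theta> y * \<theta> y = 1" if "y \<in> B" for y
    proof -
      have "cinv c y \<in> S'" using that BS by blast
      from nq(2)[OF this] show ?thesis using cmap_cinv[OF c] Bc that by auto
    qed
    have "continuous_on B (\<lambda>y. n (cinv c y) c)"
    proof -
      have "smooth_in_slice e i (\<lambda>p. n p e)" using n es unfolding unit_normal_field_def by blast
      then have ce: "continuous_on {x. zero_coord i x \<in> cim e} (\<lambda>x. n (cinv e (zero_coord i x)) e)"
        unfolding smooth_in_slice_def using Ck_on_imp_continuous_on smooth_onD by blast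
      have z: "zero_coord i y = y" "y \<in> cim e" if "y \<in> B" for y
      proof -
        show "zero_coord i y = y" using that by (simp add: B_def zero_coord_id)
        have "cinv c y \<in> S'" using BS that by blast
        then have "cmap c (cinv c y) \<in> cim e" using S'e by (metis edom(2) imageI)
        then show "y \<in> cim e" using cmap_cinv[OF c] Bc that by auto
      qed
      have cB: "continuous_on B (\<lambda>x. n (cinv e (zero_coord i x)) e)" by (rule continuous_on_subset[OF ce]) (use z in auto)
      have eq: "n (cinv e (zero_coord i y)) e = n (cinv c y) c" if "y \<in> B" for y
      proof -
        have "y \<in> cmap c ` (cdom c \<inter> X)" using z(2)[OF that] by (simp add: e_def)
        then have ce: "cinv e y = cinv c y" unfolding e_def by (rule restrict_chart(2)[OF c Xo(1)])
        have q: "cinv c y \<in> S'" using BS that by blast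
        have "n (cinv c y) c = TD e c (cinv c y) (n (cinv c y) e)"
          using tangent_spaceD[OF nT(1)[OF q] eA S'e[OF q]] tvec_of_apply[OF c S'c(1)[OF q], of e "n (cinv c y) e"] by simp
        moreover have "TD e c (cinv c y) a = a" for a
          using TD_restrict[OF c Xo(1) S'c(1)[OF q]] q by (simp add: e_def S'_def)
        ultimately show ?thesis by (simp add: z(1)[OF that] ce)
      qed
      show ?thesis by (rule continuous_on_eq[OF cB eq])
    qed
    then have "continuous_on B \<theta>"
      unfolding \<theta>_def[abs_def]
      by (intro bounded_bilinear.continuous_on[OF bounded_bilinear_inner] bounded_bilinear.continuous_on[OF bounded_bilinear_matrix_vector]
          continuous_on_subset[OF Ck_on_imp_continuous_on[OF metric_smooth[OF c]] Bc]
          continuous_on_subset[OF Ck_on_imp_continuous_on[OF coord_normal_smooth[OF c]] Bc])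
    then have con: "connected (\<theta> ` B)" using connected_continuous_image convex_connected[OF conv] by blast
    have x0B: "x0 \<in> B" using x0 r by (simp add: B_def)
    define \<sigma> where "\<sigma> = \<theta> x0"
    have \<sigma>: "\<sigma> * \<sigma> = 1" unfolding \<sigma>_def by (rule sq[OF x0B])
    have const: "\<theta> y = \<sigma>" if y: "y \<in> B" for y
    proof (rule ccontr)
      assume ne: "\<theta> y \<noteq> \<sigma>"
      then have "(\<theta> y = 1 \<and> \<sigma> = -1) \<or> (\<theta> y = -1 \<and> \<sigma> = 1)" using pm[OF sq[OF y]] pm[OF \<sigma>] by auto
      then have "-1 \<in> \<theta> ` B" "1 \<in> \<theta> ` B" using y x0B by (auto simp: \<sigma>_def image_iff) metis+
      then have "{-1..1} \<subseteq> \<theta> ` B" using connected_contains_Icc[OF con] by blast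
      then have "0 \<in> \<theta> ` B" by auto
      then obtain u where u: "u \<in> B" "\<theta> u = 0" by (metis imageE)
      show False using sq[OF u(1)] u(2) by simp
    qed
    have cB: "cmap c q \<in> B" if "q \<in> S'" for q using S'c[OF that] by (simp add: B_def)
    have n\<eta>: "n q c = \<sigma> *\<^sub>R ?\<eta> (cmap c q)" if "q \<in> S'" for q using nq(1)[OF that] const[OF cB[OF that]] by simp
    \<comment> \<open>Since n is \<sigma> times the coordinate normal, the initial velocity \<nu> n
      is N times that normal, as in the system solved by N, and the initial value \<sigma> \<nu>0 of
      N becomes \<nu>0 for \<nu>.\<close>
    define \<nu> where "\<nu> q = \<sigma> * N \<sigma> (cmap c q)" for q
    have V: "\<nu> q *\<^sub>R n q c = V \<sigma> (cmap c q)" if "q \<in> S'" for q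
      using \<sigma> by (simp add: n\<eta>[OF that] \<nu>_def V_def algebra_simps)
    have tf: "transformation_function A S' \<nu>"
      unfolding transformation_function_def
    proof (intro exI[of _ S''] exI[of _ \<nu>] conjI ballI)
      show "relatively_compact_in A S' S''" by (rule rc)
      show "smooth_function_on A S'' \<nu>"
        unfolding smooth_function_on_def
      proof (intro allI impI)
        fix dd j assume dj: "slice_chart A S'' dd j"
        show "smooth_in_slice dd j \<nu>"
        proof (rule smooth_in_slice_local[OF dj])
          fix p assume p: "p \<in> S''" "p \<in> cdom dd"
          have B0: "open (ball x0 r0)" by simp
          have "smooth_on (ball x0 r0) (\<lambda>x. \<sigma> * N \<sigma> x)"
            by (intro smooth_onI Ck_on_mult[OF B0] Ck_on_const[OF B0] Ck_on_subset[OF Ns[OF \<sigma>] ball_\<rho>[OF \<sigma>]])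
          then show "\<exists>c\<in>A. p \<in> cdom c \<and> (\<exists>W h'. open W \<and> cmap c p \<in> W \<and> smooth_on W h' \<and>
             (\<forall>q\<in>S''. q \<in> cdom c \<longrightarrow> cmap c q \<in> W \<longrightarrow> \<nu> q = h' (cmap c q)))"
            using c S''c(1,2)[OF p(1)] B0 by (intro bexI[of _ c] conjI exI[of _ "ball x0 r0"] exI[of _ "\<lambda>x. \<sigma> * N \<sigma> x"]) (auto simp: \<nu>_def)
        qed
      qed
      show "\<nu> p \<noteq> 0" if "p \<in> closure S'" for p
      proof -
        have "p \<in> S''" using that clos CS'' by blast
        then have "N \<sigma> (cmap c p) \<noteq> 0" using Nz[OF \<sigma>] S''c(2) ball_\<rho>[OF \<sigma>] by blast
        then show ?thesis using \<sigma> by (auto simp: \<nu>_def)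
      qed
    qed simp
    have \<nu>p0: "\<nu> p0 = \<nu>0" using \<sigma> N0[OF \<sigma>] by (simp add: \<nu>_def x0_def[symmetric] mult.assoc[symmetric])
    have "\<exists>z. q \<in> S' \<longrightarrow> z 0 = (cmap c q, V \<sigma> (cmap c q)) \<and>
        (\<forall>t\<in>{-\<delta> \<sigma><..<\<delta> \<sigma>}. fst (z t) \<in> cim c \<and> (z has_vector_derivative GG c (z t)) (at t))" for q
    proof (cases "q \<in> S'")
      case True
      have "cmap c q \<in> ball x0 (d \<sigma>)" using S'c(2)[OF True] ball_d[OF \<sigma>] by blast
      from flow[OF dV[OF \<sigma> this]] show ?thesis by blast
    qed simp
    then obtain z where z0: "\<And>q. q \<in> S' \<Longrightarrow> z q 0 = (cmap c q, V \<sigma> (cmap c q))"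
      and z: "\<And>q t. q \<in> S' \<Longrightarrow> t \<in> {-\<delta> \<sigma><..<\<delta> \<sigma>} \<Longrightarrow> fst (z q t) \<in> cim c"
        "\<And>q t. q \<in> S' \<Longrightarrow> t \<in> {-\<delta> \<sigma><..<\<delta> \<sigma>} \<Longrightarrow> (z q has_vector_derivative GG c (z q t)) (at t)"
      by metis
    define f where "f t q = cinv c (fst (z q t))" for t q
    have sh: "is_shift A g F S' n \<nu> (\<delta> \<sigma>) f"
      unfolding is_shift_def
    proof (intro conjI ballI \<delta>)
      fix q assume q: "q \<in> S'"
      note qc = S'c(1)[OF q]
      have I: "open {-\<delta> \<sigma><..<\<delta> \<sigma>}" "0 \<in> {-\<delta> \<sigma><..<\<delta> \<sigma>}" using \<delta>[of \<sigma>] by auto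
      show "trajectory A g F {-\<delta> \<sigma><..<\<delta> \<sigma>} (\<lambda>t. f t q)"
        unfolding f_def by (rule trajectory_of_chart(1)[OF c I(1)]) (rule z[OF q], assumption)+
      have tr0: "velocity A (\<lambda>t. cinv c (fst (z q t))) 0 = tvec_of A c (cinv c (fst (z q 0))) (snd (z q 0))"
        by (rule trajectory_of_chart(2)[OF c I(1) _ _ I(2)]) (rule z[OF q], assumption)+
      show "f 0 q = q" by (simp add: f_def z0[OF q] cinv_cmap[OF c qc])
      have "velocity A (\<lambda>t. f t q) 0 = tvec_of A c q (\<nu> q *\<^sub>R n q c)"
        unfolding f_def using tr0 by (simp add: z0[OF q] cinv_cmap[OF c qc] V[OF q])
      then show "velocity A (\<lambda>t. f t q) 0 = (\<lambda>c. \<nu> q *\<^sub>R n q c)"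
        using tangent_spaceD[OF tangent_space_scaleR[OF nT(1)[OF q]] c qc] by simp
    qed
    have "(deviation A g f dd k p has_real_derivative 0) (at 0)"
      if dj: "slice_chart A S' dd j" and k: "k \<noteq> j" and p: "p \<in> S'" "p \<in> cdom dd" for dd j k p
    proof -
      note dA = slice_chartD[OF dj] and pc = S'c(1)[OF p(1)]
      have \<nu>s: "smooth_function_on A S' \<nu>" by (rule transformation_function_smooth[OF hS' tf])
      let ?k = "axis k 1 :: real^'n" and ?y = "cmap c p"
      have kj: "?k $ j = 0" using k by (simp add: axis_def)
      let ?u = "tvec_of A dd p ?k"
      define a where "a = TD dd c p ?k"
      have uT: "?u \<in> tangent_to A S' p" by (rule tangent_to_slice[OF dj p kj])
      have ua: "?u c = a" by (simp add: a_def tvec_of_apply[OF c pc])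
      have ai: "a $ i = 0" using tang(2)[OF p(1) uT] by (simp add: ua)
      let ?D\<nu> = "frechet_derivative (\<lambda>x. \<nu> (cinv dd (zero_coord j x))) (at (cmap dd p)) ?k"
      have 1: "((\<lambda>s. \<nu> (cinv dd (cmap dd p + s *\<^sub>R ?k))) has_vector_derivative ?D\<nu>) (at 0)"
        by (rule slice_derivative[OF dj _ p kj]) (use \<nu>s dj in \<open>auto simp: smooth_function_on_def\<close>)
      have "?y \<in> ball x0 r0" using S'c(2)[OF p(1)] r by simp
      then have yB: "?y \<in> ball x0 (\<rho> \<sigma>)" using ball_\<rho>[OF \<sigma>] by blast
      have "((\<lambda>s. N \<sigma> ((cmap c \<circ> cinv dd) (cmap dd p + s *\<^sub>R ?k))) has_vector_derivative frechet_derivative (N \<sigma>) (at ?y) a) (at 0)"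
      proof (rule has_vector_derivative_chain[where f = "N \<sigma>"])
        show "((\<lambda>s. (cmap c \<circ> cinv dd) (cmap dd p + s *\<^sub>R ?k)) has_vector_derivative a) (at 0)"
          unfolding a_def by (rule has_vector_derivative_chain[where f = "cmap c \<circ> cinv dd", OF line_deriv])
            (use TD_has_derivative[OF dA c p(2) pc] in \<open>simp del: o_apply\<close>)
        show "(N \<sigma> has_derivative frechet_derivative (N \<sigma>) (at ?y)) (at ((cmap c \<circ> cinv dd) (cmap dd p + 0 *\<^sub>R ?k)))"
          using Ck_on_Suc_has_derivative[OF Ns[OF \<sigma>] yB] by (simp add: cinv_cmap[OF dA p(2)])
      qed
      from bounded_linear.has_vector_derivative[OF bounded_linear_mult_right[of \<sigma>] this]
      have "((\<lambda>s. \<nu> (cinv dd (cmap dd p + s *\<^sub>R ?k))) has_vector_derivative \<sigma> * frechet_derivative (N \<sigma>) (at ?y) a) (at 0)"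
        by (simp add: \<nu>_def)
      from vector_derivative_unique_at[OF 1 this] have D\<nu>: "?D\<nu> = \<sigma> * frechet_derivative (N \<sigma>) (at ?y) a" .
      have "\<nu> p * ?D\<nu> = (\<sigma> * \<sigma>) * (N \<sigma> ?y * frechet_derivative (N \<sigma>) (at ?y) a)" unfolding D\<nu> by (simp add: \<nu>_def)
      also have "\<dots> = - (Fd c ?y (V \<sigma> ?y) \<bullet> a)"
        using Neq[OF \<sigma> yB S'c(3)[OF p(1)] ai] \<sigma> by (simp add: V_def)
      finally have e1: "\<nu> p * ?D\<nu> = - (Fd c ?y (V \<sigma> ?y) \<bullet> a)" .
      have wT: "(\<lambda>d. \<nu> p *\<^sub>R n p d) \<in> tangent_space A p" by (rule tangent_space_scaleR[OF nT(1)[OF p(1)]])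
      have "g p (F p (\<lambda>d. \<nu> p *\<^sub>R n p d)) ?u = (gm c ?y *v F p (\<lambda>d. \<nu> p *\<^sub>R n p d) c) \<bullet> a"
        unfolding ua[symmetric] by (rule metric_chart[OF c pc force_in[OF wT] tang(1)[OF p(1) uT]])
      also have "F p (\<lambda>d. \<nu> p *\<^sub>R n p d) c = Fu c ?y (V \<sigma> ?y)" using force_chart[OF c pc wT] by (simp add: V[OF p(1)])
      finally have e2: "g p (F p (\<lambda>d. \<nu> p *\<^sub>R n p d)) ?u = Fd c ?y (V \<sigma> ?y) \<bullet> a" by (simp add: force_down_def)
      show ?thesis using deviation_derivative[OF dj k p n \<nu>s sh] unfolding e1 e2 by simp
    qed
    with tf \<nu>p0 sh show ?thesis by blast
  qed
  show "\<exists>S'\<subseteq>S. p0 \<in> S' \<and> transformation_class A S' \<and> (\<exists>n. unit_normal_field A g S' n) \<and>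
     (\<forall>n. unit_normal_field A g S' n \<longrightarrow>
       (\<exists>\<nu>. transformation_function A S' \<nu> \<and> \<nu> p0 = \<nu>0 \<and> (\<exists>\<delta> f. is_shift A g F S' n \<nu> \<delta> f \<and>
          (\<forall>c i k p. slice_chart A S' c i \<and> k \<noteq> i \<and> p \<in> S' \<inter> cdom c \<longrightarrow>
             (deviation A g f c k p has_real_derivative 0) (at 0)))))"
    using tc ne_field main p0 p0X by (intro exI[of _ S'] conjI) (auto simp: S'_def)
qed

end

theorem theorem9p5:
  fixes A :: "('m::{t2_space,second_countable_topology}, 'n::finite) chart set"
    and g :: "('m, 'n) metric"
    and F :: "('m, 'n) force"
  assumes "smooth_manifold A"
    and "riemannian_metric A g"
    and "force_field A F"
    and "CARD('n) \<ge> 3"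
  shows "additional_normality A g F \<longleftrightarrow>
    (\<forall>p. \<forall>v\<in>tangent_space A p. v \<noteq> (\<lambda>_. 0) \<longrightarrow> (\<forall>c\<in>A. p \<in> cdom c \<longrightarrow>
      (let x = cmap c p;
           P = projector A g c p v;
           N = unit_up g c p v;
           F_dn = (\<lambda>i. force_down A g F c x (v c) $ i);
           vF_up = (\<lambda>i k. vgrad_up A F c i k x (v c));
           vF_dn = (\<lambda>i k. vgrad_down A g F c i k x (v c));
           sF_dn = (\<lambda>i k. sgrad_down A g F c i k x (v c))
       in \<forall>\<epsilon> \<sigma>.
         (\<Sum>i\<in>UNIV. \<Sum>j\<in>UNIV. P i \<epsilon> * P j \<sigma> *
            ((\<Sum>m\<in>UNIV. N m * (F_dn i * vF_dn m j / sqrt (g p v v))) - sF_dn i j))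
         = (\<Sum>i\<in>UNIV. \<Sum>j\<in>UNIV. P i \<epsilon> * P j \<sigma> *
            ((\<Sum>m\<in>UNIV. N m * (F_dn j * vF_dn m i / sqrt (g p v v))) - sF_dn j i))
         \<and>
         (\<Sum>i\<in>UNIV. \<Sum>j\<in>UNIV. P j \<sigma> * vF_up j i * P \<epsilon> i)
         = (\<Sum>i\<in>UNIV. \<Sum>j\<in>UNIV. \<Sum>m\<in>UNIV.
              P j m * vF_up j i * P m i / (real CARD('n) - 1) * P \<epsilon> \<sigma>))))"
    (is "?N \<longleftrightarrow> ?R" is "_ \<longleftrightarrow> (\<forall>p. \<forall>v\<in>_ p. _ v \<longrightarrow> (\<forall>c\<in>A. _ p c \<longrightarrow> ?eq p v c))")
proof -
  interpret newtonian A g F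
    by unfold_locales (fact assms)+
  have n2: "2 \<le> CARD('n)" using assms(4) by simp
  have nonzero: "v c \<noteq> 0 \<longleftrightarrow> v \<noteq> (\<lambda>_. 0)"
    if "v \<in> tangent_space A p" "c \<in> A" "p \<in> cdom c" for v p c
    using tangent_spaceD[OF that] tvec_of_zero[OF that(2,3)] by auto
  show ?thesis
  proof (intro iffI allI ballI impI)
    fix p v c
    assume AN: "additional_normality A g F" and v: "v \<in> tangent_space A p" "v \<noteq> (\<lambda>_. 0)" and c: "c \<in> A" "p \<in> cdom c"
    have "v c \<noteq> 0" using nonzero[OF v(1) c] v(2) by blast
    from normality_imp_compat[OF AN c v(1) this] normal_equations_iff[OF c v n2] show "?eq p v c"
      by (rule rev_iffD2)
  next
    assume R: ?R
    show "additional_normality A g F"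
    proof (rule compat_imp_normality[OF _ n2])
      fix c p v assume c: "c \<in> A" "p \<in> cdom c" and v: "v \<in> tangent_space A p" "v c \<noteq> 0"
      have v0: "v \<noteq> (\<lambda>_. 0)" using nonzero[OF v(1) c] v(2) by blast
      from R v(1) v0 c normal_equations_iff[OF c v(1) v0 n2] show "compat c (cmap c p) (v c)" by blast
    qed
  qed
qed

end
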